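(* Let $Q$ be an abelian group and $\mathfrak{g}$ a finite dimensional $Q$-graded semi-simple Lie algebra over an algebraically closed field $\Bbbk$ of characteristic $0$. Then any finite dimensional $Q$-graded module $V$ over $\mathfrak{g}$ is completely reducible as a graded module, that is, $V$ is a direct sum of $Q$-graded simple submodules of $V$.
   Context: A $Q$-graded Lie algebra over $\Bbbk$ is a Lie algebra $\mathfrak{g}=\bigoplus_{\alpha\in Q}\mathfrak{g}_\alpha$ with $[\mathfrak{g}_\alpha,\mathfrak{g}_\beta]\subset\mathfrak{g}_{\alpha+\beta}$ for all $\alpha,\beta\in Q$; it is graded simple if it is not commutative and does not contain any non-trivial graded ideal (i.e. any graded ideal other than $0$ and $\mathfrak{g}$). A finite dimensional $Q$-graded Lie algebra is $Q$-graded semi-simple if it is a finite direct sum of $Q$-graded ideals each of which is a $Q$-graded simple Lie algebra. A $Q$-graded $\mathfrak{g}$-module is a $\mathfrak{g}$-module $V=\bigoplus_{\alpha\in Q}V_\alpha$ with $\mathfrak{g}_\alpha V_\beta\subset V_{\alpha+\beta}$ for all $\alpha,\beta\in Q$. A $Q$-graded module $V$ is called graded simple if $\mathfrak{g}V\neq 0$ and $V$ does not contain any non-trivial graded submodule (i.e. any graded submodule other than $0$ and $V$).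
   Formalization: Since graded simple requires gV ≠ 0, the claim fails for a one-dimensional trivial module; the formal version lets each summand be either graded simple or a one-dimensional graded submodule on which g acts by zero. *)

theory Defs
  imports "HOL-Computational_Algebra.Polynomial"
begin

context vector_space
begin

definition fin_dim :: "'b set \<Rightarrow> bool" where
  "fin_dim V \<longleftrightarrow> (\<exists>B. finite B \<and> span B = V)"

text \<open>
  Internal direct sum of the subspaces \<open>W i\<close>, for \<open>i\<close> in a possibly infinite index set \<open>I\<close>:
  every element of \<open>V\<close> is a sum of components \<open>c i\<close> in \<open>W i\<close>, almost all zero, for exactly one
  family \<open>c\<close>. Setting \<open>c i = 0\<close> outside \<open>I\<close> makes \<open>c\<close> unique as a function.
\<close>

definition direct_sum :: "'b set \<Rightarrow> 'i set \<Rightarrow> ('i \<Rightarrow> 'b set) \<Rightarrow> bool" where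
  "direct_sum V I W \<longleftrightarrow>
     subspace V \<and> (\<forall>i\<in>I. subspace (W i) \<and> W i \<subseteq> V) \<and>
     (\<forall>v\<in>V. \<exists>!c. (\<forall>i\<in>I. c i \<in> W i) \<and> (\<forall>i. i \<notin> I \<longrightarrow> c i = 0) \<and>
                finite {i. c i \<noteq> 0} \<and> v = (\<Sum>i | c i \<noteq> 0. c i))"

end

text \<open>
  Algebras and modules live on carrier sets, so that graded ideals and graded submodules, with
  the induced grading, are again instances of the same locales.
\<close>

locale lie_algebra = vector_space scale
  for scale :: "'k::field \<Rightarrow> 'g::ab_group_add \<Rightarrow> 'g" +
  fixes L :: "'g set" and bracket :: "'g \<Rightarrow> 'g \<Rightarrow> 'g"
  assumes subspace_carrier: "subspace L"
    and bracket_closed: "x \<in> L \<Longrightarrow> y \<in> L \<Longrightarrow> bracket x y \<in> L"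
    and bracket_add_left:
      "x \<in> L \<Longrightarrow> y \<in> L \<Longrightarrow> z \<in> L \<Longrightarrow> bracket (x + y) z = bracket x z + bracket y z"
    and bracket_add_right:
      "x \<in> L \<Longrightarrow> y \<in> L \<Longrightarrow> z \<in> L \<Longrightarrow> bracket x (y + z) = bracket x y + bracket x z"
    and bracket_scale_left:
      "x \<in> L \<Longrightarrow> y \<in> L \<Longrightarrow> bracket (scale c x) y = scale c (bracket x y)"
    and bracket_scale_right:
      "x \<in> L \<Longrightarrow> y \<in> L \<Longrightarrow> bracket x (scale c y) = scale c (bracket x y)"
    and bracket_self: "x \<in> L \<Longrightarrow> bracket x x = 0"
    and jacobi: "x \<in> L \<Longrightarrow> y \<in> L \<Longrightarrow> z \<in> L \<Longrightarrow>
      bracket x (bracket y z) + bracket y (bracket z x) + bracket z (bracket x y) = 0"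

locale graded_lie_algebra = lie_algebra scale L bracket
  for scale :: "'k::field \<Rightarrow> 'g::ab_group_add \<Rightarrow> 'g"
    and L :: "'g set" and bracket :: "'g \<Rightarrow> 'g \<Rightarrow> 'g" +
  fixes grade :: "'q::ab_group_add \<Rightarrow> 'g set"
  assumes grading: "direct_sum L UNIV grade"
    and bracket_grade:
      "x \<in> grade \<alpha> \<Longrightarrow> y \<in> grade \<beta> \<Longrightarrow> bracket x y \<in> grade (\<alpha> + \<beta>)"
begin

definition graded_ideal :: "'g set \<Rightarrow> bool" where
  "graded_ideal J \<longleftrightarrow>
     subspace J \<and> J \<subseteq> L \<and> (\<forall>x\<in>L. \<forall>y\<in>J. bracket x y \<in> J) \<and>
     direct_sum J UNIV (\<lambda>\<alpha>. J \<inter> grade \<alpha>)"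

end

locale graded_simple_lie_algebra = graded_lie_algebra +
  assumes not_commutative: "\<exists>x\<in>L. \<exists>y\<in>L. bracket x y \<noteq> 0"
    and graded_ideal_trivial: "graded_ideal J \<Longrightarrow> J = {0} \<or> J = L"

locale graded_semisimple_lie_algebra = graded_lie_algebra +
  assumes finite_dimensional: "fin_dim L"
    and sum_of_simple_ideals:
      "\<exists>(n::nat) J. direct_sum L {..<n} J \<and>
         (\<forall>i<n. graded_ideal (J i) \<and>
                graded_simple_lie_algebra scale (J i) bracket (\<lambda>\<alpha>. J i \<inter> grade \<alpha>))"

locale graded_lie_module =
  graded_lie_algebra scale L bracket grade + vs: vector_space scaleV
  for scale :: "'k::field \<Rightarrow> 'g::ab_group_add \<Rightarrow> 'g"
    and L :: "'g set" and bracket :: "'g \<Rightarrow> 'g \<Rightarrow> 'g"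
    and grade :: "'q::ab_group_add \<Rightarrow> 'g set"
    and scaleV :: "'k \<Rightarrow> 'v::ab_group_add \<Rightarrow> 'v" +
  fixes V :: "'v set" and act :: "'g \<Rightarrow> 'v \<Rightarrow> 'v" and gradeV :: "'q \<Rightarrow> 'v set"
  assumes subspace_module: "vs.subspace V"
    and act_closed: "x \<in> L \<Longrightarrow> v \<in> V \<Longrightarrow> act x v \<in> V"
    and act_add_left:
      "x \<in> L \<Longrightarrow> y \<in> L \<Longrightarrow> v \<in> V \<Longrightarrow> act (x + y) v = act x v + act y v"
    and act_add_right:
      "x \<in> L \<Longrightarrow> v \<in> V \<Longrightarrow> w \<in> V \<Longrightarrow> act x (v + w) = act x v + act x w"
    and act_scale_left:
      "x \<in> L \<Longrightarrow> v \<in> V \<Longrightarrow> act (scale c x) v = scaleV c (act x v)"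
    and act_scale_right:
      "x \<in> L \<Longrightarrow> v \<in> V \<Longrightarrow> act x (scaleV c v) = scaleV c (act x v)"
    and act_bracket: "x \<in> L \<Longrightarrow> y \<in> L \<Longrightarrow> v \<in> V \<Longrightarrow>
      act (bracket x y) v = act x (act y v) - act y (act x v)"
    and module_grading: "vs.direct_sum V UNIV gradeV"
    and act_grade: "x \<in> grade \<alpha> \<Longrightarrow> v \<in> gradeV \<beta> \<Longrightarrow> act x v \<in> gradeV (\<alpha> + \<beta>)"
begin

definition graded_submodule :: "'v set \<Rightarrow> bool" where
  "graded_submodule W \<longleftrightarrow>
     vs.subspace W \<and> W \<subseteq> V \<and> (\<forall>x\<in>L. \<forall>w\<in>W. act x w \<in> W) \<and>
     vs.direct_sum W UNIV (\<lambda>\<alpha>. W \<inter> gradeV \<alpha>)"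

end

locale graded_simple_lie_module = graded_lie_module +
  assumes act_nonzero: "\<exists>x\<in>L. \<exists>v\<in>V. act x v \<noteq> 0"
    and graded_submodule_trivial: "graded_submodule W \<Longrightarrow> W = {0} \<or> W = V"

context graded_lie_module
begin

text \<open>
  Graded simple modules have nonzero action, which excludes the trivial module of dimension
  one. That module has no proper nonzero submodule either, hence it is listed separately among
  the summands of a completely reducible module.
\<close>

definition trivial_line :: "'v set \<Rightarrow> bool" where
  "trivial_line W \<longleftrightarrow> vs.dim W = 1 \<and> (\<forall>x\<in>L. \<forall>w\<in>W. act x w = 0)"

definition graded_completely_reducible :: bool where
  "graded_completely_reducible \<longleftrightarrow>
     (\<exists>(n::nat) W. vs.direct_sum V {..<n} W \<and>
        (\<forall>i<n. graded_submodule (W i) \<and>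
           (graded_simple_lie_module scale L bracket grade
              scaleV (W i) act (\<lambda>\<alpha>. W i \<inter> gradeV \<alpha>) \<or>
            trivial_line (W i))))"

end

end

theory Submission
  imports Defs "HOL-Library.Function_Algebras"
begin

text \<open>
  The theorem is a graded version of Weyl's theorem, and the proof follows the classical one: a
  Casimir operator shows that every cocycle with values in a finite-dimensional module is a
  coboundary, and cocycles measure the obstruction to a complement. The question is where the
  grading enters.

  A graded simple ideal \<open>J\<close> has no nontrivial graded ideal, but it may well have ungraded ones, so the
  classical arguments apply to it only as long as they produce graded objects.
  For a graded module \<open>U\<close> the trace form \<open>tr (x y)\<close> pairs degrees \<open>a\<close> and \<open>b\<close> to zero unless \<open>a + b = 0\<close>
  (\<open>trace_form_orthogonal\<close>), even if \<open>Q\<close> has torsion, so its radical on \<open>J\<close> is a graded ideal and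
  therefore \<open>0\<close> or \<open>J\<close>. In the second case Cartan's criterion (\<open>cartan_criterion\<close>) makes \<open>J\<close> act trivially,
  as \<open>J\<close> is perfect. So the form is nondegenerate on every \<open>J\<close> that acts nontrivially, and the Casimir
  operator of \<open>J\<close> commutes with the algebra (\<open>casimir_commute\<close>), preserves degrees
  (\<open>casimir_projection\<close>) and has the nonzero trace \<open>dim J\<close> (\<open>trace_casimir\<close>).

  Cartan's criterion is proved for perfect algebras only. Comparing the eigenvalues of \<open>x\<close> on \<open>U\<close> with
  their images under a linear functional over the rational numbers shows that the elements of \<open>J\<close> act
  nilpotently when the trace form vanishes on \<open>J\<close> (\<open>perfect_isotropic_nilpotent\<close>); Engel's theorem (\<open>engel\<close>) then makes long products of
  elements vanish, and perfectness makes short products vanish as well.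

  For a cocycle with values in \<open>U\<close> (\<open>cocycle_is_coboundary\<close>), subtracting a coboundary moves the values
  into the kernel of a power of the Casimir operator, a proper graded submodule of \<open>U\<close>, and induction
  on the dimension applies. Once all simple ideals act trivially, cocycles vanish because the algebra
  is perfect. For a graded submodule \<open>W\<close> of \<open>V\<close>, this is applied to the graded module of linear maps
  from \<open>V / W\<close> to \<open>W\<close> and yields a projection onto \<open>W\<close> that commutes with the algebra. Its part of degree
  zero has a graded kernel, which is a complement of \<open>W\<close> (\<open>stable_complement\<close>).
\<close>

section \<open>Operators on finite-dimensional subspaces\<close>

locale linear_space = vector_space scale
  for scale :: "'a::field \<Rightarrow> 'b::ab_group_add \<Rightarrow> 'b"
begin

definition endo :: "('b \<Rightarrow> 'b) \<Rightarrow> bool" where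
  "endo f \<longleftrightarrow> Vector_Spaces.linear scale scale f"

definition endo_on :: "'b set \<Rightarrow> ('b \<Rightarrow> 'b) \<Rightarrow> bool" where
  "endo_on U f \<longleftrightarrow> endo f \<and> (\<forall>u\<in>U. f u \<in> U)"

lemma endo_iff: "endo f \<longleftrightarrow> (\<forall>x y. f (x + y) = f x + f y) \<and> (\<forall>c x. f (scale c x) = scale c (f x))"
  using vector_space_axioms by (auto simp: endo_def Vector_Spaces.linear_iff)

lemma endo_add: "endo f \<Longrightarrow> f (x + y) = f x + f y"
  and endo_scale: "endo f \<Longrightarrow> f (scale c x) = scale c (f x)"
  by (auto simp: endo_iff)

lemma endo_module_hom: "endo f \<Longrightarrow> module_hom scale scale f"
  by (simp add: endo_def module_hom_iff_linear)

lemma endo_zero: "endo f \<Longrightarrow> f 0 = 0"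
  and endo_diff: "endo f \<Longrightarrow> f (x - y) = f x - f y"
  and endo_sum: "endo f \<Longrightarrow> f (sum g S) = (\<Sum>a\<in>S. f (g a))"
  using module_hom.zero[OF endo_module_hom] module_hom.diff[OF endo_module_hom]
    module_hom.sum[OF endo_module_hom] by auto

lemma endo_onD: "endo_on U f \<Longrightarrow> endo f" "endo_on U f \<Longrightarrow> u \<in> U \<Longrightarrow> f u \<in> U"
  by (auto simp: endo_on_def)

lemma endo_comp: "endo f \<Longrightarrow> endo g \<Longrightarrow> endo (\<lambda>x. f (g x))"
  by (simp add: endo_iff)

lemma endo_closures:
  "endo f \<Longrightarrow> endo g \<Longrightarrow> endo (\<lambda>x. f x + g x)"
  "endo f \<Longrightarrow> endo g \<Longrightarrow> endo (\<lambda>x. f x - g x)"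
  "endo f \<Longrightarrow> endo (\<lambda>x. scale c (f x))"
  "endo (\<lambda>x. x)" "endo (\<lambda>x. 0)"
  by (auto simp: endo_iff scale_right_distrib scale_right_diff_distrib)

lemma endo_sum_fun: "(\<And>i. i \<in> I \<Longrightarrow> endo (f i)) \<Longrightarrow> endo (\<lambda>x. \<Sum>i\<in>I. f i x)"
  by (induction I rule: infinite_finite_induct) (simp_all add: endo_closures)

lemma endo_funpow: "endo f \<Longrightarrow> endo (f ^^ n)"
proof (induction n)
  case (Suc n)
  then show ?case using endo_comp[of f "f ^^ n"] by (simp add: o_def)
qed (simp add: endo_iff)

lemma endo_on_comp: "endo_on U f \<Longrightarrow> endo_on U g \<Longrightarrow> endo_on U (\<lambda>x. f (g x))"
  by (simp add: endo_on_def endo_comp)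

lemma endo_on_closures:
  "subspace U \<Longrightarrow> endo_on U f \<Longrightarrow> endo_on U g \<Longrightarrow> endo_on U (\<lambda>x. f x + g x)"
  "subspace U \<Longrightarrow> endo_on U f \<Longrightarrow> endo_on U g \<Longrightarrow> endo_on U (\<lambda>x. f x - g x)"
  "subspace U \<Longrightarrow> endo_on U f \<Longrightarrow> endo_on U (\<lambda>x. scale c (f x))"
  "endo_on U (\<lambda>x. x)" "subspace U \<Longrightarrow> endo_on U (\<lambda>x. 0)"
  by (auto simp: endo_on_def endo_closures subspace_add subspace_diff subspace_scale subspace_0)

lemma endo_on_sum:
  "subspace U \<Longrightarrow> (\<And>i. i \<in> I \<Longrightarrow> endo_on U (f i)) \<Longrightarrow> endo_on U (\<lambda>x. \<Sum>i\<in>I. f i x)"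
  by (auto simp: endo_on_def intro!: endo_sum_fun subspace_sum)

lemma endo_on_funpow: "endo_on U f \<Longrightarrow> endo_on U (f ^^ n)"
proof -
  have "(f ^^ n) u \<in> U" if "endo_on U f" "u \<in> U" for u
    using that by (induction n) (auto simp: endo_on_def)
  then show "endo_on U f \<Longrightarrow> endo_on U (f ^^ n)" by (simp add: endo_on_def endo_funpow)
qed

lemma fin_dim_subspaceD: "fin_dim U \<Longrightarrow> subspace U"
  by (auto simp: fin_dim_def)

lemma fin_dim_basis:
  assumes "fin_dim U"
  obtains B where "finite B" "independent B" "span B = U" "card B = dim U"
proof -
  obtain B0 where B0: "finite B0" "span B0 = U" using assms by (auto simp: fin_dim_def)
  obtain B where B: "B \<subseteq> U" "independent B" "U \<subseteq> span B" "card B = dim U"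
    using basis_exists by blast
  have "finite B" using independent_span_bound[OF B0(1) B(2)] B B0 by auto
  moreover have "span B = U"
    using B fin_dim_subspaceD[OF assms] by (intro span_subspace) auto
  ultimately show thesis using that B by blast
qed

lemma fin_dim_subset:
  assumes "fin_dim V" "subspace U" "U \<subseteq> V"
  shows "fin_dim U" "dim U \<le> dim V" "dim V \<le> dim U \<Longrightarrow> U = V"
proof -
  obtain C where C: "finite C" "independent C" "span C = V" "card C = dim V"
    using fin_dim_basis[OF assms(1)] .
  obtain B where B: "B \<subseteq> U" "independent B" "U \<subseteq> span B" "card B = dim U"
    using basis_exists by blast
  have fB: "finite B" and cB: "card B \<le> card C"
    using independent_span_bound[OF C(1) B(2)] B C assms by auto
  have sB: "span B = U" using B assms by (intro span_subspace) auto
  show "fin_dim U" using fB sB by (auto simp: fin_dim_def)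
  show "dim U \<le> dim V" using cB B C by simp
  assume le: "dim V \<le> dim U"
  show "U = V"
  proof (rule ccontr)
    assume "U \<noteq> V"
    then obtain v where v: "v \<in> V" "v \<notin> U" using assms by auto
    have "independent (insert v B)" using v sB B by (intro independent_insertI) auto
    then have "card (insert v B) \<le> card C"
      using independent_span_bound[OF C(1), of "insert v B"] v B C assms by auto
    moreover have "v \<notin> B" using v B by auto
    ultimately show False using fB le B C by simp
  qed
qed

lemma dim_less:
  assumes "fin_dim V" "subspace U" "U \<subset> V"
  shows "dim U < dim V"
proof (rule ccontr)
  assume "\<not> dim U < dim V"
  then have "U = V" using fin_dim_subset(3)[OF assms(1,2)] assms(3) by auto
  then show False using assms(3) by simp
qed

lemma fin_dim_image:
  assumes "fin_dim U" "endo f"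
  shows "fin_dim (f ` U)"
proof -
  obtain B where "finite B" "span B = U" using assms by (auto simp: fin_dim_def)
  then have "span (f ` B) = f ` U" using module_hom.span_image[OF endo_module_hom[OF assms(2)]] by auto
  then show ?thesis using \<open>finite B\<close> by (auto simp: fin_dim_def intro!: exI[of _ "f ` B"])
qed

lemma subspace_endo_image: "endo f \<Longrightarrow> subspace U \<Longrightarrow> subspace (f ` U)"
  using module_hom.subspace_image endo_module_hom by blast

lemma subspace_endo_kernel: "endo f \<Longrightarrow> subspace U \<Longrightarrow> subspace {u \<in> U. f u = 0}"
  by (auto simp: subspace_def endo_add endo_scale endo_zero)

lemma inj_endo_on_surj:
  assumes "fin_dim U" "endo_on U f" "\<And>u. u \<in> U \<Longrightarrow> f u = 0 \<Longrightarrow> u = 0"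
  shows "f ` U = U"
proof -
  note f = endo_onD[OF assms(2)]
  obtain B where B: "finite B" "independent B" "span B = U" "card B = dim U"
    using fin_dim_basis[OF assms(1)] .
  have inj: "inj_on f U"
  proof (rule inj_onI)
    fix x y assume xy: "x \<in> U" "y \<in> U" "f x = f y"
    then have "f (x - y) = 0" using endo_diff[OF f(1)] by simp
    then have "x - y = 0"
      using assms(3)[of "x - y"] xy subspace_diff fin_dim_subspaceD[OF assms(1)] by blast
    then show "x = y" by simp
  qed
  have BU: "B \<subseteq> U" using B span_superset by blast
  have "independent (f ` B)"
    using module_hom.independent_injective_image[OF endo_module_hom[OF f(1)] B(2)] inj B(3) by simp
  moreover have "card (f ` B) = card B" using inj BU by (meson card_image inj_on_subset)
  moreover have "span (f ` B) = f ` U"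
    using module_hom.span_image[OF endo_module_hom[OF f(1)]] B by auto
  ultimately have "dim (f ` U) = dim U"
    using dim_eq_card_independent[of "f ` B"] B dim_span[of "f ` B"] by simp
  then show ?thesis
    using fin_dim_subset(3)[OF assms(1), of "f ` U"] f subspace_endo_image[OF f(1)]
      fin_dim_subspaceD[OF assms(1)] by auto
qed

text \<open>Images of powers of an operator on a finite-dimensional space shrink, hence stabilise.\<close>

lemma funpow_image_stabilises:
  assumes U: "fin_dim U" and f: "endo_on U f"
  obtains n where "\<And>m. n \<le> m \<Longrightarrow> (f ^^ m) ` U = (f ^^ n) ` U"
proof -
  note sU = fin_dim_subspaceD[OF U]
  obtain n where n: "\<And>m. dim ((f ^^ n) ` U) \<le> dim ((f ^^ m) ` U)"
    using arg_min_nat_le[of "\<lambda>_. True" _ "\<lambda>n. dim ((f ^^ n) ` U)"]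
      ex_has_least_nat[of "\<lambda>_. True" 0 "\<lambda>n. dim ((f ^^ n) ` U)"] by blast
  have "(f ^^ m) ` U = (f ^^ n) ` U" if nm: "n \<le> m" for m
  proof (rule fin_dim_subset(3))
    show "fin_dim ((f ^^ n) ` U)"
      using fin_dim_image U endo_onD(1)[OF endo_on_funpow[OF f]] by blast
    show "subspace ((f ^^ m) ` U)"
      using subspace_endo_image sU endo_onD(1)[OF endo_on_funpow[OF f]] by blast
    obtain k where k: "m = n + k" using le_Suc_ex[OF nm] by blast
    have "(f ^^ m) u \<in> (f ^^ n) ` U" if "u \<in> U" for u
    proof -
      have "(f ^^ m) u = (f ^^ n) ((f ^^ k) u)" by (simp add: k funpow_add)
      then show ?thesis using endo_onD(2)[OF endo_on_funpow[OF f] that, of k] by auto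
    qed
    then show "(f ^^ m) ` U \<subseteq> (f ^^ n) ` U" by auto
  qed (fact n)
  then show thesis using that by blast
qed

section \<open>The trace of an operator on a finite-dimensional subspace\<close>

text \<open>
  The basis is an arbitrary choice; lemma \<open>trace_on_eq\<close> frees the trace of it.
\<close>

definition trace_on :: "'b set \<Rightarrow> ('b \<Rightarrow> 'b) \<Rightarrow> 'a" where
  "trace_on U f = (let B = (SOME B. independent B \<and> span B = U)
                   in \<Sum>b\<in>B. representation B (f b) b)"

lemma sum_rep: "independent B \<Longrightarrow> finite B \<Longrightarrow> u \<in> span B \<Longrightarrow>
    (\<Sum>b\<in>B. scale (representation B u b) b) = u"
  by (rule sum_representation_eq) auto

lemma endo_rep: "independent B \<Longrightarrow> finite B \<Longrightarrow> u \<in> span B \<Longrightarrow> endo f \<Longrightarrow>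
    f u = (\<Sum>b\<in>B. scale (representation B u b) (f b))"
  by (subst sum_rep[symmetric, of B u], assumption+) (simp add: endo_sum endo_scale)

lemma endo_eq_on_basis: "independent B \<Longrightarrow> finite B \<Longrightarrow> u \<in> span B \<Longrightarrow> endo f \<Longrightarrow> endo g \<Longrightarrow>
    (\<And>b. b \<in> B \<Longrightarrow> f b = g b) \<Longrightarrow> f u = g u"
  by (simp add: endo_rep)

lemma rep_endo: "independent B \<Longrightarrow> finite B \<Longrightarrow> u \<in> span B \<Longrightarrow> independent C \<Longrightarrow> endo f \<Longrightarrow>
    (\<And>b. b \<in> B \<Longrightarrow> f b \<in> span C) \<Longrightarrow>
    representation C (f u) c = (\<Sum>b\<in>B. representation B u b * representation C (f b) c)"
  by (subst endo_rep[of B u f], assumption+)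
     (simp add: representation_sum representation_scale span_scale)

text \<open>
  The common source of two facts: \<open>B = C\<close> gives the symmetry of the trace of a product, and
  \<open>g = id\<close> gives its independence of the basis. Both sides are the same double sum over \<open>B \<times> C\<close>.
\<close>

lemma basis_sum_commute:
  assumes B: "independent B" "finite B" and C: "independent C" "finite C" and sp: "span B = span C"
    and f: "endo_on (span B) f" and g: "endo_on (span B) g"
  shows "(\<Sum>b\<in>B. representation B (f (g b)) b) = (\<Sum>c\<in>C. representation C (g (f c)) c)"
proof -
  have gb: "g b \<in> span C" if "b \<in> B" for b using endo_onD(2)[OF g] that sp span_base by auto
  have fc: "f c \<in> span B" if "c \<in> C" for c using endo_onD(2)[OF f] that sp span_base by auto
  have "(\<Sum>b\<in>B. representation B (f (g b)) b)
      = (\<Sum>b\<in>B. \<Sum>c\<in>C. representation C (g b) c * representation B (f c) b)"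
    using rep_endo[OF C gb B(1) endo_onD(1)[OF f] fc] by (intro sum.cong) auto
  also have "\<dots> = (\<Sum>c\<in>C. \<Sum>b\<in>B. representation B (f c) b * representation C (g b) c)"
    by (subst sum.swap) (simp add: mult.commute)
  also have "\<dots> = (\<Sum>c\<in>C. representation C (g (f c)) c)"
    using rep_endo[OF B fc C(1) endo_onD(1)[OF g] gb] by (intro sum.cong) auto
  finally show ?thesis .
qed

lemma trace_on_eq:
  assumes B: "independent B" "finite B" "span B = U" and f: "endo_on U f"
  shows "trace_on U f = (\<Sum>b\<in>B. representation B (f b) b)"
proof -
  define C where "C = (SOME B. independent B \<and> span B = U)"
  have C: "independent C" "span C = U"
    using someI[of "\<lambda>B. independent B \<and> span B = U" B] B by (auto simp: C_def)
  have fC: "finite C" using independent_span_bound[OF B(2) C(1)] B C span_superset by auto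
  show ?thesis
    using basis_sum_commute[OF B(1,2) C(1) fC, of f "\<lambda>x. x"] B C f
    by (simp add: trace_on_def C_def[symmetric] endo_on_closures)
qed

lemma trace_on_commute:
  assumes "fin_dim U" "endo_on U f" "endo_on U g"
  shows "trace_on U (\<lambda>x. f (g x)) = trace_on U (\<lambda>x. g (f x))"
proof -
  obtain B where B: "finite B" "independent B" "span B = U" using fin_dim_basis[OF assms(1)] .
  show ?thesis
    using basis_sum_commute[OF B(2,1) B(2,1), of f g] assms B
    by (simp add: trace_on_eq[OF B(2,1,3)] endo_on_comp)
qed

lemma trace_on_lincomb:
  assumes U: "fin_dim U" and f: "endo_on U f" and g: "endo_on U g"
  shows "trace_on U (\<lambda>x. f x + g x) = trace_on U f + trace_on U g"
    and "trace_on U (\<lambda>x. f x - g x) = trace_on U f - trace_on U g"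
    and "trace_on U (\<lambda>x. scale c (f x)) = c * trace_on U f"
proof -
  obtain B where B: "finite B" "independent B" "span B = U" using fin_dim_basis[OF U] .
  note [simp] = trace_on_eq[OF B(2,1,3)] endo_on_closures fin_dim_subspaceD[OF U] f g
  have sp: "f b \<in> span B" "g b \<in> span B" if "b \<in> B" for b
    using endo_onD(2)[OF f, of b] endo_onD(2)[OF g, of b] span_base[OF that] B(3) by auto
  show "trace_on U (\<lambda>x. f x + g x) = trace_on U f + trace_on U g"
    using B(2) sp by (simp add: sum.distrib representation_add)
  show "trace_on U (\<lambda>x. f x - g x) = trace_on U f - trace_on U g"
    using B(2) sp by (simp add: sum_subtractf representation_diff)
  show "trace_on U (\<lambda>x. scale c (f x)) = c * trace_on U f"
    using B(2) sp by (simp add: sum_distrib_left representation_scale)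
qed

lemma trace_on_zero: "trace_on U (\<lambda>x. 0) = 0"
  by (simp add: trace_on_def Let_def representation_zero)

lemma trace_on_sum:
  assumes U: "fin_dim U" and f: "\<And>i. i \<in> I \<Longrightarrow> endo_on U (f i)"
  shows "trace_on U (\<lambda>x. \<Sum>i\<in>I. f i x) = (\<Sum>i\<in>I. trace_on U (f i))"
  using f
proof (induction I rule: infinite_finite_induct)
  case (insert i I)
  then show ?case
    using trace_on_lincomb(1)[OF U, of "f i" "\<lambda>x. \<Sum>i\<in>I. f i x"] fin_dim_subspaceD[OF U]
    by (simp add: endo_on_sum)
qed (auto simp: trace_on_zero)

lemma trace_on_cong:
  assumes "fin_dim U" "endo_on U f" "endo_on U g" "\<And>u. u \<in> U \<Longrightarrow> f u = g u"
  shows "trace_on U f = trace_on U g"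
proof -
  obtain B where B: "finite B" "independent B" "span B = U" using fin_dim_basis[OF assms(1)] .
  have "f b = g b" if "b \<in> B" for b using assms(4) that B span_base by blast
  then show ?thesis using assms by (simp add: trace_on_eq[OF B(2,1,3)])
qed

text \<open>
  In a basis of \<open>U\<close> extending one of \<open>U'\<close>, the basis vectors outside \<open>U'\<close> contribute nothing.
\<close>

lemma trace_on_subspace:
  assumes U: "fin_dim U" and f: "endo_on U f" and U': "subspace U'" "U' \<subseteq> U"
    and fU': "\<And>u. u \<in> U \<Longrightarrow> f u \<in> U'"
  shows "trace_on U f = trace_on U' f"
proof -
  obtain B' where B': "finite B'" "independent B'" "span B' = U'"
    using fin_dim_basis[OF fin_dim_subset(1)[OF U U']] .
  have "B' \<subseteq> U" using B' U' span_superset by blast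
  then obtain B where B: "B' \<subseteq> B" "B \<subseteq> U" "independent B" "U \<subseteq> span B"
    using maximal_independent_subset_extend[OF _ B'(2)] by metis
  obtain B0 where B0: "finite B0" "span B0 = U" using U by (auto simp: fin_dim_def)
  have fB: "finite B" using independent_span_bound[OF B0(1) B(3)] B B0 by auto
  have sB: "span B = U" using B fin_dim_subspaceD[OF U] by (intro span_subspace) auto
  have f': "endo_on U' f" using f fU' U' by (auto simp: endo_on_def)
  have r: "representation B (f b) = representation B' (f b)" if "b \<in> B" for b
    using representation_extend[OF B(3) _ B(1)] B'(3) fU' that B(2) by blast
  have "(\<Sum>b\<in>B. representation B (f b) b) = (\<Sum>b\<in>B'. representation B' (f b) b)"
  proof (rule sum.mono_neutral_cong_right[OF fB B(1)])
    show "\<forall>b\<in>B - B'. representation B (f b) b = 0"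
      using r representation_ne_zero by fastforce
  qed (use r B in auto)
  then show ?thesis
    using trace_on_eq[OF B(3) fB sB f] trace_on_eq[OF B'(2,1,3) f'] by simp
qed

lemma trace_on_funpow_image:
  assumes U: "fin_dim U" and f: "endo_on U f"
  shows "trace_on U f = trace_on ((f ^^ n) ` U) f"
proof (induction n)
  case (Suc n)
  let ?W = "(f ^^ n) ` U"
  note fn = endo_on_funpow[OF f]
  have "trace_on ?W f = trace_on (f ` ?W) f"
  proof (rule trace_on_subspace)
    show "fin_dim ?W" using fin_dim_image[OF U endo_onD(1)[OF fn]] .
    show "endo_on ?W f"
      using endo_onD[OF f] funpow_swap1[of f n] by (auto simp: endo_on_def)
    show "subspace (f ` ?W)"
      using subspace_endo_image endo_onD(1)[OF fn] endo_onD(1)[OF f] fin_dim_subspaceD[OF U] by blast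
    show "f ` ?W \<subseteq> ?W" using funpow_swap1[of f n] endo_onD[OF f] by auto
  qed auto
  then show ?case using Suc by (simp add: image_comp)
qed simp

text \<open>
  The trace may be computed on the image of any power of \<open>f\<close>, here on \<open>{0}\<close>.
\<close>

lemma trace_on_nilpotent:
  assumes "fin_dim U" "endo_on U f" "\<And>u. u \<in> U \<Longrightarrow> (f ^^ n) u = 0"
  shows "trace_on U f = 0"
proof -
  have "(f ^^ n) ` U = {0}"
    using assms(3) subspace_0[OF fin_dim_subspaceD[OF assms(1)]] by force
  then have "trace_on U f = trace_on {0} f" using trace_on_funpow_image[OF assms(1,2), of n] by simp
  also have "\<dots> = (\<Sum>b\<in>{}. representation {} (f b) b)"
    using endo_zero[OF endo_onD(1)[OF assms(2)]] endo_onD(1)[OF assms(2)]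
    by (intro trace_on_eq) (auto simp: endo_on_def independent_empty)
  finally show ?thesis by simp
qed

end

section \<open>Generalised eigenvectors\<close>

context linear_space
begin

definition shift_by :: "('b \<Rightarrow> 'b) \<Rightarrow> 'a \<Rightarrow> 'b \<Rightarrow> 'b" where
  "shift_by f a = (\<lambda>x. f x - scale a x)"

definition gen_eigenspace :: "('b \<Rightarrow> 'b) \<Rightarrow> 'a \<Rightarrow> 'b set" where
  "gen_eigenspace f a = {v. \<exists>n. (shift_by f a ^^ n) v = 0}"

lemma shift_by_apply: "shift_by f a x = f x - scale a x"
  by (simp add: shift_by_def)

lemma endo_scale_self: "endo (\<lambda>x. scale c x)"
  by (simp add: endo_iff scale_right_distrib)

lemma endo_shift_by: "endo f \<Longrightarrow> endo (shift_by f a)"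
  by (simp add: shift_by_def endo_closures endo_scale_self)

lemma endo_on_shift_by: "subspace U \<Longrightarrow> endo_on U f \<Longrightarrow> endo_on U (shift_by f a)"
  by (simp add: endo_on_def endo_shift_by) (simp add: shift_by_def subspace_diff subspace_scale)

lemma funpow_zero_mono:
  assumes "endo g" "(g ^^ n) v = 0" "n \<le> m"
  shows "(g ^^ m) v = 0"
proof -
  have "(g ^^ m) v = (g ^^ (m - n)) ((g ^^ n) v)"
    using assms(3) by (metis comp_apply funpow_add le_add_diff_inverse2)
  then show ?thesis using assms endo_zero[OF endo_funpow[OF assms(1)]] by simp
qed

lemma subspace_gen_eigenspace:
  assumes f: "endo f"
  shows "subspace (gen_eigenspace f a)"
proof -
  note g = endo_shift_by[OF f, of a]
  have "x + y \<in> gen_eigenspace f a" if xy: "x \<in> gen_eigenspace f a" "y \<in> gen_eigenspace f a" for x y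
  proof -
    obtain n m where "(shift_by f a ^^ n) x = 0" "(shift_by f a ^^ m) y = 0"
      using xy by (auto simp: gen_eigenspace_def)
    then have "(shift_by f a ^^ (n + m)) x = 0" "(shift_by f a ^^ (n + m)) y = 0"
      using funpow_zero_mono[OF g] by auto
    then have "(shift_by f a ^^ (n + m)) (x + y) = 0"
      by (simp add: endo_add[OF endo_funpow[OF g]])
    then show ?thesis unfolding gen_eigenspace_def by blast
  qed
  moreover have "scale c x \<in> gen_eigenspace f a" if x: "x \<in> gen_eigenspace f a" for c x
    using x by (auto simp: gen_eigenspace_def endo_scale[OF endo_funpow[OF g]])
  moreover have "0 \<in> gen_eigenspace f a"
    using endo_zero[OF endo_funpow[OF g]] by (auto simp: gen_eigenspace_def)
  ultimately show ?thesis by (intro subspaceI) auto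
qed

lemma funpow_commute:
  assumes "\<And>x. h (g x) = g (h x)"
  shows "h ((g ^^ n) x) = (g ^^ n) (h x)"
  by (induction n) (simp_all add: assms)

lemma gen_eigenspace_commuting:
  assumes f: "endo f" and h: "endo h" and c: "\<And>x. h (f x) = f (h x)"
    and v: "v \<in> gen_eigenspace f a"
  shows "h v \<in> gen_eigenspace f a"
proof -
  have "h (shift_by f a x) = shift_by f a (h x)" for x
    by (simp add: shift_by_def endo_diff[OF h] endo_scale[OF h] c)
  then have "(shift_by f a ^^ n) (h v) = h ((shift_by f a ^^ n) v)" for n
    using funpow_commute[of h "shift_by f a"] by simp
  moreover obtain n where "(shift_by f a ^^ n) v = 0" using v by (auto simp: gen_eigenspace_def)
  ultimately have "(shift_by f a ^^ n) (h v) = 0" using endo_zero[OF h] by simp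
  then show ?thesis unfolding gen_eigenspace_def by blast
qed

lemma shift_by_commute: "endo f \<Longrightarrow> shift_by f a (f x) = f (shift_by f a x)"
  by (simp add: shift_by_def endo_diff endo_scale)

text \<open>
  The last nonzero vector among the \<open>(f - a)^k v\<close> is an eigenvector for \<open>a\<close>, on which \<open>f - b\<close> is
  multiplication by the nonzero scalar \<open>a - b\<close>.
\<close>

lemma gen_eigenspace_disjoint:
  assumes f: "endo f" and v: "v \<in> gen_eigenspace f a" "v \<in> gen_eigenspace f b" and ab: "a \<noteq> b"
  shows "v = 0"
proof (rule ccontr)
  assume nz: "v \<noteq> 0"
  define n where "n = (LEAST n. (shift_by f a ^^ n) v = 0)"
  have n: "(shift_by f a ^^ n) v = 0"
    using v(1) unfolding n_def gen_eigenspace_def by (auto intro: LeastI)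
  with nz obtain k where k: "n = Suc k" by (cases n) auto
  define w where "w = (shift_by f a ^^ k) v"
  have w0: "w \<noteq> 0"
    using not_less_Least[of k "\<lambda>n. (shift_by f a ^^ n) v = 0"] k n_def by (auto simp: w_def)
  have "shift_by f a w = 0" using n k by (simp add: w_def)
  then have fw: "f w = scale a w" by (simp add: shift_by_def)
  have "w \<in> gen_eigenspace f b" unfolding w_def
    using gen_eigenspace_commuting[OF f endo_funpow[OF endo_shift_by[OF f]] _ v(2)]
      funpow_commute[of f "shift_by f a"] shift_by_commute[OF f] by metis
  then obtain m where m: "(shift_by f b ^^ m) w = 0" by (auto simp: gen_eigenspace_def)
  have "(shift_by f b ^^ m) w = scale ((a - b) ^ m) w" for m
    by (induction m)
      (simp_all add: endo_scale[OF endo_shift_by[OF f]] shift_by_def fw endo_scale[OF f] algebra_simps)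
  with m w0 ab show False by simp
qed

text \<open>
  A power of \<open>f - b\<close> removes the summand for \<open>b\<close> and is injective on the other generalised
  eigenspaces.
\<close>

lemma gen_eigenspaces_independent:
  assumes f: "endo f" and "finite \<Lambda>" "\<And>a. a \<in> \<Lambda> \<Longrightarrow> u a \<in> gen_eigenspace f a" "(\<Sum>a\<in>\<Lambda>. u a) = 0"
    "a \<in> \<Lambda>"
  shows "u a = 0"
  using assms(2-)
proof (induction \<Lambda> arbitrary: u a rule: finite_induct)
  case (insert b \<Lambda>)
  obtain n where n: "(shift_by f b ^^ n) (u b) = 0"
    using insert.prems(1)[of b] by (auto simp: gen_eigenspace_def)
  define g where "g = shift_by f b ^^ n"
  have g: "endo g" unfolding g_def by (intro endo_funpow endo_shift_by f)
  have gf: "g (f x) = f (g x)" for x unfolding g_def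
    using funpow_commute[of f "shift_by f b"] shift_by_commute[OF f] by simp
  have "(\<Sum>a\<in>\<Lambda>. g (u a)) = g (\<Sum>a\<in>insert b \<Lambda>. u a)"
    using insert.hyps n by (simp add: endo_sum[OF g] endo_add[OF g] g_def[symmetric])
  then have s: "(\<Sum>a\<in>\<Lambda>. g (u a)) = 0" using insert.prems(2) endo_zero[OF g] by simp
  have "u c = 0" if c: "c \<in> \<Lambda>" for c
  proof (rule gen_eigenspace_disjoint[OF f])
    have "g (u c) = 0"
      using insert.IH[OF _ s c] gen_eigenspace_commuting[OF f g gf] insert.prems(1) by blast
    then show "u c \<in> gen_eigenspace f b" unfolding g_def gen_eigenspace_def by blast
  qed (use insert c in auto)
  then show ?case using insert.prems(2,3) insert.hyps by auto
qed simp

text \<open>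
  A basis of generalised eigenvectors lets one replace each eigenvalue \<open>a\<close> by a scalar \<open>h a\<close>; the
  resulting operator is a multiplication by \<open>h a\<close> on the whole generalised eigenspace of \<open>a\<close>,
  whatever the basis.
\<close>

lemma diagonal_operator:
  assumes f: "endo f" and B: "independent B" "finite B"
    and ev: "\<And>b. b \<in> B \<Longrightarrow> b \<in> gen_eigenspace f (ev b)"
  obtains d where "endo d" "\<And>b. b \<in> B \<Longrightarrow> d b = scale (h (ev b)) b"
    "\<And>a u. u \<in> span B \<Longrightarrow> u \<in> gen_eigenspace f a \<Longrightarrow> d u = scale (h a) u"
proof -
  interpret pair: vector_space_pair scale scale by unfold_locales
  obtain d where d: "endo d" "\<And>b. b \<in> B \<Longrightarrow> d b = scale (h (ev b)) b"
    using pair.linear_independent_extend[OF B(1), of "\<lambda>b. scale (h (ev b)) b"]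
    by (auto simp: endo_def)
  have "d u = scale (h a) u" if u: "u \<in> span B" "u \<in> gen_eigenspace f a" for a u
  proof -
    define v where "v l = (\<Sum>b | b \<in> B \<and> ev b = l. scale (representation B u b) b)" for l
    define \<Lambda> where "\<Lambda> = insert a (ev ` B)"
    have \<Lambda>: "finite \<Lambda>" "a \<in> \<Lambda>" using B by (auto simp: \<Lambda>_def)
    have v: "v l \<in> gen_eigenspace f l" for l unfolding v_def
      by (rule subspace_sum[OF subspace_gen_eigenspace[OF f]])
         (use ev subspace_scale[OF subspace_gen_eigenspace[OF f]] in auto)
    have "(\<Sum>l\<in>\<Lambda>. v l) = u" unfolding v_def
      using sum.group[OF B(2) \<Lambda>(1), of ev "\<lambda>b. scale (representation B u b) b"]
        sum_rep[OF B u(1)] by (simp add: \<Lambda>_def subset_insertI)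
    then have s: "(\<Sum>l\<in>\<Lambda>. v l - (if l = a then u else 0)) = 0"
      using \<Lambda> by (simp add: sum_subtractf)
    have "v a - (if a = a then u else 0) = 0"
      by (rule gen_eigenspaces_independent[OF f \<Lambda>(1) _ s \<Lambda>(2)])
         (use v u subspace_diff[OF subspace_gen_eigenspace[OF f]] in auto)
    then have va: "v a = u" by simp
    have "d (v a) = (\<Sum>b | b \<in> B \<and> ev b = a. scale (h a) (scale (representation B u b) b))"
      unfolding v_def endo_sum[OF d(1)]
      by (intro sum.cong) (auto simp: endo_scale[OF d(1)] d(2) mult.commute)
    also have "\<dots> = scale (h a) (v a)" by (simp only: v_def scale_sum_right)
    finally show ?thesis using va by simp
  qed
  then show thesis using that d by blast
qed

lemma nonzero_relation:
  assumes U: "fin_dim U" and w: "\<And>i. w i \<in> U"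
  obtains c and n :: nat where "(\<Sum>i\<le>n. scale (c i) (w i)) = 0" "\<exists>i\<le>n. c i \<noteq> 0"
proof (cases "inj_on w {..dim U}")
  case False
  then obtain i j where ij: "i \<le> dim U" "j \<le> dim U" "i \<noteq> j" "w i = w j" by (auto simp: inj_on_def)
  let ?c = "\<lambda>k. (if k = i then 1 else 0) - (if k = j then 1 else 0) :: 'a"
  have "(\<Sum>k\<le>dim U. scale (?c k) (w k))
      = (\<Sum>k\<le>dim U. (if k = i then w k else 0) - (if k = j then w k else 0))"
    by (intro sum.cong) (auto simp: scale_left_diff_distrib)
  also have "\<dots> = 0" using ij by (simp add: sum_subtractf)
  finally show thesis using that[of ?c "dim U"] ij by force
next
  case True
  obtain B where B: "finite B" "span B = U" "card B = dim U" using fin_dim_basis[OF U] .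
  have "dependent (w ` {..dim U})"
  proof (rule ccontr)
    assume "independent (w ` {..dim U})"
    then have "card (w ` {..dim U}) \<le> card B" using independent_span_bound[OF B(1)] w B by auto
    then show False using card_image[OF True] B by simp
  qed
  then obtain c where c: "\<exists>v\<in>w ` {..dim U}. c v \<noteq> 0" "(\<Sum>v\<in>w ` {..dim U}. scale (c v) v) = 0"
    using dependent_finite[of "w ` {..dim U}"] by auto
  then show thesis using that[of "\<lambda>i. c (w i)" "dim U"] by (auto simp: sum.reindex[OF True])
qed

lemma dim_noninjective_image:
  assumes U: "fin_dim U" and f: "endo f" and v: "v \<in> U" "v \<noteq> 0" "f v = 0"
  shows "dim (f ` U) < dim U"
proof -
  obtain B where B: "{v} \<subseteq> B" "B \<subseteq> U" "independent B" "U \<subseteq> span B"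
    using maximal_independent_subset_extend[of "{v}" U] v by auto
  obtain B0 where B0: "finite B0" "span B0 = U" using U by (auto simp: fin_dim_def)
  have fB: "finite B" using independent_span_bound[OF B0(1) B(3)] B B0 by auto
  have sB: "span B = U" using B fin_dim_subspaceD[OF U] by (intro span_subspace) auto
  have "f ` U = span (f ` B)" using module_hom.span_image[OF endo_module_hom[OF f], of B] sB by simp
  also have "f ` B = insert 0 (f ` (B - {v}))" using v B by force
  finally have "f ` U \<subseteq> span (f ` (B - {v}))" by (simp add: span_insert_0)
  then have "dim (f ` U) \<le> card (f ` (B - {v}))" using fB by (intro dim_le_card) auto
  also have "\<dots> \<le> card (B - {v})" using fB by (intro card_image_le) auto
  also have "\<dots> < card B" using fB B by (intro psubset_card_mono) auto
  also have "card B = dim U" by (rule basis_card_eq_dim[OF B(2,4,3)])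
  finally show ?thesis .
qed

end

locale closed_linear_space = linear_space scale
  for scale :: "'a::alg_closed_field \<Rightarrow> 'b::ab_group_add \<Rightarrow> 'b"
begin

text \<open>
  Factoring a linear root out of a polynomial relation between the vectors \<open>u, f u, f (f u), \<dots>\<close>
  either yields an eigenvector or a shorter relation.
\<close>

lemma eigenvector_of_relation:
  assumes f: "endo_on U f" and U: "subspace U" and u: "u \<in> U" "u \<noteq> 0"
  shows "p \<noteq> 0 \<Longrightarrow> degree p \<le> n \<Longrightarrow> (\<Sum>i\<le>n. scale (coeff p i) ((f ^^ i) u)) = 0 \<Longrightarrow>
    \<exists>a v. v \<in> U \<and> v \<noteq> 0 \<and> f v = scale a v"
proof (induction n arbitrary: p)
  case 0
  then have "coeff p 0 \<noteq> 0" by (metis le_zero_eq leading_coeff_0_iff)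
  then show ?case using 0 u by simp
next
  case (Suc n)
  note lf = endo_onD(1)[OF f]
  show ?case
  proof (cases "degree p = 0")
    case True
    then have "coeff p 0 \<noteq> 0" "\<And>i. i > 0 \<Longrightarrow> coeff p i = 0"
      using Suc.prems(1) by (auto simp: coeff_eq_0 leading_coeff_0_iff[symmetric])
    then have "scale (coeff p 0) u = 0"
      using Suc.prems(3) by (simp add: sum.atMost_Suc_shift del: sum.atMost_Suc)
    then show ?thesis using u \<open>coeff p 0 \<noteq> 0\<close> by simp
  next
    case False
    then obtain a where "poly p a = 0" using alg_closed_imp_poly_has_root by blast
    then obtain q where q: "p = [:- a, 1:] * q" by (metis dvdE poly_eq_0_iff_dvd)
    have q0: "q \<noteq> 0" using Suc.prems(1) q by auto
    then have dq: "degree q \<le> n" using Suc.prems(2) degree_mult_eq[of "[:- a, 1:]" q] q by simp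
    have cp: "coeff p 0 = - a * coeff q 0"
      "coeff p (Suc i) = coeff q i - a * coeff q (Suc i)" for i
      by (simp_all add: q)
    define v where "v = (\<Sum>i\<le>n. scale (coeff q i) ((f ^^ i) u))"
    have "coeff q (Suc n) = 0" using dq by (simp add: coeff_eq_0)
    then have v': "v = (\<Sum>i\<le>Suc n. scale (coeff q i) ((f ^^ i) u))" by (simp add: v_def)
    have fv: "f v = (\<Sum>i\<le>n. scale (coeff q i) ((f ^^ Suc i) u))"
      by (simp add: v_def endo_sum[OF lf] endo_scale[OF lf])
    have av: "scale a v = scale (a * coeff q 0) u
        + (\<Sum>i\<le>n. scale (a * coeff q (Suc i)) ((f ^^ Suc i) u))"
      by (subst v', subst sum.atMost_Suc_shift) (simp add: scale_right_distrib scale_sum_right)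
    have "(\<Sum>i\<le>Suc n. scale (coeff p i) ((f ^^ i) u)) = f v - scale a v"
      by (simp add: sum.atMost_Suc_shift cp fv av sum_subtractf scale_left_diff_distrib
          del: sum.atMost_Suc funpow.simps)
    then have "f v - scale a v = 0" using Suc.prems(3) by simp
    then have fv: "f v = scale a v" by simp
    have "v \<in> U" unfolding v_def
      by (intro subspace_sum[OF U] subspace_scale[OF U] endo_onD(2)[OF endo_on_funpow[OF f] u(1)])
    then show ?thesis using fv Suc.IH[OF q0 dq] v_def by blast
  qed
qed

lemma eigenvector_exists:
  assumes U: "fin_dim U" and f: "endo_on U f" and u: "u \<in> U" "u \<noteq> 0"
  obtains a v where "v \<in> U" "v \<noteq> 0" "f v = scale a v"
proof -
  obtain c n where c: "(\<Sum>i\<le>n. scale (c i) ((f ^^ i) u)) = 0" "\<exists>i\<le>n. c i \<noteq> 0"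
    using nonzero_relation[OF U, of "\<lambda>i. (f ^^ i) u"] endo_onD(2)[OF endo_on_funpow[OF f] u(1)] by blast
  define p where "p = (\<Sum>i\<le>n. monom (c i) i)"
  have cp: "coeff p i = (if i \<le> n then c i else 0)" for i
    by (simp add: p_def coeff_sum)
  have "p \<noteq> 0" using c(2) cp by (metis coeff_0)
  moreover have "degree p \<le> n" by (rule degree_le) (simp add: cp)
  moreover have "(\<Sum>i\<le>n. scale (coeff p i) ((f ^^ i) u)) = 0" using c(1) by (simp add: cp)
  ultimately show thesis
    using eigenvector_of_relation[OF f fin_dim_subspaceD[OF U] u] that by blast
qed

text \<open>
  For an eigenvalue \<open>a\<close> of \<open>f\<close> on \<open>U\<close> and \<open>g = f - a\<close>, Fitting's argument writes \<open>U\<close> as the sum of the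
  kernel and the image of a high power of \<open>g\<close>. The kernel consists of generalised eigenvectors, and
  the image is smaller because \<open>g\<close> is not injective.
\<close>

lemma gen_eigenspaces_span:
  assumes "fin_dim U" "endo_on U f"
  shows "U \<subseteq> span (\<Union>a. gen_eigenspace f a \<inter> U)"
  using assms
proof (induction "dim U" arbitrary: U rule: less_induct)
  case less
  note U = less.prems(1) and f = less.prems(2)
  note sU = fin_dim_subspaceD[OF U]
  show ?case
  proof (cases "U = {0}")
    case True
    then show ?thesis using span_zero by auto
  next
    case False
    then obtain u where "u \<in> U" "u \<noteq> 0" using subspace_0[OF sU] by auto
    then obtain a v where v: "v \<in> U" "v \<noteq> 0" "f v = scale a v" using eigenvector_exists[OF U f] by blast
    define g where "g = shift_by f a"
    have g: "endo_on U g" unfolding g_def by (rule endo_on_shift_by[OF sU f])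
    obtain n where n: "\<And>m. n \<le> m \<Longrightarrow> (g ^^ m) ` U = (g ^^ n) ` U"
      using funpow_image_stabilises[OF U g] by blast
    note gn = endo_on_funpow[OF g, of n]
    define W where "W = (g ^^ n) ` U"
    have W: "fin_dim W" "W \<subseteq> U"
      unfolding W_def using fin_dim_image[OF U endo_onD(1)[OF gn]] endo_onD(2)[OF gn] by auto
    have "W \<subseteq> g ` U"
      using n[of "Suc n"] endo_onD(2)[OF gn] by (auto simp: W_def)
    then have "dim W \<le> dim (g ` U)"
      using fin_dim_subset(2)[OF fin_dim_image[OF U endo_onD(1)[OF g]]] fin_dim_subspaceD[OF W(1)] by blast
    also have "\<dots> < dim U"
      using dim_noninjective_image[OF U endo_onD(1)[OF g] v(1,2)] v(3) by (simp add: g_def shift_by_def)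
    finally have "dim W < dim U" .
    moreover have "endo_on W f"
    proof -
      have "f ((g ^^ n) x) = (g ^^ n) (f x)" for x unfolding g_def
        by (rule funpow_commute) (simp add: shift_by_commute[OF endo_onD(1)[OF f]])
      then show ?thesis using endo_onD[OF f] by (auto simp: endo_on_def W_def)
    qed
    ultimately have IH: "W \<subseteq> span (\<Union>a. gen_eigenspace f a \<inter> W)" using less.hyps W(1) by blast
    have IH': "W \<subseteq> span (\<Union>a. gen_eigenspace f a \<inter> U)"
      using IH span_mono[of "\<Union>a. gen_eigenspace f a \<inter> W" "\<Union>a. gen_eigenspace f a \<inter> U"] W(2) by blast
    show ?thesis
    proof
      fix x assume x: "x \<in> U"
      have "(g ^^ n) x \<in> (g ^^ (n + n)) ` U" using n[of "n + n"] x by auto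
      then obtain y where y: "y \<in> U" "(g ^^ n) x = (g ^^ n) ((g ^^ n) y)" by (auto simp: funpow_add)
      have "(g ^^ n) (x - (g ^^ n) y) = 0" using y(2) endo_diff[OF endo_onD(1)[OF gn]] by simp
      then have "x - (g ^^ n) y \<in> gen_eigenspace f a \<inter> U"
        using subspace_diff[OF sU x endo_onD(2)[OF gn y(1)]] unfolding gen_eigenspace_def g_def by blast
      then have "x - (g ^^ n) y \<in> span (\<Union>a. gen_eigenspace f a \<inter> U)" by (intro span_base) blast
      moreover have "(g ^^ n) y \<in> span (\<Union>a. gen_eigenspace f a \<inter> U)"
        using IH' y(1) by (auto simp: W_def)
      ultimately show "x \<in> span (\<Union>a. gen_eigenspace f a \<inter> U)"
        using span_add by fastforce
    qed
  qed
qed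

lemma gen_eigenbasis:
  assumes U: "fin_dim U" and f: "endo_on U f"
  obtains B ev where "finite B" "independent B" "span B = U"
    "\<And>b. b \<in> B \<Longrightarrow> b \<in> gen_eigenspace f (ev b)"
proof -
  let ?G = "\<Union>a. gen_eigenspace f a \<inter> U"
  obtain B where B: "B \<subseteq> ?G" "independent B" "?G \<subseteq> span B"
    using maximal_independent_subset[of ?G] by blast
  have sB: "span B = U"
  proof
    show "span B \<subseteq> U" using B(1) fin_dim_subspaceD[OF U] by (intro span_minimal) auto
    show "U \<subseteq> span B" using gen_eigenspaces_span[OF U f] span_minimal[OF B(3) subspace_span] by blast
  qed
  obtain B0 where B0: "finite B0" "span B0 = U" using U by (auto simp: fin_dim_def)
  have "finite B" using independent_span_bound[OF B0(1) B(2)] B0 sB span_superset by auto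
  moreover have "\<forall>b\<in>B. \<exists>a. b \<in> gen_eigenspace f a" using B(1) by blast
  ultimately show thesis using that B(2) sB by metis
qed

end

text \<open>
  This is how characteristic zero enters Cartan's criterion: a vanishing sum \<open>\<Sum> \<phi> a * a\<close> turns under
  \<open>\<phi>\<close> into a vanishing sum of squares of rational numbers.
\<close>

lemma rational_functional:
  fixes a :: "'k::field_char_0"
  assumes "a \<noteq> 0"
  obtains \<phi> :: "'k \<Rightarrow> rat" where "\<And>x y. \<phi> (x + y) = \<phi> x + \<phi> y"
    "\<And>r x. \<phi> (of_rat r * x) = r * \<phi> x" "\<phi> a \<noteq> 0"
proof -
  interpret pair: vector_space_pair "\<lambda>r x. of_rat r * (x::'k)" "(*) :: rat \<Rightarrow> rat \<Rightarrow> rat"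
    by unfold_locales (auto simp: algebra_simps of_rat_add of_rat_mult)
  have "pair.vs1.independent {a}" using assms by simp
  then obtain \<phi> where \<phi>: "Vector_Spaces.linear (\<lambda>r x. of_rat r * x) (*) \<phi>" "\<phi> a = (1::rat)"
    using pair.linear_independent_extend[of "{a}" "\<lambda>_. 1"] by auto
  then show thesis using that[of \<phi>] by (auto simp: Vector_Spaces.linear_iff)
qed

section \<open>Representations on finite-dimensional subspaces\<close>

locale total_lie_algebra = L: linear_space s + lie_algebra s UNIV br
  for s :: "'k::field \<Rightarrow> 'g::ab_group_add \<Rightarrow> 'g"
    and br :: "'g \<Rightarrow> 'g \<Rightarrow> 'g"
begin

lemmas br_add_left = bracket_add_left[OF UNIV_I UNIV_I UNIV_I]
  and br_add_right = bracket_add_right[OF UNIV_I UNIV_I UNIV_I]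
  and br_scale_left = bracket_scale_left[OF UNIV_I UNIV_I]
  and br_scale_right = bracket_scale_right[OF UNIV_I UNIV_I]
  and br_self = bracket_self[OF UNIV_I]

lemma br_anti: "br x y = - br y x"
proof -
  have "br (x + y) (x + y) = 0" by (rule br_self)
  then have "br x x + br y x + (br x y + br y y) = 0" by (simp only: br_add_left br_add_right)
  then have "br x y + br y x = 0" by (simp add: br_self add.commute)
  then show ?thesis by (simp add: eq_neg_iff_add_eq_0)
qed

lemma endo_br: "L.endo (br x)"
  by (simp add: L.endo_iff br_add_right br_scale_right)

definition subalgebra :: "'g set \<Rightarrow> bool" where
  "subalgebra K \<longleftrightarrow> L.subspace K \<and> (\<forall>x\<in>K. \<forall>y\<in>K. br x y \<in> K)"

definition perfect :: "'g set \<Rightarrow> bool" where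
  "perfect J \<longleftrightarrow> L.span {br x y |x y. x \<in> J \<and> y \<in> J} = J"

lemma perfect_subalgebra: "perfect J \<Longrightarrow> subalgebra J"
  unfolding perfect_def subalgebra_def
  by (metis (mono_tags, lifting) L.span_base L.subspace_span mem_Collect_eq)

end

locale lie_rep = total_lie_algebra s br + M: linear_space sm
  for s :: "'k::field \<Rightarrow> 'g::ab_group_add \<Rightarrow> 'g"
    and sm :: "'k \<Rightarrow> 'm::ab_group_add \<Rightarrow> 'm"
    and br :: "'g \<Rightarrow> 'g \<Rightarrow> 'g" +
  fixes U :: "'m set" and act :: "'g \<Rightarrow> 'm \<Rightarrow> 'm"
  assumes fin_dim_carrier: "M.fin_dim U"
    and act_endo_on: "M.endo_on U (act x)"
    and act_add: "u \<in> U \<Longrightarrow> act (x + y) u = act x u + act y u"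
    and act_scale: "u \<in> U \<Longrightarrow> act (s c x) u = sm c (act x u)"
    and act_br: "u \<in> U \<Longrightarrow> act (br x y) u = act x (act y u) - act y (act x u)"
begin

lemmas act_endo = M.endo_onD(1)[OF act_endo_on] and act_closed = M.endo_onD(2)[OF act_endo_on]
lemmas act_vadd = M.endo_add[OF act_endo] and act_vscale = M.endo_scale[OF act_endo]
  and act_vzero = M.endo_zero[OF act_endo] and act_vdiff = M.endo_diff[OF act_endo]
lemmas subspace_carrier' = M.fin_dim_subspaceD[OF fin_dim_carrier]

lemma act_zero: "u \<in> U \<Longrightarrow> act 0 u = 0"
  using act_add[of u 0 0] by simp

lemma act_diff: "u \<in> U \<Longrightarrow> act (x - y) u = act x u - act y u"
  using act_add[of u "x - y" y] by (simp add: algebra_simps)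

definition acts_trivially :: "'g set \<Rightarrow> bool" where
  "acts_trivially J \<longleftrightarrow> (\<forall>x\<in>J. \<forall>u\<in>U. act x u = 0)"

section \<open>Engel's theorem\<close>

text \<open>
  The subspace usually written \<open>K\<^sup>n U\<close>.
\<close>

primrec iterated_image :: "'g set \<Rightarrow> nat \<Rightarrow> 'm set" where
  "iterated_image K 0 = U"
| "iterated_image K (Suc n) = M.span {act x v |x v. x \<in> K \<and> v \<in> iterated_image K n}"

lemma subspace_iterated_image: "M.subspace (iterated_image K n)"
  by (cases n) (auto simp: subspace_carrier')

lemma act_iterated_image: "x \<in> K \<Longrightarrow> v \<in> iterated_image K n \<Longrightarrow> act x v \<in> iterated_image K (Suc n)"
  by (auto intro!: M.span_base)

lemma iterated_image_Suc_subset: "iterated_image K (Suc n) \<subseteq> iterated_image K n"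
proof (induction n)
  case 0
  have "{act x v |x v. x \<in> K \<and> v \<in> U} \<subseteq> U" using act_closed by blast
  then show ?case by (simp add: M.span_minimal[OF _ subspace_carrier'])
next
  case (Suc n)
  then have "{act x v |x v. x \<in> K \<and> v \<in> iterated_image K (Suc n)}
      \<subseteq> {act x v |x v. x \<in> K \<and> v \<in> iterated_image K n}" by blast
  then show ?case unfolding iterated_image.simps(2)[of K "Suc n"] iterated_image.simps(2)[of K n]
    by (rule M.span_mono)
qed

lemma iterated_image_antimono: "m \<le> n \<Longrightarrow> iterated_image K n \<subseteq> iterated_image K m"
  using iterated_image_Suc_subset by (rule lift_Suc_antimono_le)

lemma iterated_image_subset: "iterated_image K n \<subseteq> U"
  using iterated_image_antimono[of 0 n K] by simp

lemma iterated_imageD: "v \<in> iterated_image K n \<Longrightarrow> v \<in> U"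
  using iterated_image_subset by blast

definition nilpotent_action :: "'g set \<Rightarrow> bool" where
  "nilpotent_action K \<longleftrightarrow> (\<exists>n. iterated_image K n = {0})"

text \<open>
  Let the products of \<open>m\<close> elements of \<open>K\<close> vanish on \<open>U\<close>.
  A commutator of \<open>2 m\<close> elements of \<open>K\<close> with any \<open>z\<close> expands into products with at least \<open>m\<close>
  consecutive factors from \<open>K\<close> on one side of \<open>z\<close>, so it acts by zero. Commuting with elements of
  \<open>K\<close> therefore leads from outside \<open>K\<close> into \<open>K\<close>, and the last element outside \<open>K\<close> normalises \<open>K\<close>.
\<close>

lemma nilpotent_subalgebra_normalised:
  assumes J: "subalgebra J" and K: "subalgebra K" "K \<subseteq> J" "nilpotent_action K" "K \<noteq> J"
    and N: "\<And>x. x \<in> J \<Longrightarrow> \<forall>u\<in>U. act x u = 0 \<Longrightarrow> x \<in> K"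
  shows "\<exists>y. y \<in> J \<and> y \<notin> K \<and> (\<forall>k\<in>K. br k y \<in> K)"
proof (rule ccontr)
  assume "\<nexists>y. y \<in> J \<and> y \<notin> K \<and> (\<forall>k\<in>K. br k y \<in> K)"
  then have no: "\<exists>k\<in>K. br k y \<notin> K" if "y \<in> J" "y \<notin> K" for y using that by blast
  obtain m where m: "iterated_image K m = {0}" using K(3) by (auto simp: nilpotent_action_def)
  define level where "level r z \<longleftrightarrow>
    (\<forall>t. \<forall>v \<in> iterated_image K t. act z v \<in> iterated_image K (r + t - m))" for r z
  have "\<exists>y. y \<in> J \<and> y \<notin> K \<and> level r y" for r
  proof (induction r)
    case 0
    obtain y where y: "y \<in> J" "y \<notin> K" using K by auto
    have "act y v \<in> iterated_image K (t - m)" if v: "v \<in> iterated_image K t" for t v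
    proof (cases "t \<le> m")
      case True
      then show ?thesis using v act_closed[OF iterated_imageD] by simp
    next
      case False
      then have "v = 0" using iterated_image_antimono[of m t K] m v by auto
      then show ?thesis using act_vzero M.subspace_0[OF subspace_iterated_image] by simp
    qed
    then show ?case using y by (auto simp: level_def)
  next
    case (Suc r)
    then obtain z where z: "z \<in> J" "z \<notin> K" "level r z" by blast
    obtain k where k: "k \<in> K" "br k z \<notin> K" using no z by blast
    have "act (br k z) v \<in> iterated_image K (Suc r + t - m)" if v: "v \<in> iterated_image K t" for t v
    proof -
      have "act k (act z v) \<in> iterated_image K (Suc (r + t - m))"
        using z(3) v k(1) by (auto simp: level_def intro!: act_iterated_image simp del: iterated_image.simps)
      then have 1: "act k (act z v) \<in> iterated_image K (Suc r + t - m)"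
        by (rule subsetD[OF iterated_image_antimono, rotated]) arith
      have "act z (act k v) \<in> iterated_image K (r + Suc t - m)"
        using z(3) act_iterated_image[OF k(1) v] unfolding level_def by blast
      then have 2: "act z (act k v) \<in> iterated_image K (Suc r + t - m)" by simp
      have "v \<in> U" using v by (rule iterated_imageD)
      then show ?thesis
        using act_br M.subspace_diff[OF subspace_iterated_image 1 2] by simp
    qed
    then have "level (Suc r) (br k z)" by (simp add: level_def)
    then show ?case using k z J K(2) by (auto simp: subalgebra_def)
  qed
  then obtain y where y: "y \<in> J" "y \<notin> K" "level (2 * m) y" by blast
  have "act y u = 0" if "u \<in> U" for u
    using y(3)[unfolded level_def, rule_format, of u 0] that m by simp
  then show False using N y by blast
qed

text \<open>
  If \<open>y\<close> normalises \<open>K\<close>, every \<open>iterated_image K j\<close> is stable under \<open>y\<close>, and as \<open>y\<close> is nilpotent,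
  sufficiently many factors from \<open>K + \<langle>y\<rangle>\<close> map \<open>iterated_image K j\<close> into \<open>iterated_image K (Suc j)\<close>.
\<close>

lemma nilpotent_action_extend:
  assumes K: "subalgebra K" "nilpotent_action K" and y: "\<And>k. k \<in> K \<Longrightarrow> br k y \<in> K"
    and nil: "\<And>u. u \<in> U \<Longrightarrow> (act y ^^ n) u = 0"
  shows "nilpotent_action (L.span (insert y K))" (is "nilpotent_action ?K'")
proof -
  let ?D = "iterated_image K"
  note sD = subspace_iterated_image[of K]
  have sK: "L.span K = K" using K(1) by (simp add: subalgebra_def)
  have yD: "act y v \<in> ?D j" if "v \<in> ?D j" for v j
    using that
  proof (induction j arbitrary: v)
    case 0
    then show ?case using act_closed by simp
  next
    case (Suc j)
    have "{act x v |x v. x \<in> K \<and> v \<in> ?D j} \<subseteq> act y -` ?D (Suc j)"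
    proof clarify
      fix x v assume xv: "x \<in> K" "v \<in> ?D j"
      then have vU: "v \<in> U" using iterated_imageD by blast
      have "act y (act x v) = act x (act y v) - act (br x y) v" using act_br[OF vU] by simp
      moreover have "act x (act y v) \<in> ?D (Suc j)" using xv Suc.IH act_iterated_image by blast
      moreover have "act (br x y) v \<in> ?D (Suc j)" using xv y act_iterated_image by blast
      ultimately have "act y (act x v) \<in> ?D (Suc j)" using M.subspace_diff[OF sD] by metis
      then show "act x v \<in> act y -` ?D (Suc j)" by (rule vimageI2)
    qed
    then have "M.span {act x v |x v. x \<in> K \<and> v \<in> ?D j} \<subseteq> act y -` ?D (Suc j)"
      using module_hom.subspace_vimage[OF M.endo_module_hom[OF act_endo] sD] M.span_minimal by blast
    then show ?case using Suc.prems by auto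
  qed
  have ynD: "(act y ^^ i) v \<in> ?D j" if "v \<in> ?D j" for v i j
    using that by (induction i) (auto intro: yD)
  have "\<exists>t. iterated_image ?K' t \<subseteq> ?D j" for j
  proof (induction j)
    case 0
    show ?case by (rule exI[of _ 0]) simp
  next
    case (Suc j)
    then obtain t where t: "iterated_image ?K' t \<subseteq> ?D j" by blast
    define E where "E i = M.span ((act y ^^ i) ` ?D j \<union> ?D (Suc j))" for i
    have ED: "E i \<subseteq> ?D j" for i unfolding E_def
      using ynD iterated_image_Suc_subset[of K j] by (intro M.span_minimal sD) blast
    have DE: "?D (Suc j) \<subseteq> E i" for i unfolding E_def using M.span_superset by blast
    have yE: "act y v \<in> E (Suc i)" if "v \<in> E i" for v i
    proof -
      have "(act y ^^ i) ` ?D j \<union> ?D (Suc j) \<subseteq> act y -` E (Suc i)"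
      proof -
        have "act y ((act y ^^ i) d) \<in> E (Suc i)" if "d \<in> ?D j" for d
        proof -
          have "act y ((act y ^^ i) d) \<in> (act y ^^ Suc i) ` ?D j" using that by force
          then show ?thesis unfolding E_def by (rule M.span_base[OF UnI1])
        qed
        moreover have "act y d \<in> E (Suc i)" if "d \<in> ?D (Suc j)" for d
          using yD[OF that] DE by blast
        ultimately show ?thesis by blast
      qed
      then have "E i \<subseteq> act y -` E (Suc i)" unfolding E_def[of i]
        by (rule M.span_minimal)
          (use module_hom.subspace_vimage[OF M.endo_module_hom[OF act_endo]] E_def in auto)
      then show ?thesis using that by auto
    qed
    have "iterated_image ?K' (t + i) \<subseteq> E i" for i
    proof (induction i)
      case 0
      have "?D j \<subseteq> E 0" unfolding E_def by (auto intro!: M.span_base simp del: iterated_image.simps)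
      then show ?case using t by auto
    next
      case (Suc i)
      have "act x v \<in> E (Suc i)" if x: "x \<in> ?K'" and v: "v \<in> E i" for x v
      proof -
        obtain c where "x - s c y \<in> K" using x L.span_breakdown_eq[of x y K] sK by auto
        moreover define k where "k = x - s c y"
        ultimately have k: "k \<in> K" "x = k + s c y" by auto
        have vD: "v \<in> ?D j" using v ED by auto
        then have vU: "v \<in> U" using iterated_imageD by blast
        have "act k v \<in> E (Suc i)" using act_iterated_image[OF k(1) vD] DE by blast
        moreover have "sm c (act y v) \<in> E (Suc i)" using yE[OF v] unfolding E_def by (rule M.span_scale)
        ultimately show ?thesis
          using act_add[OF vU] act_scale[OF vU] M.span_add k(2) unfolding E_def by simp
      qed
      then have "{act x v |x v. x \<in> ?K' \<and> v \<in> iterated_image ?K' (t + i)} \<subseteq> E (Suc i)"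
        using Suc by blast
      then have "M.span {act x v |x v. x \<in> ?K' \<and> v \<in> iterated_image ?K' (t + i)} \<subseteq> E (Suc i)"
        by (rule M.span_minimal) (simp add: E_def)
      then show ?case by simp
    qed
    moreover have "E n \<subseteq> ?D (Suc j)"
    proof -
      have "(act y ^^ n) ` ?D j \<subseteq> {0}" using nil iterated_image_subset[of K j] by auto
      then have "(act y ^^ n) ` ?D j \<union> ?D (Suc j) \<subseteq> ?D (Suc j)"
        using M.subspace_0[OF sD, of "Suc j"] by (auto simp del: iterated_image.simps)
      then show ?thesis unfolding E_def by (rule M.span_minimal[OF _ sD])
    qed
    ultimately show ?case by blast
  qed
  moreover obtain m where "?D m = {0}" using K(2) by (auto simp: nilpotent_action_def)
  ultimately obtain t where "iterated_image ?K' t \<subseteq> {0}" by metis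
  then show ?thesis
    using M.subspace_0[OF subspace_iterated_image[of ?K' t]] unfolding nilpotent_action_def by blast
qed

text \<open>
  A subalgebra of maximal dimension among those that act nilpotently must be all of \<open>J\<close>: otherwise
  some \<open>y\<close> outside normalises it, and adding \<open>y\<close> keeps the action nilpotent. Only subalgebras that
  contain the kernel \<open>N\<close> of the action compete, because the search for \<open>y\<close> takes place in operators on
  \<open>U\<close> and sees elements of \<open>J\<close> only modulo \<open>N\<close>.
\<close>

theorem engel:
  assumes fJ: "L.fin_dim J" and J: "subalgebra J"
    and nil: "\<And>x. x \<in> J \<Longrightarrow> \<exists>n. \<forall>u\<in>U. (act x ^^ n) u = 0"
  shows "nilpotent_action J"
proof -
  define N where "N = {x \<in> J. \<forall>u\<in>U. act x u = 0}"
  define P where "P K \<longleftrightarrow> subalgebra K \<and> N \<subseteq> K \<and> K \<subseteq> J \<and> nilpotent_action K" for K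
  have sJ: "L.subspace J" using J by (simp add: subalgebra_def)
  have "L.subspace N"
    using sJ by (auto simp: N_def L.subspace_def act_add act_scale act_zero)
  moreover have "br x y \<in> N" if "x \<in> N" "y \<in> N" for x y
    using that J by (auto simp: N_def subalgebra_def act_br act_vzero)
  moreover have "nilpotent_action N"
  proof -
    have "{act x v |x v. x \<in> N \<and> v \<in> U} \<subseteq> {0}" by (auto simp: N_def)
    then have "M.span {act x v |x v. x \<in> N \<and> v \<in> U} \<subseteq> {0}" by (rule M.span_minimal) simp
    then have "iterated_image N (Suc 0) = {0}" using M.span_zero by auto
    then show ?thesis unfolding nilpotent_action_def by blast
  qed
  ultimately have "P N" by (auto simp: P_def subalgebra_def N_def)
  moreover have "\<forall>K. P K \<longrightarrow> L.dim K < Suc (L.dim J)"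
    using L.fin_dim_subset(2)[OF fJ] by (auto simp: P_def subalgebra_def less_Suc_eq_le)
  ultimately obtain K where K: "P K" "\<And>K'. P K' \<Longrightarrow> L.dim K' \<le> L.dim K"
    using ex_has_greatest_nat[of P N L.dim "Suc (L.dim J)"] by blast
  have "K = J"
  proof (rule ccontr)
    assume "K \<noteq> J"
    then obtain y where y: "y \<in> J" "y \<notin> K" "\<And>k. k \<in> K \<Longrightarrow> br k y \<in> K"
      using nilpotent_subalgebra_normalised[OF J, of K] K(1) unfolding P_def N_def by blast
    obtain n where n: "\<And>u. u \<in> U \<Longrightarrow> (act y ^^ n) u = 0" using nil y(1) by blast
    let ?K' = "L.span (insert y K)"
    have sK: "L.subspace K" "L.span K = K" using K(1) by (auto simp: P_def subalgebra_def)
    have KK': "K \<subseteq> ?K'" "y \<in> ?K'" using L.span_superset by blast+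
    have "subalgebra ?K'"
    proof -
      have "br x x' \<in> K" if xx: "x \<in> ?K'" "x' \<in> ?K'" for x x'
      proof -
        obtain c c' where "x - s c y \<in> K" "x' - s c' y \<in> K"
          using xx L.span_breakdown_eq[of _ y K] sK(2) by auto
        moreover define k k' where "k = x - s c y" "k' = x' - s c' y"
        ultimately have k: "k \<in> K" "x = k + s c y" "k' \<in> K" "x' = k' + s c' y" by auto
        have "br x x' = br k k' + s c' (br k y) + s c (br y k')"
          by (simp add: k br_add_left br_add_right br_scale_left br_scale_right br_self)
        moreover have "br y k' \<in> K" using y(3)[OF k(3)] br_anti[of y k'] L.subspace_neg[OF sK(1)] by simp
        ultimately show ?thesis
          using k y(3) K(1) L.subspace_add[OF sK(1)] L.subspace_scale[OF sK(1)]
          by (simp add: P_def subalgebra_def)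
      qed
      then show ?thesis using KK' by (auto simp: subalgebra_def)
    qed
    moreover have "nilpotent_action ?K'"
      using nilpotent_action_extend[OF _ _ y(3) n] K(1) by (auto simp: P_def)
    moreover have "?K' \<subseteq> J" using K(1) y(1) by (intro L.span_minimal sJ) (auto simp: P_def)
    ultimately have P': "P ?K'" using KK' K(1) by (auto simp: P_def)
    have "L.fin_dim ?K'" using L.fin_dim_subset(1)[OF fJ L.subspace_span \<open>?K' \<subseteq> J\<close>] .
    then have "L.dim K < L.dim ?K'" using L.dim_less[of ?K' K] sK(1) KK' y(2) by blast
    then show False using K(2)[OF P'] by simp
  qed
  then show ?thesis using K(1) by (simp add: P_def)
qed

text \<open>
  In a perfect algebra every element is a sum of commutators, that is, a product of \<open>n + 1\<close> factors is
  a sum of products of \<open>n + 2\<close> factors. If the longer products vanish, so do the shorter ones.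
\<close>

lemma perfect_nilpotent_action_trivial:
  assumes J: "perfect J" and nil: "nilpotent_action J"
  shows "acts_trivially J"
proof -
  have step: "iterated_image J (Suc n) = {0}" if n: "iterated_image J (Suc (Suc n)) = {0}" for n
  proof -
    have "act x d = 0" if d: "d \<in> iterated_image J n" and x: "x \<in> J" for x d
    proof -
      have dU: "d \<in> U" using d by (rule iterated_imageD)
      have "{br a b |a b. a \<in> J \<and> b \<in> J} \<subseteq> {x. act x d = 0}"
      proof clarify
        fix a b assume ab: "a \<in> J" "b \<in> J"
        have "act a (act b d) \<in> iterated_image J (Suc (Suc n))" "act b (act a d) \<in> iterated_image J (Suc (Suc n))"
          using ab d act_iterated_image by blast+
        then show "act (br a b) d = 0" using n act_br[OF dU] by simp
      qed
      moreover have "L.subspace {x. act x d = 0}"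
        using dU by (auto simp: L.subspace_def act_add act_scale act_zero)
      ultimately have "L.span {br a b |a b. a \<in> J \<and> b \<in> J} \<subseteq> {x. act x d = 0}" by (rule L.span_minimal)
      then show ?thesis using x J by (auto simp: perfect_def)
    qed
    then have "{act x v |x v. x \<in> J \<and> v \<in> iterated_image J n} \<subseteq> {0}" by blast
    then have "M.span {act x v |x v. x \<in> J \<and> v \<in> iterated_image J n} \<subseteq> {0}" by (rule M.span_minimal) simp
    then show ?thesis using M.span_zero by auto
  qed
  obtain n where "iterated_image J n = {0}" using nil by (auto simp: nilpotent_action_def)
  then have "iterated_image J (Suc n) = {0}"
    using iterated_image_Suc_subset[of J n] M.subspace_0[OF subspace_iterated_image[of J "Suc n"]] by blast
  then have 1: "iterated_image J (Suc 0) = {0}"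
    by (induction n) (use step in blast)+
  show ?thesis unfolding acts_trivially_def
  proof (intro ballI)
    fix x u assume "x \<in> J" "u \<in> U"
    then have "act x u \<in> iterated_image J (Suc 0)" by (intro act_iterated_image) auto
    then show "act x u = 0" using 1 by auto
  qed
qed

section \<open>Cartan's criterion\<close>

definition trace_form :: "'g \<Rightarrow> 'g \<Rightarrow> 'k" where
  "trace_form x y = M.trace_on U (\<lambda>u. act x (act y u))"

text \<open>
  The Leibniz rule: \<open>x - (a + b)\<close> applied to \<open>act y u\<close> gives one term with \<open>br x - a\<close> applied to \<open>y\<close>
  and one with \<open>x - b\<close> applied to \<open>u\<close>. So \<open>y\<close> in the generalised eigenspace of \<open>a\<close> shifts the
  eigenvalues of \<open>x\<close> on \<open>U\<close> by \<open>a\<close>.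
\<close>

lemma gen_eigenspace_act:
  assumes "(L.shift_by (br x) a ^^ m) y = 0" "(M.shift_by (act x) b ^^ n) u = 0" "u \<in> U"
  shows "(M.shift_by (act x) (a + b) ^^ (m + n)) (act y u) = 0"
proof -
  define X where "X = M.shift_by (act x) (a + b)"
  have X: "M.endo X" unfolding X_def by (rule M.endo_shift_by[OF act_endo])
  have "(X ^^ N) (act y u) = 0" if "m + n = N" "(L.shift_by (br x) a ^^ m) y = 0"
    "(M.shift_by (act x) b ^^ n) u = 0" "u \<in> U" for N
    using that
  proof (induction N arbitrary: m n y u)
    case 0
    then show ?case by (simp add: act_vzero)
  next
    case (Suc N)
    let ?y = "L.shift_by (br x) a y" and ?u = "M.shift_by (act x) b u"
    note XN = M.endo_funpow[OF X, of N]
    have u': "?u \<in> U" using M.endo_onD(2)[OF M.endo_on_shift_by[OF subspace_carrier' act_endo_on]] Suc.prems(4) .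
    have "X (act y u) = act ?y u + act y ?u"
      using Suc.prems(4) act_closed
      by (simp add: X_def M.shift_by_def L.shift_by_def act_diff act_scale act_br act_vdiff act_vscale
          M.scale_left_distrib algebra_simps)
    then have split: "(X ^^ Suc N) (act y u) = (X ^^ N) (act ?y u) + (X ^^ N) (act y ?u)"
      by (simp add: funpow_swap1 M.endo_add[OF XN])
    have "(X ^^ N) (act ?y u) = 0"
    proof (cases m)
      case 0
      then have "?y = 0" using Suc.prems(2) L.endo_zero[OF L.endo_shift_by[OF endo_br]] by simp
      then show ?thesis using act_zero[OF Suc.prems(4)] M.endo_zero[OF XN] by simp
    next
      case (Suc k)
      then have "(L.shift_by (br x) a ^^ k) ?y = 0" using Suc.prems(2) by (simp add: funpow_swap1)
      then show ?thesis using Suc.IH[of k n ?y u] Suc.prems Suc by simp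
    qed
    moreover have "(X ^^ N) (act y ?u) = 0"
    proof (cases n)
      case 0
      then have "?u = 0" using Suc.prems(3) M.endo_zero[OF M.endo_shift_by[OF act_endo]] by simp
      then show ?thesis using act_vzero M.endo_zero[OF XN] by simp
    next
      case (Suc k)
      then have "(M.shift_by (act x) b ^^ k) ?u = 0" using Suc.prems(3) by (simp add: funpow_swap1)
      then show ?thesis using Suc.IH[of m k y ?u] Suc.prems(1,2) u' Suc by simp
    qed
    ultimately show ?case using split by simp
  qed
  then show ?thesis using assms unfolding X_def by blast
qed

end

context linear_space
begin

lemma nilpotent_of_basis:
  assumes B: "finite B" "independent B" "span B = U" and g: "endo g"
    and nil: "\<And>b. b \<in> B \<Longrightarrow> \<exists>k. (g ^^ k) b = 0"
  shows "\<exists>n. \<forall>u\<in>U. (g ^^ n) u = 0"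
proof -
  obtain k where k: "\<And>b. b \<in> B \<Longrightarrow> (g ^^ k b) b = 0" using nil by metis
  have "(g ^^ sum k B) b = 0" if "b \<in> B" for b
    using funpow_zero_mono[OF g k[OF that]] member_le_sum[of b B k] that B(1) by auto
  then have "(g ^^ sum k B) u = 0" if "u \<in> U" for u
    using endo_eq_on_basis[OF B(2,1), of u "g ^^ sum k B" "\<lambda>_. 0"] that B(3) endo_funpow[OF g]
    by (auto simp: endo_closures)
  then show ?thesis by blast
qed

end

locale lie_rep_closed = lie_rep s sm br U act
  for s :: "'k::{alg_closed_field, field_char_0} \<Rightarrow> 'g::ab_group_add \<Rightarrow> 'g"
    and sm :: "'k \<Rightarrow> 'm::ab_group_add \<Rightarrow> 'm"
    and br U act

sublocale lie_rep_closed \<subseteq> L: closed_linear_space s by unfold_locales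
sublocale lie_rep_closed \<subseteq> M: closed_linear_space sm by unfold_locales

context lie_rep_closed
begin

text \<open>
  For a rational functional \<open>\<phi>\<close> let \<open>z\<close> multiply the generalised eigenspace of \<open>x\<close> for \<open>a\<close> by \<open>\<phi> a\<close>.
  The commutator with \<open>z\<close> acts on the generalised eigenspace of \<open>br x\<close> for \<open>a\<close> as multiplication by
  \<open>\<phi> a\<close>, because \<open>\<phi>\<close> is additive; so it maps the operators from \<open>J\<close> to operators from \<open>J\<close>. For
  commutators \<open>[y, y']\<close> in \<open>J\<close>, of which \<open>x\<close> is a sum, \<open>tr ([y, y'] z) = - tr (y [z, y']) = 0\<close>. Hence
  \<open>tr (x z) = 0\<close>. On the other hand \<open>tr (x z)\<close> is the sum of \<open>\<phi> a * a\<close> over the eigenvalues with multiplicity. Hence \<open>\<phi>\<close>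
  vanishes at all eigenvalues, and \<open>\<phi>\<close> was arbitrary.
\<close>

lemma perfect_isotropic_nilpotent:
  assumes fJ: "L.fin_dim J" and J: "perfect J"
    and iso: "\<And>x y. x \<in> J \<Longrightarrow> y \<in> J \<Longrightarrow> trace_form x y = 0" and x: "x \<in> J"
  shows "\<exists>n. \<forall>u\<in>U. (act x ^^ n) u = 0"
proof -
  note U = fin_dim_carrier and sU = subspace_carrier' and X = act_endo_on[of x]
  have sJ: "L.subspace J" "\<And>x y. x \<in> J \<Longrightarrow> y \<in> J \<Longrightarrow> br x y \<in> J"
    using perfect_subalgebra[OF J] by (auto simp: subalgebra_def)
  obtain B ev where B: "finite B" "M.independent B" "M.span B = U"
    and ev: "\<And>b. b \<in> B \<Longrightarrow> b \<in> M.gen_eigenspace (act x) (ev b)"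
    by (rule M.gen_eigenbasis[OF U X]) (rule that)
  have BU: "b \<in> U" if "b \<in> B" for b using that B M.span_base by blast
  have "ev b0 = 0" if b0: "b0 \<in> B" for b0
  proof (rule ccontr)
    assume "ev b0 \<noteq> 0"
    then obtain \<phi> :: "'k \<Rightarrow> rat" where \<phi>: "\<And>x y. \<phi> (x + y) = \<phi> x + \<phi> y"
      "\<And>r x. \<phi> (of_rat r * x) = r * \<phi> x" "\<phi> (ev b0) \<noteq> 0"
      using rational_functional by blast
    define h where "h a = (of_rat (\<phi> a) :: 'k)" for a
    have h_add: "h (a + b) = h a + h b" for a b by (simp add: h_def \<phi> of_rat_add)
    obtain z where z: "M.endo z" "\<And>b. b \<in> B \<Longrightarrow> z b = sm (h (ev b)) b"
      "\<And>a u. u \<in> M.span B \<Longrightarrow> u \<in> M.gen_eigenspace (act x) a \<Longrightarrow> z u = sm (h a) u"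
      using M.diagonal_operator[OF act_endo B(2,1) ev] by blast
    obtain S where S: "M.endo S" "\<And>b. b \<in> B \<Longrightarrow> S b = sm (ev b) b"
      "\<And>a u. u \<in> M.span B \<Longrightarrow> u \<in> M.gen_eigenspace (act x) a \<Longrightarrow> S u = sm a u"
      using M.diagonal_operator[OF act_endo B(2,1) ev, of "\<lambda>a. a"] by blast
    have maps: "d u \<in> U" if d: "M.endo d" "\<And>b. b \<in> B \<Longrightarrow> d b = sm (c b) b" and u: "u \<in> U" for d c u
      unfolding M.endo_rep[OF B(2,1) u[folded B(3)] d(1)]
      by (intro M.subspace_sum[OF sU] M.subspace_scale[OF sU]) (simp add: d(2) BU M.subspace_scale[OF sU])
    have zU: "M.endo_on U z" and SU: "M.endo_on U S"
      using z(1) S(1) maps[OF z(1,2)] maps[OF S(1,2)] by (auto simp: M.endo_on_def)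
    \<comment> \<open>\<open>D b b'\<close>: the commutator of \<open>z\<close> with \<open>b\<close> acts on \<open>U\<close> like \<open>b'\<close>, which is again in \<open>J\<close>\<close>
    define D where "D b b' \<longleftrightarrow> b' \<in> J \<and> (\<forall>u\<in>U. z (act b u) - act b (z u) = act b' u)" for b b'
    have "J \<subseteq> L.span (\<Union>a. L.gen_eigenspace (br x) a \<inter> J)"
      using L.gen_eigenspaces_span[OF fJ] endo_br sJ x by (auto simp: L.endo_on_def)
    also have "\<dots> \<subseteq> {b. \<exists>b'. D b b'}"
    proof (rule L.span_minimal)
      show "(\<Union>a. L.gen_eigenspace (br x) a \<inter> J) \<subseteq> {b. \<exists>b'. D b b'}"
      proof clarify
        fix a b assume b: "b \<in> L.gen_eigenspace (br x) a" "b \<in> J"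
        have zc: "z (act b c) - act b (z c) = sm (h a) (act b c)" if c: "c \<in> B" for c
        proof -
          obtain m where m: "(L.shift_by (br x) a ^^ m) b = 0" using b by (auto simp: L.gen_eigenspace_def)
          obtain n where n: "(M.shift_by (act x) (ev c) ^^ n) c = 0" using ev[OF c] by (auto simp: M.gen_eigenspace_def)
          have "act b c \<in> M.gen_eigenspace (act x) (a + ev c)"
            using gen_eigenspace_act[OF m n BU[OF c]] unfolding M.gen_eigenspace_def by blast
          then have "z (act b c) = sm (h (a + ev c)) (act b c)"
            using z(3) B(3) act_closed BU[OF c] by simp
          moreover have "act b (z c) = sm (h (ev c)) (act b c)" using z(2)[OF c] act_vscale by simp
          ultimately show ?thesis by (simp add: h_add M.scale_left_distrib)
        qed
        have "z (act b u) - act b (z u) = sm (h a) (act b u)" if u: "u \<in> U" for u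
          by (rule M.endo_eq_on_basis[OF B(2,1) u[folded B(3)]
                M.endo_closures(2)[OF M.endo_comp[OF z(1) act_endo] M.endo_comp[OF act_endo z(1)]]
                M.endo_closures(3)[OF act_endo] zc])
        then have "D b (s (h a) b)" using b L.subspace_scale[OF sJ(1)] by (auto simp: D_def act_scale)
        then show "\<exists>b'. D b b'" by blast
      qed
      have "D 0 0" using L.subspace_0[OF sJ(1)] zU M.endo_zero[OF z(1)] M.endo_onD(2)[OF zU]
        by (auto simp: D_def act_zero)
      moreover have "D (b + c) (b' + c')" if "D b b'" "D c c'" for b b' c c'
        using that L.subspace_add[OF sJ(1)] M.endo_onD(2)[OF zU]
        by (auto simp: D_def act_add M.endo_add[OF z(1)] algebra_simps)
      moreover have "D (s c b) (s c b')" if "D b b'" for b b' c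
        using that L.subspace_scale[OF sJ(1)] M.endo_onD(2)[OF zU]
        by (auto simp: D_def act_scale M.endo_scale[OF z(1)] M.scale_right_diff_distrib[symmetric])
      ultimately show "L.subspace {b. \<exists>b'. D b b'}" unfolding L.subspace_def by blast
    qed
    finally have D: "\<exists>b'. D b b'" if "b \<in> J" for b using that by blast
    have tr: "M.trace_on U (\<lambda>u. act w (z u)) = 0" if "w \<in> J" for w
    proof -
      have "{br a b |a b. a \<in> J \<and> b \<in> J} \<subseteq> {w. M.trace_on U (\<lambda>u. act w (z u)) = 0}"
      proof clarify
        fix a b assume ab: "a \<in> J" "b \<in> J"
        obtain b' where b': "D b b'" using D ab by blast
        have az: "M.endo_on U (\<lambda>u. act a (z u))" and bz: "M.endo_on U (\<lambda>u. act b (z u))"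
          and zb: "M.endo_on U (\<lambda>u. z (act b u))"
          by (rule M.endo_on_comp; rule act_endo_on zU)+
        have abz: "M.endo_on U (\<lambda>u. act a (act b (z u)))" by (rule M.endo_on_comp[OF act_endo_on bz])
        have azb: "M.endo_on U (\<lambda>u. act a (z (act b u)))" by (rule M.endo_on_comp[OF act_endo_on zb])
        have baz: "M.endo_on U (\<lambda>u. act b (act a (z u)))" by (rule M.endo_on_comp[OF act_endo_on az])
        have "M.trace_on U (\<lambda>u. act (br a b) (z u))
            = M.trace_on U (\<lambda>u. act a (act b (z u)) - act b (act a (z u)))"
          by (rule M.trace_on_cong[OF U M.endo_on_comp[OF act_endo_on zU] M.endo_on_closures(2)[OF sU abz baz]])
            (simp add: act_br M.endo_onD(2)[OF zU])
        also have "\<dots> = M.trace_on U (\<lambda>u. act a (act b (z u))) - M.trace_on U (\<lambda>u. act b (act a (z u)))"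
          by (rule M.trace_on_lincomb(2)[OF U abz baz])
        also have "M.trace_on U (\<lambda>u. act b (act a (z u))) = M.trace_on U (\<lambda>u. act a (z (act b u)))"
          by (rule M.trace_on_commute[OF U act_endo_on az])
        also have "M.trace_on U (\<lambda>u. act a (act b (z u))) - M.trace_on U (\<lambda>u. act a (z (act b u)))
            = - (M.trace_on U (\<lambda>u. act a (z (act b u))) - M.trace_on U (\<lambda>u. act a (act b (z u))))" by simp
        also have "M.trace_on U (\<lambda>u. act a (z (act b u))) - M.trace_on U (\<lambda>u. act a (act b (z u)))
            = M.trace_on U (\<lambda>u. act a (z (act b u)) - act a (act b (z u)))"
          by (rule M.trace_on_lincomb(2)[OF U azb abz, symmetric])
        also have "\<dots> = trace_form a b'" unfolding trace_form_def
          by (rule M.trace_on_cong[OF U M.endo_on_closures(2)[OF sU azb abz] M.endo_on_comp[OF act_endo_on act_endo_on]])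
            (use b' in \<open>auto simp: D_def act_vdiff[symmetric]\<close>)
        also have "\<dots> = 0" using iso ab b' by (simp add: D_def)
        finally show "M.trace_on U (\<lambda>u. act (br a b) (z u)) = 0" by simp
      qed
      moreover have "L.subspace {w. M.trace_on U (\<lambda>u. act w (z u)) = 0}"
      proof -
        have az: "M.endo_on U (\<lambda>u. act a (z u))" for a by (rule M.endo_on_comp[OF act_endo_on zU])
        have "M.trace_on U (\<lambda>u. act (a + b) (z u)) = M.trace_on U (\<lambda>u. act a (z u)) + M.trace_on U (\<lambda>u. act b (z u))" for a b
          unfolding M.trace_on_lincomb(1)[OF U az az, symmetric]
          by (rule M.trace_on_cong[OF U az M.endo_on_closures(1)[OF sU az az]])
            (simp add: act_add M.endo_onD(2)[OF zU])
        moreover have "M.trace_on U (\<lambda>u. act (s c a) (z u)) = c * M.trace_on U (\<lambda>u. act a (z u))" for c a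
          unfolding M.trace_on_lincomb(3)[OF U az az, symmetric]
          by (rule M.trace_on_cong[OF U az M.endo_on_closures(3)[OF sU az]])
            (simp add: act_scale M.endo_onD(2)[OF zU])
        moreover have "M.trace_on U (\<lambda>u. act 0 (z u)) = 0"
          unfolding M.trace_on_zero[symmetric, of U]
          by (rule M.trace_on_cong[OF U az M.endo_on_closures(5)[OF sU]])
            (simp add: act_zero M.endo_onD(2)[OF zU])
        ultimately show ?thesis by (auto simp: L.subspace_def)
      qed
      ultimately have "L.span {br a b |a b. a \<in> J \<and> b \<in> J} \<subseteq> {w. M.trace_on U (\<lambda>u. act w (z u)) = 0}"
        by (rule L.span_minimal)
      then show ?thesis using that J by (auto simp: perfect_def)
    qed
    \<comment> \<open>\<open>S\<close> is the semisimple part of \<open>x\<close>, and \<open>z N\<close> is nilpotent, so that only \<open>z S\<close> contributes to the trace\<close>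
    define N where "N u = act x u - S u" for u
    have N: "M.endo_on U N" unfolding N_def by (rule M.endo_on_closures(2)[OF sU act_endo_on SU])
    have zN: "M.endo_on U (\<lambda>u. z (N u))" and zS: "M.endo_on U (\<lambda>u. z (S u))"
      by (rule M.endo_on_comp[OF zU N] M.endo_on_comp[OF zU SU])+
    have "\<exists>k. ((\<lambda>u. z (N u)) ^^ k) b = 0" if b: "b \<in> B" for b
    proof -
      let ?Y = "M.shift_by (act x) (ev b)"
      have Y: "M.endo_on U ?Y" by (rule M.endo_on_shift_by[OF sU act_endo_on])
      have YE: "?Y u \<in> M.gen_eigenspace (act x) (ev b)" if "u \<in> M.gen_eigenspace (act x) (ev b)" for u
        using M.gen_eigenspace_commuting[OF act_endo M.endo_onD(1)[OF Y] _ that] M.shift_by_commute[OF act_endo] .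
      have "((\<lambda>u. z (N u)) ^^ k) b = sm (h (ev b) ^ k) ((?Y ^^ k) b)
          \<and> (?Y ^^ k) b \<in> M.gen_eigenspace (act x) (ev b) \<and> (?Y ^^ k) b \<in> U" for k
      proof (induction k)
        case 0
        then show ?case using b ev BU by simp
      next
        case (Suc k)
        let ?w = "(?Y ^^ k) b"
        have "S ?w = sm (ev b) ?w" using S(3) Suc B(3) by simp
        then have "N ?w = ?Y ?w" by (simp add: N_def M.shift_by_apply)
        moreover have "z (?Y ?w) = sm (h (ev b)) (?Y ?w)"
          using z(3) YE Suc B(3) M.endo_onD(2)[OF Y] by simp
        ultimately have "z (N ?w) = sm (h (ev b)) (?Y ?w)" by simp
        then show ?case
          using Suc YE M.endo_onD(2)[OF Y] M.endo_scale[OF M.endo_onD(1)[OF zN]] by (simp add: mult.commute)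
      qed
      moreover obtain k where "(?Y ^^ k) b = 0" using ev[OF b] by (auto simp: M.gen_eigenspace_def)
      ultimately have "((\<lambda>u. z (N u)) ^^ k) b = 0" by simp
      then show ?thesis by blast
    qed
    then obtain n where n: "\<And>u. u \<in> U \<Longrightarrow> ((\<lambda>u. z (N u)) ^^ n) u = 0"
      using M.nilpotent_of_basis[OF B M.endo_onD(1)[OF zN]] by blast
    have "0 = M.trace_on U (\<lambda>u. z (act x u))"
      using tr[OF x] M.trace_on_commute[OF U act_endo_on zU, of x] by simp
    also have "\<dots> = M.trace_on U (\<lambda>u. z (S u) + z (N u))"
      by (rule M.trace_on_cong[OF U M.endo_on_comp[OF zU act_endo_on] M.endo_on_closures(1)[OF sU zS zN]])
        (simp add: N_def M.endo_diff[OF z(1)])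
    also have "\<dots> = M.trace_on U (\<lambda>u. z (S u))"
      using M.trace_on_lincomb(1)[OF U zS zN] M.trace_on_nilpotent[OF U zN n] by simp
    also have "\<dots> = (\<Sum>b\<in>B. M.representation B (z (S b)) b)"
      by (rule M.trace_on_eq[OF B(2,1,3) zS])
    also have "\<dots> = (\<Sum>b\<in>B. of_rat (\<phi> (ev b)) * ev b)"
    proof (rule sum.cong)
      fix b assume b: "b \<in> B"
      have "z (S b) = sm (h (ev b) * ev b) b"
        using b by (simp add: S(2) z(2) M.endo_scale[OF z(1)] mult.commute)
      then show "M.representation B (z (S b)) b = of_rat (\<phi> (ev b)) * ev b"
        using b B(2) by (simp add: M.representation_scale M.span_base M.representation_basis h_def)
    qed simp
    finally have "(\<Sum>b\<in>B. of_rat (\<phi> (ev b)) * ev b) = 0" by simp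
    moreover have "\<phi> (\<Sum>b\<in>C. of_rat (\<phi> (ev b)) * ev b) = (\<Sum>b\<in>C. \<phi> (ev b) * \<phi> (ev b))" for C
      using \<phi>(1)[of 0 0] by (induction C rule: infinite_finite_induct) (auto simp: \<phi>)
    ultimately have "(\<Sum>b\<in>B. \<phi> (ev b) * \<phi> (ev b)) = 0" using \<phi>(1)[of 0 0] by (metis add_cancel_right_right)
    then have "\<phi> (ev b0) * \<phi> (ev b0) = 0"
      using sum_nonneg_eq_0_iff[OF B(1), of "\<lambda>b. \<phi> (ev b) * \<phi> (ev b)"] b0 by simp
    then show False using \<phi>(3) by simp
  qed
  moreover have "M.shift_by (act x) 0 = act x" by (simp add: M.shift_by_def)
  ultimately have "\<exists>k. (act x ^^ k) b = 0" if "b \<in> B" for b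
    using ev[OF that] that by (auto simp: M.gen_eigenspace_def)
  then show ?thesis using M.nilpotent_of_basis[OF B act_endo] by blast
qed

theorem cartan_criterion:
  assumes "L.fin_dim J" "perfect J" "\<And>x y. x \<in> J \<Longrightarrow> y \<in> J \<Longrightarrow> trace_form x y = 0"
  shows "acts_trivially J"
proof (rule perfect_nilpotent_action_trivial[OF assms(2)], rule engel[OF assms(1)])
  show "subalgebra J" using assms(2) by (rule perfect_subalgebra)
  show "\<exists>n. \<forall>u\<in>U. (act x ^^ n) u = 0" if "x \<in> J" for x
    by (rule perfect_isotropic_nilpotent[OF assms that])
qed

end

section \<open>Gradings as families of projections\<close>

context linear_space
begin

text \<open>
  A grading is described by its projections onto the homogeneous components, finitely many of which
  suffice to add up to the identity. Graded subspaces are then the subspaces stable under the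
  projections, and degree arguments become computations with operators and their traces.
\<close>

definition graded_by :: "'b set \<Rightarrow> ('q \<Rightarrow> 'b \<Rightarrow> 'b) \<Rightarrow> bool" where
  "graded_by U P \<longleftrightarrow> (\<forall>a. endo_on U (P a)) \<and>
     (\<forall>a b. \<forall>u\<in>U. P a (P b u) = (if a = b then P b u else 0)) \<and>
     (\<exists>S. finite S \<and> (\<forall>u\<in>U. (\<Sum>a\<in>S. P a u) = u))"

lemma graded_byD:
  assumes "graded_by U P"
  shows "endo_on U (P a)" "u \<in> U \<Longrightarrow> P a (P b u) = (if a = b then P b u else 0)"
  using assms by (auto simp: graded_by_def)

lemma graded_by_sum:
  assumes P: "graded_by U P" and T: "finite T"
  obtains S where "finite S" "T \<subseteq> S" "\<And>u. u \<in> U \<Longrightarrow> (\<Sum>a\<in>S. P a u) = u"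
    "\<And>a u. u \<in> U \<Longrightarrow> a \<notin> S \<Longrightarrow> P a u = 0"
proof -
  obtain S where S: "finite S" "\<And>u. u \<in> U \<Longrightarrow> (\<Sum>a\<in>S. P a u) = u" using P by (auto simp: graded_by_def)
  have out: "P a u = 0" if "u \<in> U" "a \<notin> S" for a u
  proof -
    have "P a u = (\<Sum>b\<in>S. P a (P b u))"
      using S(2)[OF that(1)] endo_sum[OF endo_onD(1)[OF graded_byD(1)[OF P]]] by metis
    also have "\<dots> = 0" using graded_byD(2)[OF P that(1)] that(2) by (intro sum.neutral) auto
    finally show ?thesis .
  qed
  have "(\<Sum>a\<in>S \<union> T. P a u) = u" if "u \<in> U" for u
    using sum.mono_neutral_right[of "S \<union> T" S "\<lambda>a. P a u"] S T out[OF that] that by auto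
  then show thesis using that[of "S \<union> T"] S T out by auto
qed

lemma graded_by_subset:
  assumes "graded_by U P" "U' \<subseteq> U" "\<And>a u. u \<in> U' \<Longrightarrow> P a u \<in> U'"
  shows "graded_by U' P"
  using assms unfolding graded_by_def endo_on_def by (meson subsetD)

end

text \<open>
  The assumption on the bracket says that it adds degrees: the component
  of \<open>br x\<^sub>a y\<close> in degree \<open>a + b\<close> comes from the component of \<open>y\<close> in degree \<open>b\<close>.
\<close>

locale projection_graded_lie_algebra = total_lie_algebra s br
  for s :: "'k::field \<Rightarrow> 'g::ab_group_add \<Rightarrow> 'g"
    and br :: "'g \<Rightarrow> 'g \<Rightarrow> 'g" +
  fixes p :: "'q::ab_group_add \<Rightarrow> 'g \<Rightarrow> 'g"
  assumes graded_algebra: "L.graded_by UNIV p"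
    and br_shift: "br (p a x) (p b y) = p (a + b) (br (p a x) y)"
begin

text \<open>
  Perfectness is the form in which noncommutativity is used: \<open>[J, J]\<close> is a graded ideal, so a
  noncommutative graded simple ideal is perfect.
\<close>

definition graded_simple_ideal :: "'g set \<Rightarrow> bool" where
  "graded_simple_ideal J \<longleftrightarrow> L.fin_dim J \<and> (\<forall>x. \<forall>y\<in>J. br x y \<in> J) \<and> (\<forall>a. \<forall>y\<in>J. p a y \<in> J) \<and>
     perfect J \<and>
     (\<forall>R. L.subspace R \<and> R \<subseteq> J \<and> (\<forall>x\<in>J. \<forall>y\<in>R. br x y \<in> R) \<and> (\<forall>a. \<forall>y\<in>R. p a y \<in> R) \<longrightarrow>
        R = {0} \<or> R = J)"

end

locale graded_rep = projection_graded_lie_algebra s br p + lie_rep_closed s sm br U act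
  for s :: "'k::{alg_closed_field, field_char_0} \<Rightarrow> 'g::ab_group_add \<Rightarrow> 'g"
    and sm :: "'k \<Rightarrow> 'm::ab_group_add \<Rightarrow> 'm"
    and br :: "'g \<Rightarrow> 'g \<Rightarrow> 'g"
    and p :: "'q::ab_group_add \<Rightarrow> 'g \<Rightarrow> 'g"
    and U act +
  fixes P :: "'q \<Rightarrow> 'm \<Rightarrow> 'm"
  assumes graded_module: "M.graded_by U P"
    and act_shift: "u \<in> U \<Longrightarrow> act (p a x) (P b u) = P (a + b) (act (p a x) u)"

section \<open>The trace form\<close>

context lie_rep
begin

lemma act2_endo_on: "M.endo_on U (\<lambda>u. act x (act y u))"
  by (rule M.endo_on_comp[OF act_endo_on act_endo_on])

lemma trace_form_commute: "trace_form x y = trace_form y x"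
  unfolding trace_form_def by (rule M.trace_on_commute[OF fin_dim_carrier act_endo_on act_endo_on])

lemma trace_form_add_left: "trace_form (x + y) z = trace_form x z + trace_form y z"
  unfolding trace_form_def M.trace_on_lincomb(1)[OF fin_dim_carrier act2_endo_on act2_endo_on, symmetric]
  by (rule M.trace_on_cong[OF fin_dim_carrier act2_endo_on M.endo_on_closures(1)[OF subspace_carrier' act2_endo_on act2_endo_on]])
    (simp add: act_add act_closed)

lemma trace_form_scale_left: "trace_form (s c x) z = c * trace_form x z"
  unfolding trace_form_def M.trace_on_lincomb(3)[OF fin_dim_carrier act2_endo_on act2_endo_on, symmetric]
  by (rule M.trace_on_cong[OF fin_dim_carrier act2_endo_on M.endo_on_closures(3)[OF subspace_carrier' act2_endo_on]])
    (simp add: act_scale act_closed)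

lemma trace_form_add_right: "trace_form z (x + y) = trace_form z x + trace_form z y"
  and trace_form_scale_right: "trace_form z (s c x) = c * trace_form z x"
  using trace_form_add_left trace_form_scale_left trace_form_commute by metis+

lemma trace_form_zero: "trace_form 0 z = 0" "trace_form z 0 = 0"
  using trace_form_scale_left[of 0 0 z] trace_form_scale_right[of z 0 0] by simp_all

lemma trace_form_sum: "trace_form (\<Sum>i\<in>I. f i) z = (\<Sum>i\<in>I. trace_form (f i) z)"
  "trace_form z (\<Sum>i\<in>I. f i) = (\<Sum>i\<in>I. trace_form z (f i))"
  by (induction I rule: infinite_finite_induct)
    (simp_all add: trace_form_zero trace_form_add_left trace_form_add_right)

lemma trace_form_diff_right: "trace_form z (x - y) = trace_form z x - trace_form z y"
  using trace_form_add_right[of z "x - y" y] by simp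

lemma trace_form_invariant: "trace_form (br a x) y = trace_form x (- br a y)"
proof -
  note U = fin_dim_carrier and e3 = M.endo_on_comp[OF act_endo_on act2_endo_on]
    and d = M.endo_on_closures(2)[OF subspace_carrier']
  have "trace_form (br a x) y = M.trace_on U (\<lambda>u. act a (act x (act y u)) - act x (act a (act y u)))"
    unfolding trace_form_def
    by (rule M.trace_on_cong[OF U act2_endo_on d[OF e3 e3]]) (simp add: act_br act_closed)
  also have "\<dots> = M.trace_on U (\<lambda>u. act a (act x (act y u))) - M.trace_on U (\<lambda>u. act x (act a (act y u)))"
    by (rule M.trace_on_lincomb(2)[OF U e3 e3])
  also have "M.trace_on U (\<lambda>u. act a (act x (act y u))) = M.trace_on U (\<lambda>u. act x (act y (act a u)))"
    by (rule M.trace_on_commute[OF U act_endo_on act2_endo_on])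
  also have "\<dots> - M.trace_on U (\<lambda>u. act x (act a (act y u)))
      = M.trace_on U (\<lambda>u. act x (act y (act a u)) - act x (act a (act y u)))"
    by (rule M.trace_on_lincomb(2)[OF U e3 e3, symmetric])
  also have "\<dots> = trace_form x (- br a y)" unfolding trace_form_def br_anti[of a y] minus_minus
    by (rule M.trace_on_cong[OF U d[OF e3 e3] act2_endo_on]) (simp add: act_br act_vdiff)
  finally show ?thesis .
qed

section \<open>Dual bases and the Casimir operator\<close>

definition dual_bases :: "'g set \<Rightarrow> 'g set \<Rightarrow> ('g \<Rightarrow> 'g) \<Rightarrow> bool" where
  "dual_bases J X y \<longleftrightarrow> finite X \<and> L.independent X \<and> L.span X = J \<and> y ` X \<subseteq> J \<and>
     (\<forall>x\<in>X. \<forall>x'\<in>X. trace_form x (y x') = (if x = x' then 1 else 0))"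

definition nondegenerate_on :: "'g set \<Rightarrow> bool" where
  "nondegenerate_on J \<longleftrightarrow> (\<forall>x\<in>J. (\<forall>y\<in>J. trace_form y x = 0) \<longrightarrow> x = 0)"

text \<open>
  Nondegeneracy makes the map \<open>w \<mapsto> \<Sum> trace_form x w \<sqdot> x\<close> of \<open>J\<close> injective, hence surjective; the dual
  basis consists of preimages of the basis vectors.
\<close>

lemma dual_bases_exist:
  assumes J: "L.fin_dim J" and nd: "nondegenerate_on J"
  obtains X y where "dual_bases J X y"
proof -
  obtain X where X: "finite X" "L.independent X" "L.span X = J" using L.fin_dim_basis[OF J] .
  have XJ: "x \<in> J" if "x \<in> X" for x using that X(3) L.span_base by blast
  note sJ = L.fin_dim_subspaceD[OF J]
  define \<Phi> where "\<Phi> w = (\<Sum>x\<in>X. s (trace_form x w) x)" for w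
  have "\<Phi> w \<in> J" for w
    unfolding \<Phi>_def by (intro L.subspace_sum[OF sJ] L.subspace_scale[OF sJ] XJ)
  then have \<Phi>: "L.endo_on J \<Phi>"
    by (simp add: L.endo_on_def L.endo_iff \<Phi>_def trace_form_add_right trace_form_scale_right
        L.scale_left_distrib sum.distrib L.scale_sum_right)
  have coeff: "trace_form x w = d x" if "\<Phi> w = (\<Sum>x\<in>X. s (d x) x)" "x \<in> X" for w d x
  proof -
    have "(\<Sum>x\<in>X. s (trace_form x w - d x) x) = 0"
      using that(1) by (simp add: \<Phi>_def L.scale_left_diff_distrib sum_subtractf)
    then have "trace_form x w - d x = 0" by (rule L.independentD[OF X(2,1) subset_refl _ that(2)])
    then show ?thesis by simp
  qed
  have "w = 0" if w: "w \<in> J" "\<Phi> w = 0" for w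
  proof -
    have "trace_form x w = 0" if "x \<in> X" for x using coeff[of w "\<lambda>_. 0"] w(2) that by simp
    then have "X \<subseteq> {z. trace_form z w = 0}" by auto
    then have "L.span X \<subseteq> {z. trace_form z w = 0}"
      by (rule L.span_minimal)
        (auto simp: L.subspace_def trace_form_add_left trace_form_scale_left trace_form_zero)
    then show ?thesis using nd w(1) X(3) by (auto simp: nondegenerate_on_def)
  qed
  then have "\<Phi> ` J = J" by (rule L.inj_endo_on_surj[OF J \<Phi>])
  then have "\<forall>x\<in>X. \<exists>w\<in>J. \<Phi> w = x" using XJ by (metis imageE)
  then obtain y where y: "\<And>x. x \<in> X \<Longrightarrow> y x \<in> J \<and> \<Phi> (y x) = x" by metis
  have "trace_form x (y x') = (if x = x' then 1 else 0)" if "x \<in> X" "x' \<in> X" for x x'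
  proof (rule coeff[OF _ that(1)])
    have "(\<Sum>x\<in>X. s (if x = x' then 1 else 0) x) = (\<Sum>x\<in>X. if x = x' then x else 0)"
      by (rule sum.cong) auto
    then show "\<Phi> (y x') = (\<Sum>x\<in>X. s (if x = x' then 1 else 0) x)"
      using X(1) that(2) y by simp
  qed
  then show thesis using that[of X y] X y by (auto simp: dual_bases_def)
qed

lemma dual_bases_expand:
  assumes J: "dual_bases J X y" and nd: "nondegenerate_on J" and w: "w \<in> J"
  shows "w = (\<Sum>x\<in>X. s (trace_form w (y x)) x)" and "w = (\<Sum>x\<in>X. s (trace_form x w) (y x))"
proof -
  have X: "finite X" "L.independent X" "L.span X = J" "\<And>x. x \<in> X \<Longrightarrow> y x \<in> J"
    and dual: "\<And>x x'. x \<in> X \<Longrightarrow> x' \<in> X \<Longrightarrow> trace_form x (y x') = (if x = x' then 1 else 0)"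
    using J by (auto simp: dual_bases_def)
  have sJ: "L.subspace J" using X(3) by auto
  have "trace_form w (y x) = L.representation X w x" if x: "x \<in> X" for x
  proof -
    have "trace_form w (y x) = trace_form (\<Sum>x'\<in>X. s (L.representation X w x') x') (y x)"
      using L.sum_rep[OF X(2,1)] w X(3) by simp
    also have "\<dots> = (\<Sum>x'\<in>X. if x' = x then L.representation X w x' else 0)"
      unfolding trace_form_sum by (rule sum.cong) (auto simp: trace_form_scale_left dual x)
    finally show ?thesis using X(1) x by simp
  qed
  then show "w = (\<Sum>x\<in>X. s (trace_form w (y x)) x)"
    using L.sum_rep[OF X(2,1)] w X(3) by simp
  define d where "d = w - (\<Sum>x\<in>X. s (trace_form x w) (y x))"
  have "trace_form x d = 0" if x: "x \<in> X" for x
  proof -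
    have "trace_form x (\<Sum>x'\<in>X. s (trace_form x' w) (y x')) = (\<Sum>x'\<in>X. if x = x' then trace_form x' w else 0)"
      unfolding trace_form_sum by (rule sum.cong) (auto simp: trace_form_scale_right dual x)
    then show ?thesis using X(1) x by (simp add: d_def trace_form_diff_right)
  qed
  then have "X \<subseteq> {z. trace_form z d = 0}" by auto
  then have "L.span X \<subseteq> {z. trace_form z d = 0}"
    by (rule L.span_minimal)
      (auto simp: L.subspace_def trace_form_add_left trace_form_scale_left trace_form_zero)
  moreover have "d \<in> J" unfolding d_def
    by (intro L.subspace_diff[OF sJ w] L.subspace_sum[OF sJ] L.subspace_scale[OF sJ] X(4))
  ultimately have "d = 0" using nd X(3) by (auto simp: nondegenerate_on_def)
  then show "w = (\<Sum>x\<in>X. s (trace_form x w) (y x))" by (simp add: d_def)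
qed

definition bilinear_to :: "('g \<Rightarrow> 'g \<Rightarrow> 'm) \<Rightarrow> bool" where
  "bilinear_to F \<longleftrightarrow> (\<forall>x. Vector_Spaces.linear s sm (F x)) \<and> (\<forall>y. Vector_Spaces.linear s sm (\<lambda>x. F x y))"

lemma bilinear_to_sum:
  assumes "bilinear_to F"
  shows "F (\<Sum>i\<in>I. s (c i) (f i)) y = (\<Sum>i\<in>I. sm (c i) (F (f i) y))"
    and "F x (\<Sum>i\<in>I. s (c i) (f i)) = (\<Sum>i\<in>I. sm (c i) (F x (f i)))"
proof -
  have l: "module_hom s sm (F x)" "module_hom s sm (\<lambda>x. F x y)" for x y
    using assms by (auto simp: bilinear_to_def module_hom_iff_linear)
  show "F (\<Sum>i\<in>I. s (c i) (f i)) y = (\<Sum>i\<in>I. sm (c i) (F (f i) y))"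
    by (simp add: module_hom.sum[OF l(2)] module_hom.scale[OF l(2)])
  show "F x (\<Sum>i\<in>I. s (c i) (f i)) = (\<Sum>i\<in>I. sm (c i) (F x (f i)))"
    by (simp add: module_hom.sum[OF l(1)] module_hom.scale[OF l(1)])
qed

lemma bilinear_toI:
  assumes "\<And>x x' y. F (x + x') y = F x y + F x' y" "\<And>x y y'. F x (y + y') = F x y + F x y'"
    "\<And>c x y. F (s c x) y = sm c (F x y)" "\<And>c x y. F x (s c y) = sm c (F x y)"
  shows "bilinear_to F"
  using assms L.vector_space_axioms M.vector_space_axioms
  by (auto simp: bilinear_to_def Vector_Spaces.linear_iff)

text \<open>
  The tensor \<open>\<Sum> x \<otimes> y x\<close> corresponds to the identity of \<open>J\<close> under the trace form, so an operator on its
  first factor equals the adjoint operator on its second factor. Two pairs of adjoint operators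
  matter: \<open>br a\<close> and \<open>- br a\<close>, and the projections to the degrees \<open>a\<close> and \<open>- a\<close>.
\<close>

lemma casimir_adjoint:
  assumes J: "dual_bases J X y" and nd: "nondegenerate_on J" and F: "bilinear_to F"
    and D: "\<And>x. x \<in> J \<Longrightarrow> D x \<in> J" "\<And>x. x \<in> J \<Longrightarrow> D' x \<in> J"
    and adj: "\<And>x z. x \<in> J \<Longrightarrow> z \<in> J \<Longrightarrow> trace_form (D x) z = trace_form x (D' z)"
  shows "(\<Sum>x\<in>X. F (D x) (y x)) = (\<Sum>x\<in>X. F x (D' (y x)))"
proof -
  have X: "x \<in> J" "y x \<in> J" if "x \<in> X" for x
    using J that L.span_base by (auto simp: dual_bases_def)
  have "(\<Sum>x\<in>X. F (D x) (y x)) = (\<Sum>x\<in>X. \<Sum>x'\<in>X. sm (trace_form (D x) (y x')) (F x' (y x)))"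
  proof (rule sum.cong)
    fix x assume x: "x \<in> X"
    have "F (D x) (y x) = F (\<Sum>x'\<in>X. s (trace_form (D x) (y x')) x') (y x)"
      using dual_bases_expand(1)[OF J nd D(1)[OF X(1)[OF x]]] by simp
    then show "F (D x) (y x) = (\<Sum>x'\<in>X. sm (trace_form (D x) (y x')) (F x' (y x)))"
      by (simp add: bilinear_to_sum[OF F])
  qed simp
  also have "\<dots> = (\<Sum>x'\<in>X. \<Sum>x\<in>X. sm (trace_form x (D' (y x'))) (F x' (y x)))"
    by (subst sum.swap) (intro sum.cong refl, simp add: adj X)
  also have "\<dots> = (\<Sum>x'\<in>X. F x' (D' (y x')))"
  proof (rule sum.cong)
    fix x' assume x': "x' \<in> X"
    have "F x' (D' (y x')) = F x' (\<Sum>x\<in>X. s (trace_form x (D' (y x'))) (y x))"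
      using dual_bases_expand(2)[OF J nd D(2)[OF X(2)[OF x']]] by simp
    then show "(\<Sum>x\<in>X. sm (trace_form x (D' (y x'))) (F x' (y x))) = F x' (D' (y x'))"
      by (simp add: bilinear_to_sum[OF F])
  qed simp
  finally show ?thesis .
qed

lemma casimir_ad_invariant:
  assumes J: "dual_bases J X y" and nd: "nondegenerate_on J" and F: "bilinear_to F"
    and ideal: "\<And>x. x \<in> J \<Longrightarrow> br a x \<in> J"
  shows "(\<Sum>x\<in>X. F (br a x) (y x) + F x (br a (y x))) = 0"
proof -
  have sJ: "L.subspace J" using J by (auto simp: dual_bases_def)
  have "(\<Sum>x\<in>X. F (br a x) (y x)) = (\<Sum>x\<in>X. F x (- br a (y x)))"
    by (rule casimir_adjoint[OF J nd F]) (auto simp: ideal L.subspace_neg[OF sJ] trace_form_invariant)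
  also have "\<dots> = (\<Sum>x\<in>X. - F x (br a (y x)))"
    using F module_hom.neg[of s sm "F _"] by (simp add: bilinear_to_def module_hom_iff_linear)
  finally show ?thesis by (simp add: sum.distrib sum_negf)
qed

definition casimir :: "'g set \<Rightarrow> ('g \<Rightarrow> 'g) \<Rightarrow> 'm \<Rightarrow> 'm" where
  "casimir X y u = (\<Sum>x\<in>X. act x (act (y x) u))"

lemma casimir_endo_on: "M.endo_on U (casimir X y)"
  unfolding casimir_def by (rule M.endo_on_sum[OF subspace_carrier' act2_endo_on])

lemma trace_casimir:
  assumes "dual_bases J X y"
  shows "M.trace_on U (casimir X y) = of_nat (card X)"
proof -
  have "M.trace_on U (casimir X y) = (\<Sum>x\<in>X. trace_form x (y x))"
    unfolding casimir_def trace_form_def by (rule M.trace_on_sum[OF fin_dim_carrier act2_endo_on])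
  also have "\<dots> = (\<Sum>x\<in>X. 1)" using assms by (intro sum.cong) (auto simp: dual_bases_def)
  finally show ?thesis by simp
qed

lemma bilinear_act2: "u \<in> U \<Longrightarrow> bilinear_to (\<lambda>x y. act x (act y u))"
  by (rule bilinear_toI) (simp_all add: act_add act_scale act_closed act_vadd act_vscale)

lemma casimir_commute:
  assumes J: "dual_bases J X y" and nd: "nondegenerate_on J"
    and ideal: "\<And>x. x \<in> J \<Longrightarrow> br a x \<in> J" and u: "u \<in> U"
  shows "act a (casimir X y u) = casimir X y (act a u)"
proof -
  have "act a (casimir X y u) - casimir X y (act a u)
      = (\<Sum>x\<in>X. act (br a x) (act (y x) u) + act x (act (br a (y x)) u))"
    unfolding casimir_def M.endo_sum[OF act_endo] sum_subtractf[symmetric]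
    by (rule sum.cong) (simp_all add: act_br u act_closed act_vdiff)
  also have "\<dots> = 0" by (rule casimir_ad_invariant[OF J nd bilinear_act2[OF u] ideal])
  finally show ?thesis by simp
qed

end

context graded_rep
begin

text \<open>
  An operator \<open>f\<close> that shifts degrees by \<open>d \<noteq> 0\<close> has trace zero:
  \<open>tr (f P\<^sub>c) = tr (P\<^sub>d\<^sub>+\<^sub>c f P\<^sub>c) = tr (f P\<^sub>c P\<^sub>d\<^sub>+\<^sub>c) = 0\<close> for every degree \<open>c\<close>.
\<close>

lemma trace_form_orthogonal:
  assumes "a + b \<noteq> 0"
  shows "trace_form (p a x) (p b y) = 0"
proof -
  note U = fin_dim_carrier and sU = subspace_carrier'
    and P = M.graded_byD(1)[OF graded_module] and PP = M.graded_byD(2)[OF graded_module]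
  define f where "f u = act (p a x) (act (p b y) u)" for u
  have f: "M.endo_on U f" unfolding f_def by (rule act2_endo_on)
  have shift: "f (P c u) = P (a + b + c) (f u)" if "u \<in> U" for c u
    using that by (simp add: f_def act_shift act_closed add.assoc)
  obtain S where S: "finite S" "\<And>u. u \<in> U \<Longrightarrow> (\<Sum>c\<in>S. P c u) = u"
    by (rule M.graded_by_sum[OF graded_module finite.emptyI]) (rule that)
  note fP = M.endo_on_comp[OF f P]
  have "M.trace_on U (\<lambda>u. f (P c u)) = 0" for c
  proof -
    have "M.trace_on U (\<lambda>u. f (P c u)) = M.trace_on U (\<lambda>u. P (a + b + c) (f (P c u)))"
      by (rule M.trace_on_cong[OF U fP M.endo_on_comp[OF P fP]])
        (simp add: shift[symmetric] M.endo_onD(2)[OF P] PP)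
    also have "\<dots> = M.trace_on U (\<lambda>u. f (P c (P (a + b + c) u)))"
      by (rule M.trace_on_commute[OF U P fP])
    also have "\<dots> = M.trace_on U (\<lambda>u. 0)"
      by (rule M.trace_on_cong[OF U M.endo_on_comp[OF fP P] M.endo_on_closures(5)[OF sU]])
        (use assms in \<open>simp add: PP M.endo_zero[OF M.endo_onD(1)[OF f]]\<close>)
    finally show ?thesis by (simp add: M.trace_on_zero)
  qed
  moreover have "M.trace_on U f = M.trace_on U (\<lambda>u. \<Sum>c\<in>S. f (P c u))"
    by (rule M.trace_on_cong[OF U f M.endo_on_sum[OF sU fP]])
      (simp add: M.endo_sum[OF M.endo_onD(1)[OF f], symmetric] S)
  ultimately have "M.trace_on U f = 0" using M.trace_on_sum[OF U, of S "\<lambda>c u. f (P c u)"] fP by simp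
  then show ?thesis by (simp add: trace_form_def f_def[abs_def])
qed

lemma trace_form_projection: "trace_form (p a x) y = trace_form x (p (- a) y)"
proof -
  have 1: "trace_form (p a x) y = trace_form (p a x) (p (- a) y)" for x y
  proof -
    obtain S where S: "finite S" "{- a} \<subseteq> S" "\<And>u. u \<in> UNIV \<Longrightarrow> (\<Sum>c\<in>S. p c u) = u"
      by (rule L.graded_by_sum[OF graded_algebra, of "{- a}"]) (simp, rule that)
    have "trace_form (p a x) y = trace_form (p a x) (\<Sum>c\<in>S. p c y)" using S(3) by simp
    also have "\<dots> = (\<Sum>c\<in>S. if c = - a then trace_form (p a x) (p (- a) y) else 0)"
      unfolding trace_form_sum
      by (rule sum.cong) (auto intro!: trace_form_orthogonal simp: add_eq_0_iff)
    finally show ?thesis using S(1,2) by simp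
  qed
  have 2: "trace_form x (p (- a) y) = trace_form (p a x) (p (- a) y)"
  proof -
    obtain S where S: "finite S" "{a} \<subseteq> S" "\<And>u. u \<in> UNIV \<Longrightarrow> (\<Sum>c\<in>S. p c u) = u"
      by (rule L.graded_by_sum[OF graded_algebra, of "{a}"]) (simp, rule that)
    have "trace_form x (p (- a) y) = trace_form (\<Sum>c\<in>S. p c x) (p (- a) y)" using S(3) by simp
    also have "\<dots> = (\<Sum>c\<in>S. if c = a then trace_form (p a x) (p (- a) y) else 0)"
      unfolding trace_form_sum
      by (rule sum.cong) (auto intro!: trace_form_orthogonal)
    finally show ?thesis using S(1,2) by simp
  qed
  show ?thesis using 1 2 by simp
qed

text \<open>
  Decomposing both factors of every summand \<open>x (y x)\<close> into homogeneous components, the terms with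
  degrees \<open>a\<close> and \<open>b \<noteq> - a\<close> add up to zero because the projections to \<open>a\<close> and \<open>- a\<close> are adjoint. So the
  Casimir operator preserves degrees, although the basis \<open>X\<close> need not be homogeneous.
\<close>

lemma casimir_projection:
  assumes J: "dual_bases J X y" and nd: "nondegenerate_on J" and gr: "\<And>a x. x \<in> J \<Longrightarrow> p a x \<in> J"
    and u: "u \<in> U"
  shows "casimir X y (P c u) = P c (casimir X y u)"
proof -
  note P = M.graded_byD(1)[OF graded_module]
  have p: "p a (x + z) = p a x + p a z" "p a (s k x) = s k (p a x)" "p a 0 = 0" for a x z k
    using L.endo_add L.endo_scale L.endo_zero L.endo_onD(1)[OF L.graded_byD(1)[OF graded_algebra]] by blast+
  have pp: "p a (p b x) = (if a = b then p b x else 0)" for a b x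
    by (rule L.graded_byD(2)[OF graded_algebra UNIV_I])
  obtain S where S: "finite S" "\<And>x. (\<Sum>a\<in>S. p a x) = x"
    by (rule L.graded_by_sum[OF graded_algebra finite.emptyI]) (use that in simp)
  define E where "E v a b = (\<Sum>x\<in>X. act (p a x) (act (p b (y x)) v))" for v a b
  have cas: "casimir X y v = (\<Sum>a\<in>S. \<Sum>b\<in>S. E v a b)" if v: "v \<in> U" for v
  proof -
    have bil: "bilinear_to (\<lambda>x y. act x (act y v))" by (rule bilinear_act2[OF v])
    have expand: "act x (act z v) = (\<Sum>a\<in>S. \<Sum>b\<in>S. act (p a x) (act (p b z) v))" for x z
    proof -
      have "act x (act z v) = act (\<Sum>a\<in>S. s 1 (p a x)) (act (\<Sum>b\<in>S. s 1 (p b z)) v)" using S(2) by simp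
      also have "\<dots> = (\<Sum>a\<in>S. act (p a x) (act (\<Sum>b\<in>S. s 1 (p b z)) v))"
        by (subst bilinear_to_sum(1)[OF bil]) simp
      also have "\<dots> = (\<Sum>a\<in>S. \<Sum>b\<in>S. act (p a x) (act (p b z) v))"
        by (subst bilinear_to_sum(2)[OF bil]) simp
      finally show ?thesis .
    qed
    have "casimir X y v = (\<Sum>x\<in>X. \<Sum>a\<in>S. \<Sum>b\<in>S. act (p a x) (act (p b (y x)) v))"
      unfolding casimir_def by (rule sum.cong[OF refl]) (rule expand)
    also have "\<dots> = (\<Sum>a\<in>S. \<Sum>x\<in>X. \<Sum>b\<in>S. act (p a x) (act (p b (y x)) v))" by (rule sum.swap)
    also have "\<dots> = (\<Sum>a\<in>S. \<Sum>b\<in>S. E v a b)"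
      unfolding E_def by (rule sum.cong[OF refl]) (rule sum.swap)
    finally show ?thesis .
  qed
  have off: "E v a b = 0" if v: "v \<in> U" and ab: "b \<noteq> - a" for v a b
  proof -
    have bil: "bilinear_to (\<lambda>x y. act x (act (p b y) v))"
      by (rule bilinear_toI) (simp_all add: p v act_add act_scale act_closed act_vadd act_vscale)
    have "E v a b = (\<Sum>x\<in>X. act x (act (p b (p (- a) (y x))) v))" unfolding E_def
      by (rule casimir_adjoint[OF J nd bil, of "p a" "p (- a)"]) (auto intro: gr trace_form_projection)
    then show ?thesis using ab by (simp add: pp act_zero v act_vzero)
  qed
  have "E (P c u) a b = P c (E u a b)" for a b
  proof (cases "b = - a")
    case True
    have "act (p a x) (act (p b z) (P c u)) = P c (act (p a x) (act (p b z) u))" for x z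
      by (simp add: act_shift u act_closed True)
    then show ?thesis unfolding E_def by (simp add: M.endo_sum[OF M.endo_onD(1)[OF P]])
  next
    case False
    then show ?thesis using off u M.endo_onD[OF P] M.endo_zero by simp
  qed
  then show ?thesis
    using cas[OF u] cas[OF M.endo_onD(2)[OF P u]] by (simp add: M.endo_sum[OF M.endo_onD(1)[OF P]])
qed

text \<open>
  The radical of the trace form is a graded ideal of \<open>J\<close>. If it were all of \<open>J\<close>, Cartan's criterion
  would make the action of \<open>J\<close> trivial.
\<close>

lemma nondegenerate_on_simple_ideal:
  assumes J: "graded_simple_ideal J" and nt: "\<not> acts_trivially J"
  shows "nondegenerate_on J"
proof -
  have J': "L.fin_dim J" "perfect J" and ideal: "\<And>x y. y \<in> J \<Longrightarrow> br x y \<in> J"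
    and gr: "\<And>a y. y \<in> J \<Longrightarrow> p a y \<in> J"
    and simple: "\<And>R. L.subspace R \<Longrightarrow> R \<subseteq> J \<Longrightarrow> (\<And>x y. x \<in> J \<Longrightarrow> y \<in> R \<Longrightarrow> br x y \<in> R) \<Longrightarrow>
      (\<And>a y. y \<in> R \<Longrightarrow> p a y \<in> R) \<Longrightarrow> R = {0} \<or> R = J"
    using J unfolding graded_simple_ideal_def by (simp_all add: subset_iff)
  note sJ = L.fin_dim_subspaceD[OF J'(1)]
  define R where "R = {x \<in> J. \<forall>y\<in>J. trace_form x y = 0}"
  have "R = {0} \<or> R = J"
  proof (rule simple)
    show "L.subspace R" using sJ
      by (auto simp: R_def L.subspace_def trace_form_add_left trace_form_scale_left trace_form_zero)
    show "R \<subseteq> J" by (auto simp: R_def)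
    show "br x y \<in> R" if "x \<in> J" "y \<in> R" for x y
      using that ideal by (auto simp: R_def trace_form_invariant L.subspace_neg[OF sJ])
    show "p a y \<in> R" if "y \<in> R" for a y
      using that gr by (auto simp: R_def trace_form_projection)
  qed
  moreover have "R \<noteq> J" using cartan_criterion[OF J'] nt by (auto simp: R_def)
  ultimately show ?thesis by (auto simp: nondegenerate_on_def R_def trace_form_commute)
qed

lemma graded_rep_submodule:
  assumes "M.subspace W" "W \<subseteq> U" "\<And>x w. w \<in> W \<Longrightarrow> act x w \<in> W" "\<And>a w. w \<in> W \<Longrightarrow> P a w \<in> W"
  shows "graded_rep s sm br p W act P"
proof unfold_locales
  show "M.fin_dim W" by (rule M.fin_dim_subset(1)[OF fin_dim_carrier assms(1,2)])
  show "M.graded_by W P" by (rule M.graded_by_subset[OF graded_module assms(2,4)])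
qed (use assms act_endo act_add act_scale act_br act_shift in \<open>auto simp: M.endo_on_def subset_iff\<close>)

end

section \<open>Vanishing of the first cohomology\<close>

text \<open>
  For a cocycle \<open>c\<close> and the Casimir operator \<open>C\<close> of a simple ideal, the vector
  \<open>w = \<Sum> x (c y)\<close> over dual bases satisfies \<open>a w = C (c a)\<close>: after multiplication by \<open>C\<close> the cocycle is a
  coboundary. Since \<open>C\<close> has nonzero trace, it is not nilpotent, so up to a coboundary the cocycle
  takes its values in the smaller graded submodule of vectors killed by a power of \<open>C\<close>.
\<close>

lemma cocycle_is_coboundary:
  fixes s :: "'k::{alg_closed_field, field_char_0} \<Rightarrow> 'g::ab_group_add \<Rightarrow> 'g"
    and sm :: "'k \<Rightarrow> 'm::ab_group_add \<Rightarrow> 'm"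
  assumes "graded_rep s sm br p U act P"
    and simple: "\<And>J. J \<in> \<J> \<Longrightarrow> projection_graded_lie_algebra.graded_simple_ideal s br p J"
    and span: "module.span s (\<Union>\<J>) = UNIV"
    and "Vector_Spaces.linear s sm c" "\<And>x. c x \<in> U"
    and "\<And>x y. c (br x y) = act x (c y) - act y (c x)"
  shows "\<exists>u\<in>U. \<forall>x. c x = act x u"
  using assms(1,4-)
proof (induction "vector_space.dim sm U" arbitrary: U c rule: less_induct)
  case less
  interpret R: graded_rep s sm br p U act P by (rule less.prems(1))
  note cU = less.prems(3) and coc = less.prems(4)
  have c: "c (x + y) = c x + c y" "c (s k x) = sm k (c x)" for x y k
    using less.prems(2) by (auto simp: Vector_Spaces.linear_iff)
  have c0: "c 0 = 0" using c(1)[of 0 0] by simp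
  show ?case
  proof (cases "\<forall>J\<in>\<J>. R.acts_trivially J")
    case True
    have "R.L.span (\<Union>\<J>) \<subseteq> {x. \<forall>u\<in>U. act x u = 0}"
      by (rule R.L.span_minimal)
        (use True in \<open>auto simp: R.acts_trivially_def R.L.subspace_def R.act_add R.act_scale R.act_zero\<close>)
    then have act0: "act x u = 0" if "u \<in> U" for x u using that span by auto
    have sub: "R.L.subspace {x. c x = 0}" by (auto simp: R.L.subspace_def c c0)
    have "J \<subseteq> {x. c x = 0}" if J: "J \<in> \<J>" for J
    proof -
      have "R.L.span {br x y |x y. x \<in> J \<and> y \<in> J} \<subseteq> {x. c x = 0}"
        by (rule R.L.span_minimal[OF _ sub]) (auto simp: coc act0 cU)
      then show ?thesis using simple[OF J] by (simp add: R.graded_simple_ideal_def R.perfect_def)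
    qed
    then have "R.L.span (\<Union>\<J>) \<subseteq> {x. c x = 0}" by (intro R.L.span_minimal sub) blast
    then have "c x = act x 0" for x using span R.act_vzero by auto
    then show ?thesis using R.M.subspace_0[OF R.subspace_carrier'] by blast
  next
    case False
    then obtain J where J: "J \<in> \<J>" "\<not> R.acts_trivially J" by blast
    note gsJ = simple[OF J(1)]
    have fJ: "R.L.fin_dim J" and ideal: "\<And>x y. y \<in> J \<Longrightarrow> br x y \<in> J" and gr: "\<And>a y. y \<in> J \<Longrightarrow> p a y \<in> J"
      using gsJ by (auto simp: R.graded_simple_ideal_def)
    note nd = R.nondegenerate_on_simple_ideal[OF gsJ J(2)]
    obtain X y where XY: "R.dual_bases J X y" by (rule R.dual_bases_exist[OF fJ nd])
    define C where "C = R.casimir X y"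
    have C: "R.M.endo_on U C" unfolding C_def by (rule R.casimir_endo_on)
    have CU: "(C ^^ n) u \<in> U" if "u \<in> U" for n u
      using R.M.endo_onD(2)[OF R.M.endo_on_funpow[OF C] that] .
    note Cn = R.M.endo_onD(1)[OF R.M.endo_on_funpow[OF C]]
    have Cact: "(C ^^ n) (act a u) = act a ((C ^^ n) u)" if u: "u \<in> U" for n a u
      using R.casimir_commute[OF XY nd ideal] CU[OF u]
      unfolding C_def[symmetric] by (induction n) simp_all
    have CP: "(C ^^ n) (P a u) = P a ((C ^^ n) u)" if u: "u \<in> U" for n a u
      using R.casimir_projection[OF XY nd gr] CU[OF u]
      unfolding C_def[symmetric] by (induction n) simp_all
    define w where "w = (\<Sum>x\<in>X. act x (c (y x)))"
    have wU: "w \<in> U" unfolding w_def by (intro R.M.subspace_sum[OF R.subspace_carrier'] R.act_closed cU)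
    have Cc: "C (c a) = act a w" for a
    proof -
      have bil: "R.bilinear_to (\<lambda>x y. act x (c y))"
        by (rule R.bilinear_toI) (simp_all add: c cU R.act_add R.act_scale R.act_vadd R.act_vscale)
      have "act a w - C (c a) = (\<Sum>x\<in>X. act (br a x) (c (y x)) + act x (c (br a (y x))))"
        unfolding w_def C_def R.casimir_def R.M.endo_sum[OF R.act_endo] sum_subtractf[symmetric]
        by (rule sum.cong) (simp_all add: R.act_br cU coc R.act_vdiff)
      also have "\<dots> = 0" by (rule R.casimir_ad_invariant[OF XY nd bil ideal])
      finally show ?thesis by simp
    qed
    \<comment> \<open>\<open>C\<close> is surjective on the stable image of its powers, so \<open>C\<^sup>n w\<close> is \<open>C\<^sup>n\<^sup>+\<^sup>1\<close> of some \<open>u1\<close>, whose coboundary is subtracted\<close>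
    obtain n where n: "\<And>m. n \<le> m \<Longrightarrow> (C ^^ m) ` U = (C ^^ n) ` U"
      by (rule R.M.funpow_image_stabilises[OF R.fin_dim_carrier C]) (rule that)
    have "(C ^^ n) w \<in> (C ^^ Suc n) ` U" using n[of "Suc n"] wU by (simp del: funpow.simps)
    then obtain u1 where u1: "u1 \<in> U" "(C ^^ n) w = (C ^^ Suc n) u1" by blast
    define U0 where "U0 = {u \<in> U. (C ^^ Suc n) u = 0}"
    define c0 where "c0 x = c x - act x u1" for x
    have sU0: "R.M.subspace U0" unfolding U0_def
      by (rule R.M.subspace_endo_kernel[OF Cn R.subspace_carrier'])
    have rep0: "graded_rep s sm br p U0 act P"
    proof (rule R.graded_rep_submodule[OF sU0])
      show "U0 \<subseteq> U" by (auto simp: U0_def)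
      show "act x u \<in> U0" if "u \<in> U0" for x u
        using that by (auto simp: U0_def Cact R.act_closed R.act_vzero simp del: funpow.simps)
      show "P a u \<in> U0" if "u \<in> U0" for a u
        using that R.M.graded_byD(1)[OF R.graded_module, of a]
        by (auto simp: U0_def CP R.M.endo_on_def R.M.endo_zero simp del: funpow.simps)
    qed
    have "U0 \<noteq> U"
    proof
      assume "U0 = U"
      then have "R.M.trace_on U C = 0"
        by (intro R.M.trace_on_nilpotent[OF R.fin_dim_carrier C, of "Suc n"]) (auto simp: U0_def)
      then have "card X = 0" using R.trace_casimir[OF XY] by (simp add: C_def)
      then have "J = {0}" using XY by (auto simp: R.dual_bases_def)
      then show False using J(2) by (simp add: R.acts_trivially_def R.act_zero)
    qed
    then have "U0 \<subset> U" by (auto simp: U0_def)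
    then have dim: "R.M.dim U0 < R.M.dim U" by (rule R.M.dim_less[OF R.fin_dim_carrier sU0])
    have lin: "Vector_Spaces.linear s sm c0"
      using R.L.vector_space_axioms R.M.vector_space_axioms u1(1)
      by (auto simp: Vector_Spaces.linear_iff c0_def c R.act_add R.act_scale R.M.scale_right_diff_distrib)
    have c0U: "c0 x \<in> U0" for x
    proof -
      have "(C ^^ Suc n) (c x) = (C ^^ n) (act x w)" by (simp add: funpow_swap1 Cc)
      also have "\<dots> = (C ^^ Suc n) (act x u1)" by (simp only: Cact[OF wU] Cact[OF u1(1)] u1(2))
      finally have "(C ^^ Suc n) (c0 x) = 0" by (simp only: c0_def R.M.endo_diff[OF Cn] right_minus_eq)
      then show ?thesis
        using R.M.subspace_diff[OF R.subspace_carrier' cU R.act_closed[OF u1(1)]]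
        by (simp add: U0_def c0_def del: funpow.simps)
    qed
    have coc0: "c0 (br x y) = act x (c0 y) - act y (c0 x)" for x y
      using u1(1) by (simp add: c0_def coc R.act_br R.act_vdiff)
    obtain u0 where u0: "u0 \<in> U0" "\<And>x. c0 x = act x u0"
      using less.hyps[OF dim rep0 lin c0U coc0] by blast
    have "c x = act x (u1 + u0)" for x using u0(2)[of x] by (simp add: c0_def R.act_vadd diff_eq_eq add.commute)
    moreover have "u1 + u0 \<in> U"
      using u0(1) u1(1) R.M.subspace_add[OF R.subspace_carrier'] by (auto simp: U0_def)
    ultimately show ?thesis by blast
  qed
qed

section \<open>Operators on a graded module as a graded module\<close>

lemma sum_fun_apply: "(\<Sum>i\<in>I. f i) v = (\<Sum>i\<in>I. f i v)"
  by (induction I rule: infinite_finite_induct) auto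

locale full_graded_rep = graded_rep s sm br p UNIV act P
  for s :: "'k::{alg_closed_field, field_char_0} \<Rightarrow> 'g::ab_group_add \<Rightarrow> 'g"
    and sm :: "'k \<Rightarrow> 'm::ab_group_add \<Rightarrow> 'm"
    and br :: "'g \<Rightarrow> 'g \<Rightarrow> 'g"
    and p :: "'q::ab_group_add \<Rightarrow> 'g \<Rightarrow> 'g"
    and act and P :: "'q \<Rightarrow> 'm \<Rightarrow> 'm"
begin

definition hscale :: "'k \<Rightarrow> ('m \<Rightarrow> 'm) \<Rightarrow> ('m \<Rightarrow> 'm)" where
  "hscale k f = (\<lambda>v. sm k (f v))"

sublocale E: linear_space hscale
  by unfold_locales
    (auto simp: hscale_def fun_eq_iff M.scale_right_distrib M.scale_left_distrib)

lemmas act_UNIV = act_add[OF UNIV_I] act_scale[OF UNIV_I] act_br[OF UNIV_I]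
lemmas P_endo = M.endo_onD(1)[OF M.graded_byD(1)[OF graded_module]]
lemmas P_P = M.graded_byD(2)[OF graded_module UNIV_I]
lemmas P_linear = M.endo_add[OF P_endo] M.endo_scale[OF P_endo] M.endo_zero[OF P_endo]
  M.endo_diff[OF P_endo] M.endo_sum[OF P_endo]
lemmas shift = act_shift[OF UNIV_I]

definition supp :: "'q set" where
  "supp = (SOME S. finite S \<and> (\<forall>u. (\<Sum>a\<in>S. P a u) = u) \<and> (\<forall>a u. a \<notin> S \<longrightarrow> P a u = 0))"

lemma supp: "finite supp" "(\<Sum>a\<in>supp. P a u) = u" "a \<notin> supp \<Longrightarrow> P a u = 0"
proof -
  obtain S where "finite S" "\<And>u. u \<in> UNIV \<Longrightarrow> (\<Sum>c\<in>S. P c u) = u"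
    "\<And>a u. u \<in> UNIV \<Longrightarrow> a \<notin> S \<Longrightarrow> P a u = 0"
    by (rule M.graded_by_sum[OF graded_module finite.emptyI]) (rule that)
  then have "\<exists>S. finite S \<and> (\<forall>u. (\<Sum>a\<in>S. P a u) = u) \<and> (\<forall>a u. a \<notin> S \<longrightarrow> P a u = 0)" by auto
  then have "finite supp \<and> (\<forall>u. (\<Sum>a\<in>supp. P a u) = u) \<and> (\<forall>a u. a \<notin> supp \<longrightarrow> P a u = 0)"
    unfolding supp_def by (rule someI_ex)
  then show "finite supp" "(\<Sum>a\<in>supp. P a u) = u" "a \<notin> supp \<Longrightarrow> P a u = 0"
    by blast+
qed

definition hact :: "'g \<Rightarrow> ('m \<Rightarrow> 'm) \<Rightarrow> ('m \<Rightarrow> 'm)" where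
  "hact x f = (\<lambda>v. act x (f v) - f (act x v))"

text \<open>
  The part of \<open>f\<close> that raises degrees by \<open>a\<close>.
\<close>

definition hproj :: "'q \<Rightarrow> ('m \<Rightarrow> 'm) \<Rightarrow> ('m \<Rightarrow> 'm)" where
  "hproj a f = (\<lambda>v. \<Sum>b\<in>supp. P (a + b) (f (P b v)))"

text \<open>
  Operators on the quotient by \<open>W\<close> with values in \<open>W\<close>, regarded as operators on the whole space.
\<close>

definition hom_into :: "'m set \<Rightarrow> ('m \<Rightarrow> 'm) set" where
  "hom_into W = {f. M.endo f \<and> (\<forall>v. f v \<in> W) \<and> (\<forall>w\<in>W. f w = 0)}"

text \<open>
  By lemma \<open>direct_sum_Int_iff\<close> below, these are the graded submodules.
\<close>

definition stable :: "'m set \<Rightarrow> bool" where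
  "stable W \<longleftrightarrow> M.subspace W \<and> (\<forall>x. \<forall>w\<in>W. act x w \<in> W) \<and> (\<forall>a. \<forall>w\<in>W. P a w \<in> W)"

lemma fin_dim_endos: "E.fin_dim {f. M.endo f}"
proof -
  obtain B where B: "finite B" "M.independent B" "M.span B = UNIV" using M.fin_dim_basis[OF fin_dim_carrier] .
  define e where "e b b' = (\<lambda>v. sm (M.representation B v b) b')" for b b'
  define F where "F = case_prod e ` (B \<times> B)"
  have e: "M.endo (e b b')" for b b'
    using B(2,3) by (auto simp: M.endo_iff e_def M.representation_add M.representation_scale M.scale_left_distrib)
  have sub: "E.subspace {f. M.endo f}"
    by (auto simp: E.subspace_def hscale_def M.endo_iff M.scale_right_distrib algebra_simps)
  have "E.span F \<subseteq> {f. M.endo f}" using e by (intro E.span_minimal sub) (auto simp: F_def)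
  moreover have "f \<in> E.span F" if f: "M.endo f" for f
  proof -
    have "f v = (\<Sum>b\<in>B. \<Sum>b'\<in>B. hscale (M.representation B (f b) b') (e b b')) v" for v
    proof -
      have "f v = (\<Sum>b\<in>B. sm (M.representation B v b) (f b))"
        using M.endo_rep[OF B(2,1) _ f, of v] B(3) by simp
      also have "\<dots> = (\<Sum>b\<in>B. \<Sum>b'\<in>B. sm (M.representation B v b) (sm (M.representation B (f b) b') b'))"
        unfolding M.scale_sum_right[symmetric] using M.sum_rep[OF B(2,1)] B(3) by simp
      finally show ?thesis by (simp add: sum_fun_apply hscale_def e_def mult.commute)
    qed
    then have "f = (\<Sum>b\<in>B. \<Sum>b'\<in>B. hscale (M.representation B (f b) b') (e b b'))" by (rule ext)
    also have "\<dots> \<in> E.span F"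
      by (intro E.span_sum E.span_scale E.span_base) (auto simp: F_def)
    finally show ?thesis .
  qed
  ultimately have "E.span F = {f. M.endo f}" by auto
  moreover have "finite F" using B(1) by (simp add: F_def)
  ultimately show ?thesis by (auto simp: E.fin_dim_def)
qed

lemma subspace_hom_into: "M.subspace W \<Longrightarrow> E.subspace (hom_into W)"
  by (auto simp: E.subspace_def hom_into_def hscale_def M.endo_iff M.scale_right_distrib algebra_simps
      M.subspace_0 M.subspace_add M.subspace_scale)

lemma hact_br: "M.endo f \<Longrightarrow> hact (br x y) f = hact x (hact y f) - hact y (hact x f)"
  by (rule ext) (simp add: hact_def act_UNIV M.endo_diff act_vdiff algebra_simps)

lemma hact_linear:
  "M.endo f \<Longrightarrow> hact (x + y) f = hact x f + hact y f" "M.endo f \<Longrightarrow> hact (s k x) f = hscale k (hact x f)"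
  by (rule ext, simp add: hact_def hscale_def act_UNIV M.endo_add M.endo_scale M.scale_right_diff_distrib)+

lemma hact_endo: "E.endo (hact x)" and hproj_endo: "E.endo (hproj a)"
  by (auto simp: E.endo_iff hact_def hproj_def hscale_def fun_eq_iff act_vadd act_vscale P_linear
      M.scale_right_diff_distrib sum.distrib M.scale_sum_right)

lemma hact_hom_into: "stable W \<Longrightarrow> f \<in> hom_into W \<Longrightarrow> hact x f \<in> hom_into W"
  by (auto simp: hom_into_def stable_def hact_def M.endo_closures(2) M.endo_comp[OF act_endo] M.endo_comp[OF _ act_endo]
      M.subspace_diff act_vzero)

lemma hproj_hom_into: "stable W \<Longrightarrow> f \<in> hom_into W \<Longrightarrow> hproj a f \<in> hom_into W"
  by (auto simp: hom_into_def stable_def hproj_def P_linear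
      intro!: M.endo_sum_fun M.endo_comp[OF P_endo] M.endo_comp[OF _ P_endo] M.subspace_sum)

lemma hproj_hproj:
  assumes f: "M.endo f"
  shows "hproj a (hproj b f) = (if a = b then hproj b f else 0)"
proof
  fix v
  have "hproj a (hproj b f) v = (\<Sum>c\<in>supp. \<Sum>d\<in>supp. P (a + c) (P (b + d) (f (P d (P c v)))))"
    by (simp add: hproj_def P_linear)
  also have "\<dots> = (\<Sum>c\<in>supp. \<Sum>d\<in>supp. if d = c then P (a + c) (P (b + c) (f (P c v))) else 0)"
    by (intro sum.cong refl) (auto simp: P_P[of _ _ v] M.endo_zero[OF f] P_linear)
  also have "\<dots> = (if a = b then hproj b f v else 0)"
    using supp(1) by (auto simp: P_P hproj_def)
  finally show "hproj a (hproj b f) v = (if a = b then hproj b f else 0) v" by simp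
qed

lemma hproj_sum:
  assumes f: "M.endo f"
  shows "(\<Sum>a\<in>(\<lambda>(c, b). c - b) ` (supp \<times> supp). hproj a f) = f"
proof
  fix v
  let ?G = "(\<lambda>(c, b). c - b) ` (supp \<times> supp)"
  have "(\<Sum>a\<in>?G. hproj a f) v = (\<Sum>b\<in>supp. \<Sum>a\<in>?G. P (a + b) (f (P b v)))"
    by (simp add: sum_fun_apply hproj_def) (rule sum.swap)
  also have "\<dots> = (\<Sum>b\<in>supp. f (P b v))"
  proof (rule sum.cong[OF refl])
    fix b assume b: "b \<in> supp"
    have "(\<Sum>a\<in>?G. P (a + b) (f (P b v))) = (\<Sum>c\<in>(\<lambda>a. a + b) ` ?G. P c (f (P b v)))"
      by (subst sum.reindex) (auto simp: inj_on_def)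
    also have "\<dots> = (\<Sum>c\<in>supp. P c (f (P b v)))"
    proof (rule sum.mono_neutral_right)
      show "finite ((\<lambda>a. a + b) ` ?G)" using supp(1) by auto
      show "supp \<subseteq> (\<lambda>a. a + b) ` ?G"
      proof
        fix c assume "c \<in> supp"
        then have "c - b \<in> ?G" using b by (intro image_eqI[of _ _ "(c, b)"]) auto
        then show "c \<in> (\<lambda>a. a + b) ` ?G" by (intro image_eqI[of _ _ "c - b"]) auto
      qed
    qed (use supp(3) in auto)
    finally show "(\<Sum>a\<in>?G. P (a + b) (f (P b v))) = f (P b v)" using supp(2) by simp
  qed
  also have "\<dots> = f v" by (simp add: M.endo_sum[OF f, symmetric] supp(2))
  finally show "(\<Sum>a\<in>?G. hproj a f) v = f v" .
qed

text \<open>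
  The two sides differ by a shift of the summation index by \<open>a\<close>, and the terms that enter or leave
  the finite index set \<open>supp\<close> by the shift are zero.
\<close>

lemma hact_shift:
  assumes f: "M.endo f"
  shows "hact (p a x) (hproj b f) = hproj (a + b) (hact (p a x) f)"
proof
  fix v
  let ?X = "act (p a x)"
  define t where "t c = P (b + c) (f (P c (?X v)))" for c
  have t0: "t c = 0" if "c \<notin> supp \<or> c - a \<notin> supp" for c
  proof -
    have "P c (?X v) = ?X (P (c - a) v)" by (simp add: shift)
    then have "P c (?X v) = 0" using that supp(3) act_vzero by auto
    then show ?thesis by (simp add: t_def M.endo_zero[OF f] P_linear)
  qed
  have "(\<Sum>c\<in>supp. t c) = (\<Sum>c\<in>supp \<union> (\<lambda>c. a + c) ` supp. t c)"
    using supp(1) t0 by (intro sum.mono_neutral_left) auto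
  also have "\<dots> = (\<Sum>c\<in>(\<lambda>c. a + c) ` supp. t c)"
  proof (rule sum.mono_neutral_right)
    show "\<forall>c\<in>supp \<union> (\<lambda>c. a + c) ` supp - (\<lambda>c. a + c) ` supp. t c = 0"
    proof
      fix c assume c: "c \<in> supp \<union> (\<lambda>c. a + c) ` supp - (\<lambda>c. a + c) ` supp"
      have "c - a \<notin> supp"
      proof
        assume "c - a \<in> supp"
        then have "c \<in> (\<lambda>c. a + c) ` supp" by (intro image_eqI[of _ _ "c - a"]) auto
        then show False using c by simp
      qed
      then show "t c = 0" using t0 by blast
    qed
  qed (use supp(1) in auto)
  also have "\<dots> = (\<Sum>c\<in>supp. t (a + c))" by (subst sum.reindex) (auto simp: inj_on_def)
  finally have "hproj b f (?X v) = (\<Sum>c\<in>supp. P (a + b + c) (f (?X (P c v))))"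
    by (simp add: hproj_def t_def shift add.assoc add.left_commute)
  then show "hact (p a x) (hproj b f) v = hproj (a + b) (hact (p a x) f) v"
    by (simp add: hact_def) (simp add: hproj_def M.endo_sum[OF act_endo] shift P_linear sum_subtractf add.assoc)
qed

lemma graded_rep_hom_into:
  assumes W: "stable W"
  shows "graded_rep s hscale br p (hom_into W) hact hproj"
proof unfold_locales
  have e: "M.endo f" if "f \<in> hom_into W" for f using that by (simp add: hom_into_def)
  have sW: "M.subspace W" using W by (simp add: stable_def)
  show "E.fin_dim (hom_into W)"
    by (rule E.fin_dim_subset(1)[OF fin_dim_endos subspace_hom_into[OF sW]]) (auto simp: hom_into_def)
  show "E.endo_on (hom_into W) (hact x)" for x
    by (simp add: E.endo_on_def hact_endo hact_hom_into[OF W])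
  show "hact (x + y) f = hact x f + hact y f" if "f \<in> hom_into W" for x y f
    using hact_linear(1)[OF e[OF that]] .
  show "hact (s k x) f = hscale k (hact x f)" if "f \<in> hom_into W" for k x f
    using hact_linear(2)[OF e[OF that]] .
  show "hact (br x y) f = hact x (hact y f) - hact y (hact x f)" if "f \<in> hom_into W" for x y f
    using hact_br[OF e[OF that]] .
  show "E.graded_by (hom_into W) hproj" unfolding E.graded_by_def
  proof (intro conjI allI ballI)
    show "E.endo_on (hom_into W) (hproj a)" for a
      by (simp add: E.endo_on_def hproj_endo hproj_hom_into[OF W])
    show "hproj a (hproj b f) = (if a = b then hproj b f else 0)" if "f \<in> hom_into W" for a b f
      using hproj_hproj[OF e[OF that]] .
    show "\<exists>S. finite S \<and> (\<forall>f\<in>hom_into W. (\<Sum>a\<in>S. hproj a f) = f)"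
      using supp(1) hproj_sum e by (intro exI[of _ "(\<lambda>(c, b). c - b) ` (supp \<times> supp)"]) blast
  qed
  show "hact (p a x) (hproj b f) = hproj (a + b) (hact (p a x) f)" if "f \<in> hom_into W" for a x b f
    using hact_shift[OF e[OF that]] .
qed

lemma hact_homogeneous_zero:
  assumes f: "M.endo f" and h: "\<And>a x. hact (p a x) f = 0"
  shows "hact x f = 0"
proof -
  obtain S where S: "finite S" "\<And>x. x \<in> UNIV \<Longrightarrow> (\<Sum>a\<in>S. p a x) = x"
    by (rule L.graded_by_sum[OF graded_algebra finite.emptyI]) (rule that)
  have "hact (\<Sum>a\<in>T. p a x) f = (\<Sum>a\<in>T. hact (p a x) f)" for T
  proof -
    have 0: "hact 0 f = 0" using hact_linear(1)[OF f, of 0 0] by simp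
    show ?thesis by (induction T rule: infinite_finite_induct) (simp_all add: 0 hact_linear(1)[OF f])
  qed
  from this[of S] show ?thesis using S(2) h by simp
qed

section \<open>Complements of graded submodules\<close>

text \<open>
  Let \<open>e\<close> be a linear projection onto \<open>W\<close>. Its commutators with the algebra take values in
  \<open>hom_into W\<close> and form a cocycle, hence they are commutators with some \<open>h\<close> in \<open>hom_into W\<close>. Then
  \<open>e - h\<close> is still a projection onto \<open>W\<close> and commutes with the algebra. The same holds for its part of
  degree zero, whose kernel is the complement.
\<close>

theorem stable_complement:
  assumes simple: "\<And>J. J \<in> \<J> \<Longrightarrow> graded_simple_ideal J" and span: "L.span (\<Union>\<J>) = UNIV"
    and W: "stable W"
  obtains K where "stable K" "W \<inter> K = {0}" "\<And>v. \<exists>w\<in>W. v - w \<in> K"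
proof -
  interpret pair: vector_space_pair sm sm by unfold_locales
  have sW: "M.subspace W" and aW: "\<And>x w. w \<in> W \<Longrightarrow> act x w \<in> W" and PW: "\<And>a w. w \<in> W \<Longrightarrow> P a w \<in> W"
    using W by (auto simp: stable_def)
  obtain e where e: "range e \<subseteq> W" "M.endo e" "\<And>w. w \<in> W \<Longrightarrow> e w = w"
    using pair.linear_exists_left_inverse_on[of "\<lambda>x. x" W] sW M.endo_closures(4)
    by (auto simp: M.endo_def inj_on_def)
  have eW: "e v \<in> W" for v using e(1) by auto
  have "\<exists>h\<in>hom_into W. \<forall>x. hact x e = hact x h"
  proof (rule cocycle_is_coboundary[OF graded_rep_hom_into[OF W] simple span])
    show "Vector_Spaces.linear s hscale (\<lambda>x. hact x e)"
      using L.vector_space_axioms E.vector_space_axioms hact_linear[OF e(2)]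
      by (auto simp: Vector_Spaces.linear_iff)
    show "hact x e \<in> hom_into W" for x
      using e(2,3) eW aW sW
      by (simp add: hom_into_def hact_def M.endo_closures(2) M.endo_comp[OF act_endo] M.endo_comp[OF _ act_endo]
          M.subspace_diff)
    show "hact (br x y) e = hact x (hact y e) - hact y (hact x e)" for x y by (rule hact_br[OF e(2)])
  qed auto
  then obtain h where h: "h \<in> hom_into W" "\<And>x. hact x e = hact x h" by blast
  define q where "q v = e v - h v" for v
  have q: "M.endo q" unfolding q_def using e(2) h(1) by (intro M.endo_closures) (auto simp: hom_into_def)
  have qW: "q v \<in> W" for v unfolding q_def
    using eW h(1) M.subspace_diff[OF sW] by (auto simp: hom_into_def)
  have qw: "q w = w" if "w \<in> W" for w using that e(3) h(1) by (simp add: q_def hom_into_def)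
  have "hact x q = 0" for x
  proof
    fix v show "hact x q v = 0 v"
      using fun_cong[OF h(2)[of x], of v] by (simp add: hact_def q_def act_vdiff algebra_simps)
  qed
  then have qact: "hact x (hproj 0 q) = 0" for x
  proof -
    have "M.endo (hproj 0 q)" unfolding hproj_def
      by (rule M.endo_sum_fun) (rule M.endo_comp[OF P_endo M.endo_comp[OF q P_endo]])
    then show ?thesis
      by (rule hact_homogeneous_zero)
        (simp add: hact_shift[OF q] \<open>\<And>x. hact x q = 0\<close> E.endo_zero[OF hproj_endo])
  qed
  define r where "r = hproj 0 q"
  have r_def': "r v = (\<Sum>b\<in>supp. P b (q (P b v)))" for v by (simp add: r_def hproj_def)
  have r: "M.endo r" unfolding r_def hproj_def
    by (rule M.endo_sum_fun) (rule M.endo_comp[OF P_endo M.endo_comp[OF q P_endo]])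
  have rW: "r v \<in> W" for v unfolding r_def' by (intro M.subspace_sum[OF sW] PW qW)
  have rw: "r w = w" if "w \<in> W" for w
  proof -
    have "r w = (\<Sum>b\<in>supp. P b w)" unfolding r_def' using qw[OF PW[OF that]] by (simp add: P_P)
    then show ?thesis by (simp add: supp)
  qed
  have ract: "r (act x v) = act x (r v)" for x v
    using fun_cong[OF qact[of x], of v] by (simp add: hact_def r_def)
  have rP: "r (P a v) = P a (r v)" for a v
  proof (cases "a \<in> supp")
    case True
    have "r (P a v) = (\<Sum>b\<in>supp. if b = a then P a (q (P a v)) else 0)"
      unfolding r_def' by (rule sum.cong) (auto simp: P_P[of _ _ v] M.endo_zero[OF q] P_linear)
    moreover have "P a (r v) = (\<Sum>b\<in>supp. if b = a then P a (q (P a v)) else 0)"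
      unfolding r_def' P_linear by (rule sum.cong) (auto simp: P_P)
    ultimately show ?thesis by simp
  next
    case False
    then show ?thesis by (simp add: supp(3) M.endo_zero[OF r])
  qed
  show thesis
  proof (rule that[of "{v. r v = 0}"])
    show "stable {v. r v = 0}"
      by (auto simp: stable_def M.subspace_def M.endo_add[OF r] M.endo_scale[OF r] M.endo_zero[OF r]
          ract rP act_vzero P_linear)
    show "W \<inter> {v. r v = 0} = {0}" using rw M.subspace_0[OF sW] by (auto simp: M.endo_zero[OF r])
    show "\<exists>w\<in>W. v - w \<in> {v. r v = 0}" for v
      using rW rw by (intro bexI[of _ "r v"]) (auto simp: M.endo_diff[OF r])
  qed
qed

end

section \<open>Decomposition into minimal graded submodules\<close>

context linear_space
begin

lemma direct_sum_finite_iff: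
  assumes "finite I"
  shows "direct_sum V I W \<longleftrightarrow> subspace V \<and> (\<forall>i\<in>I. subspace (W i) \<and> W i \<subseteq> V) \<and>
    (\<forall>v\<in>V. \<exists>!c. (\<forall>i\<in>I. c i \<in> W i) \<and> (\<forall>i. i \<notin> I \<longrightarrow> c i = 0) \<and> v = (\<Sum>i\<in>I. c i))"
proof -
  have "finite {i. c i \<noteq> 0} \<and> v = (\<Sum>i | c i \<noteq> 0. c i) \<longleftrightarrow> v = (\<Sum>i\<in>I. c i)"
    if "\<forall>i. i \<notin> I \<longrightarrow> c i = 0" for c and v :: 'b
  proof -
    have sub: "{i. c i \<noteq> 0} \<subseteq> I" using that by auto
    have "(\<Sum>i | c i \<noteq> 0. c i) = (\<Sum>i\<in>I. c i)"
      by (rule sum.mono_neutral_left[OF assms sub]) auto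
    then show ?thesis using finite_subset[OF sub assms] by simp
  qed
  then have "(\<forall>i\<in>I. c i \<in> W i) \<and> (\<forall>i. i \<notin> I \<longrightarrow> c i = 0) \<and> finite {i. c i \<noteq> 0} \<and> v = (\<Sum>i | c i \<noteq> 0. c i)
    \<longleftrightarrow> (\<forall>i\<in>I. c i \<in> W i) \<and> (\<forall>i. i \<notin> I \<longrightarrow> c i = 0) \<and> v = (\<Sum>i\<in>I. c i)" for c v by blast
  then show ?thesis unfolding direct_sum_def by simp
qed

lemma direct_sum_Suc:
  assumes K: "direct_sum K {..<n::nat} W" and A: "subspace A" "A \<inter> K = {0}"
    and V: "subspace V" "A \<subseteq> V" "K \<subseteq> V" "\<And>v. v \<in> V \<Longrightarrow> \<exists>a\<in>A. v - a \<in> K"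
  shows "direct_sum V {..<Suc n} (W(n := A))"
proof -
  have sK: "subspace K" and WK: "\<And>i. i < n \<Longrightarrow> subspace (W i) \<and> W i \<subseteq> K"
    and un: "\<And>v. v \<in> K \<Longrightarrow> \<exists>!c. (\<forall>i\<in>{..<n}. c i \<in> W i) \<and> (\<forall>i. i \<notin> {..<n} \<longrightarrow> c i = 0) \<and> v = (\<Sum>i<n. c i)"
    using K by (auto simp: direct_sum_finite_iff)
  show ?thesis unfolding direct_sum_finite_iff[OF finite_lessThan]
  proof (intro conjI ballI)
    show "subspace V" by fact
    show "subspace ((W(n := A)) i)" "(W(n := A)) i \<subseteq> V" if "i \<in> {..<Suc n}" for i
      using that WK[of i] A V by (auto simp: less_Suc_eq)
    fix v assume v: "v \<in> V"
    obtain a where a: "a \<in> A" "v - a \<in> K" using V(4)[OF v] by blast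
    obtain c where c: "\<forall>i\<in>{..<n}. c i \<in> W i" "\<forall>i. i \<notin> {..<n} \<longrightarrow> c i = 0" "v - a = (\<Sum>i<n. c i)"
      using un[OF a(2)] by auto
    show "\<exists>!c. (\<forall>i\<in>{..<Suc n}. c i \<in> (W(n := A)) i) \<and> (\<forall>i. i \<notin> {..<Suc n} \<longrightarrow> c i = 0) \<and> v = (\<Sum>i<Suc n. c i)"
    proof (rule ex1I[of _ "c(n := a)"])
      have "(\<Sum>i<n. (c(n := a)) i) = (\<Sum>i<n. c i)" by (rule sum.cong) auto
      then show "(\<forall>i\<in>{..<Suc n}. (c(n := a)) i \<in> (W(n := A)) i) \<and> (\<forall>i. i \<notin> {..<Suc n} \<longrightarrow> (c(n := a)) i = 0) \<and>
          v = (\<Sum>i<Suc n. (c(n := a)) i)"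
        using c a by (auto simp: less_Suc_eq diff_eq_eq)
    next
      fix d assume d: "(\<forall>i\<in>{..<Suc n}. d i \<in> (W(n := A)) i) \<and> (\<forall>i. i \<notin> {..<Suc n} \<longrightarrow> d i = 0) \<and> v = (\<Sum>i<Suc n. d i)"
      have dd: "d i \<in> (W(n := A)) i" if "i < Suc n" for i using d that by blast
      have dn: "d n \<in> A" using dd[of n] by simp
      have di: "d i \<in> W i" if "i < n" for i using dd[of i] that by simp
      have dK: "(\<Sum>i<n. d i) \<in> K" using di WK by (intro subspace_sum[OF sK]) auto
      have eq: "d n - a = (v - a) - (\<Sum>i<n. d i)" using d by (simp add: algebra_simps)
      have "d n - a \<in> K" unfolding eq by (rule subspace_diff[OF sK a(2) dK])
      then have "d n - a = 0" using A(2) subspace_diff[OF A(1) dn a(1)] by blast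
      then have "d n = a" by simp
      then have vd: "v - a = (\<Sum>i<n. d i)" using eq by simp
      have "d(n := 0) = c"
      proof (rule ex1E[OF un[OF a(2)]])
        fix c' assume u: "\<forall>y. (\<forall>i\<in>{..<n}. y i \<in> W i) \<and> (\<forall>i. i \<notin> {..<n} \<longrightarrow> y i = 0) \<and> v - a = (\<Sum>i<n. y i) \<longrightarrow> y = c'"
        have "(\<Sum>i<n. (d(n := 0)) i) = (\<Sum>i<n. d i)" by (rule sum.cong) auto
        then have "d(n := 0) = c'" using di d vd by (intro u[rule_format]) (auto simp: less_Suc_eq)
        moreover have "c = c'" using c by (intro u[rule_format]) auto
        ultimately show ?thesis by simp
      qed
      then show "d = c(n := a)" using \<open>d n = a\<close> by auto
    qed
  qed
qed

end

context full_graded_rep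
begin

definition minimal_stable :: "'m set \<Rightarrow> bool" where
  "minimal_stable W \<longleftrightarrow> stable W \<and> W \<noteq> {0} \<and> (\<forall>R. stable R \<and> R \<subseteq> W \<longrightarrow> R = {0} \<or> R = W)"

lemma minimal_stable_exists:
  assumes W: "stable W" "W \<noteq> {0}"
  obtains A where "minimal_stable A" "A \<subseteq> W"
proof -
  define Q where "Q A \<longleftrightarrow> stable A \<and> A \<noteq> {0} \<and> A \<subseteq> W" for A
  have "Q W" using W by (simp add: Q_def)
  then obtain A where A: "Q A" "\<And>B. Q B \<Longrightarrow> M.dim A \<le> M.dim B"
    using ex_has_least_nat[of Q W M.dim] by blast
  have "R = {0} \<or> R = A" if R: "stable R" "R \<subseteq> A" for R
  proof (cases "R = {0}")
    case False
    then have "Q R" using R A(1) by (auto simp: Q_def)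
    have "M.fin_dim A" using M.fin_dim_subset(1)[OF fin_dim_carrier, of A] A(1) by (auto simp: Q_def stable_def)
    then show ?thesis
      using M.fin_dim_subset(3)[of A R] R A(2)[OF \<open>Q R\<close>] by (auto simp: stable_def)
  qed simp
  then have "minimal_stable A" using A(1) by (auto simp: minimal_stable_def Q_def)
  then show thesis using that A(1) by (auto simp: Q_def)
qed

text \<open>
  Split off a minimal graded submodule and continue in a complement.
\<close>

theorem stable_decomposition:
  assumes simple: "\<And>J. J \<in> \<J> \<Longrightarrow> graded_simple_ideal J" and span: "L.span (\<Union>\<J>) = UNIV"
    and W: "stable W"
  shows "\<exists>(n::nat) A. M.direct_sum W {..<n} A \<and> (\<forall>i<n. minimal_stable (A i))"
  using W
proof (induction "M.dim W" arbitrary: W rule: less_induct)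
  case less
  note W = less.prems
  have sW: "M.subspace W" using W by (simp add: stable_def)
  show ?case
  proof (cases "W = {0}")
    case True
    have "M.direct_sum {0} {..<0::nat} (\<lambda>_. {0})"
      by (auto simp: M.direct_sum_finite_iff intro!: ex1I[of _ "\<lambda>_. 0"])
    then show ?thesis using True by (intro exI[of _ 0]) auto
  next
    case False
    then obtain A where A: "minimal_stable A" "A \<subseteq> W" using minimal_stable_exists[OF W] by blast
    then have sA: "stable A" "M.subspace A" "A \<noteq> {0}" by (auto simp: minimal_stable_def stable_def)
    obtain K where K: "stable K" "A \<inter> K = {0}" "\<And>v. \<exists>a\<in>A. v - a \<in> K"
      by (rule stable_complement[OF simple span sA(1)]) (assumption, rule that)
    let ?K = "K \<inter> W"
    have sK: "stable ?K" using K(1) W by (auto simp: stable_def M.subspace_inter)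
    have "?K \<noteq> W" using A(2) K(2) sA(3) M.subspace_0[OF sA(2)] by blast
    then have "M.dim ?K < M.dim W"
      using M.dim_less[of W ?K] M.fin_dim_subset(1)[OF fin_dim_carrier sW] sK by (auto simp: stable_def)
    then obtain n B where B: "M.direct_sum ?K {..<n::nat} B" "\<forall>i<n. minimal_stable (B i)"
      using less.hyps[OF _ sK] by blast
    have "M.direct_sum W {..<Suc n} (B(n := A))"
    proof (rule M.direct_sum_Suc[OF B(1) sA(2) _ sW A(2)])
      show "A \<inter> ?K = {0}" using K(2) A(2) by auto
      show "\<exists>a\<in>A. v - a \<in> ?K" if "v \<in> W" for v
        using K(3)[of v] A(2) that M.subspace_diff[OF sW] by blast
    qed auto
    moreover have "\<forall>i<Suc n. minimal_stable ((B(n := A)) i)" using B(2) A(1) by (auto simp: less_Suc_eq)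
    ultimately show ?thesis by blast
  qed
qed

end

section \<open>The projections of an internal grading\<close>

text \<open>
  The family \<open>c\<close> is the decomposition of \<open>v\<close> into homogeneous components; it is unique when \<open>G\<close> is a
  grading.
\<close>

definition graded_component :: "('q \<Rightarrow> 'b::ab_group_add set) \<Rightarrow> 'q \<Rightarrow> 'b \<Rightarrow> 'b" where
  "graded_component G a v = (THE c. (\<forall>i. c i \<in> G i) \<and> finite {i. c i \<noteq> 0} \<and> v = (\<Sum>i | c i \<noteq> 0. c i)) a"

context linear_space
begin

lemma direct_sumE:
  assumes "direct_sum V I W" "v \<in> V"
  obtains c where "\<And>i. i \<in> I \<Longrightarrow> c i \<in> W i" "\<And>i. i \<notin> I \<Longrightarrow> c i = 0" "finite {i. c i \<noteq> 0}"
    "v = (\<Sum>i | c i \<noteq> 0. c i)"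
proof -
  note ex = bspec[OF assms(1)[unfolded direct_sum_def, THEN conjunct2, THEN conjunct2] assms(2)]
  obtain c where "(\<forall>i\<in>I. c i \<in> W i) \<and> (\<forall>i. i \<notin> I \<longrightarrow> c i = 0) \<and>
      finite {i. c i \<noteq> 0} \<and> v = (\<Sum>i | c i \<noteq> 0. c i)"
    using ex1_implies_ex[OF ex] by (rule exE)
  then show thesis using that by blast
qed

context
  fixes G :: "'q \<Rightarrow> 'b set"
  assumes G: "direct_sum UNIV UNIV G"
begin

lemma subspace_homogeneous: "subspace (G a)"
  using G by (simp add: direct_sum_def)

lemma
  shows component_in: "graded_component G a v \<in> G a"
    and finite_components: "finite {a. graded_component G a v \<noteq> 0}"
    and sum_components: "(\<Sum>a | graded_component G a v \<noteq> 0. graded_component G a v) = v"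
    and component_unique: "(\<And>i. c i \<in> G i) \<Longrightarrow> finite T \<Longrightarrow> (\<And>i. i \<notin> T \<Longrightarrow> c i = 0) \<Longrightarrow> v = (\<Sum>i\<in>T. c i) \<Longrightarrow>
      graded_component G a v = c a"
proof -
  let ?Q = "\<lambda>c. (\<forall>i. c i \<in> G i) \<and> finite {i. c i \<noteq> 0} \<and> v = (\<Sum>i | c i \<noteq> 0. c i)"
  have ex: "\<exists>!c. ?Q c" using G by (simp add: direct_sum_def)
  define f where "f = (\<lambda>a. graded_component G a v)"
  have "f = (THE c. ?Q c)" by (simp add: f_def graded_component_def)
  then have "?Q f" using theI'[OF ex] by simp
  then have Q: "?Q (\<lambda>a. graded_component G a v)" unfolding f_def .
  then show "graded_component G a v \<in> G a" "finite {a. graded_component G a v \<noteq> 0}"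
    "(\<Sum>a | graded_component G a v \<noteq> 0. graded_component G a v) = v" by auto
  assume c: "\<And>i. c i \<in> G i" "finite T" "\<And>i. i \<notin> T \<Longrightarrow> c i = 0" "v = (\<Sum>i\<in>T. c i)"
  have sub: "{i. c i \<noteq> 0} \<subseteq> T" using c(3) by auto
  have "(\<Sum>i | c i \<noteq> 0. c i) = (\<Sum>i\<in>T. c i)" by (rule sum.mono_neutral_left[OF c(2) sub]) auto
  then have "?Q c" using c(1,4) finite_subset[OF sub c(2)] by simp
  then have "(THE c. ?Q c) = c" by (rule the1_equality[OF ex])
  then show "graded_component G a v = c a" by (simp add: graded_component_def)
qed

lemma sum_components_superset:
  assumes "finite T" "{a. graded_component G a v \<noteq> 0} \<subseteq> T"
  shows "(\<Sum>a\<in>T. graded_component G a v) = v"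
  using sum.mono_neutral_left[OF assms, of "\<lambda>a. graded_component G a v"] sum_components[of v] by simp

lemma component_homogeneous: "v \<in> G b \<Longrightarrow> graded_component G a v = (if a = b then v else 0)"
  using component_unique[of "\<lambda>i. if i = b then v else 0" "{b}" v a] subspace_0[OF subspace_homogeneous]
  by simp

lemma endo_component: "endo (graded_component G a)"
proof -
  have "graded_component G a (x + y) = graded_component G a x + graded_component G a y" for x y
  proof (rule component_unique)
    let ?T = "{a. graded_component G a x \<noteq> 0} \<union> {a. graded_component G a y \<noteq> 0}"
    show "finite ?T" using finite_components by simp
    show "x + y = (\<Sum>i\<in>?T. graded_component G i x + graded_component G i y)"
      using finite_components[of x] finite_components[of y]
      by (simp add: sum.distrib sum_components_superset)
  qed (auto intro: subspace_add[OF subspace_homogeneous] component_in)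
  moreover have "graded_component G a (scale k x) = scale k (graded_component G a x)" for k x
    by (rule component_unique[of _ "{a. graded_component G a x \<noteq> 0}"])
      (auto intro: subspace_scale[OF subspace_homogeneous] component_in
        simp: finite_components scale_sum_right[symmetric] sum_components)
  ultimately show ?thesis by (simp add: endo_iff)
qed

text \<open>
  The finitely many degrees that occur in a basis occur in all vectors.
\<close>

lemma graded_by_component:
  assumes fd: "fin_dim (UNIV :: 'b set)"
  shows "graded_by UNIV (graded_component G)"
proof -
  obtain B where B: "finite B" "independent B" "span B = UNIV" using fin_dim_basis[OF fd] .
  define S where "S = (\<Union>b\<in>B. {a. graded_component G a b \<noteq> 0})"
  have S: "finite S" using B(1) finite_components by (simp add: S_def)
  have "(\<Sum>a\<in>S. graded_component G a v) = v" for v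
  proof (rule endo_eq_on_basis[OF B(2,1), of v "\<lambda>v. \<Sum>a\<in>S. graded_component G a v" "\<lambda>v. v"])
    show "endo (\<lambda>v. \<Sum>a\<in>S. graded_component G a v)" by (rule endo_sum_fun[OF endo_component])
    show "endo (\<lambda>v. v)" by (rule endo_closures)
    show "(\<Sum>a\<in>S. graded_component G a b) = b" if "b \<in> B" for b
      using that by (intro sum_components_superset S) (auto simp: S_def)
  qed (simp add: B)
  moreover have "graded_component G a (graded_component G b v) = (if a = b then graded_component G b v else 0)" for a b v
    by (rule component_homogeneous[OF component_in])
  ultimately show ?thesis using S by (auto simp: graded_by_def endo_on_def endo_component)
qed

text \<open>
  Graded ideals and graded submodules are defined by direct sums; this turns them into subspaces
  stable under projections.
\<close>

lemma direct_sum_Int_iff: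
  assumes W: "subspace W"
  shows "direct_sum W UNIV (\<lambda>a. W \<inter> G a) \<longleftrightarrow> (\<forall>a. \<forall>w\<in>W. graded_component G a w \<in> W)"
proof
  assume ds: "direct_sum W UNIV (\<lambda>a. W \<inter> G a)"
  show "\<forall>a. \<forall>w\<in>W. graded_component G a w \<in> W"
  proof (intro allI ballI)
    fix a w assume w: "w \<in> W"
    obtain c where c: "\<And>i. i \<in> UNIV \<Longrightarrow> c i \<in> W \<inter> G i" "finite {i. c i \<noteq> 0}" "w = (\<Sum>i | c i \<noteq> 0. c i)"
      by (rule direct_sumE[OF ds w]) (rule that)
    have "graded_component G a w = c a" by (rule component_unique[OF _ c(2) _ c(3)]) (use c(1) in auto)
    then show "graded_component G a w \<in> W" using c(1) by auto
  qed
next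
  assume st: "\<forall>a. \<forall>w\<in>W. graded_component G a w \<in> W"
  have "\<exists>!c. (\<forall>i. c i \<in> W \<inter> G i) \<and> finite {i. c i \<noteq> 0} \<and> w = (\<Sum>i | c i \<noteq> 0. c i)" if w: "w \<in> W" for w
  proof (rule ex1I[of _ "\<lambda>a. graded_component G a w"])
    show "(\<forall>i. graded_component G i w \<in> W \<inter> G i) \<and> finite {i. graded_component G i w \<noteq> 0} \<and>
        w = (\<Sum>i | graded_component G i w \<noteq> 0. graded_component G i w)"
      using st w component_in finite_components sum_components by simp
  next
    fix c assume c: "(\<forall>i. c i \<in> W \<inter> G i) \<and> finite {i. c i \<noteq> 0} \<and> w = (\<Sum>i | c i \<noteq> 0. c i)"
    show "c = (\<lambda>a. graded_component G a w)"
    proof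
      fix a show "c a = graded_component G a w"
        by (rule component_unique[symmetric, of _ "{i. c i \<noteq> 0}"]) (use c in auto)
    qed
  qed
  then show "direct_sum W UNIV (\<lambda>a. W \<inter> G a)"
    unfolding direct_sum_def using W subspace_homogeneous by (auto intro: subspace_inter)
qed

end

lemma component_homogeneous_operator:
  fixes a b :: "'q::ab_group_add"
  assumes G: "direct_sum UNIV UNIV G" and f: "endo f" and shift: "\<And>c v. v \<in> G c \<Longrightarrow> f v \<in> G (a + c)"
  shows "f (graded_component G b v) = graded_component G (a + b) (f v)"
proof -
  let ?T = "insert b {c. graded_component G c v \<noteq> 0}"
  have T: "finite ?T" using finite_components[OF G] by simp
  have "graded_component G (a + b) (f v) = graded_component G (a + b) (f (\<Sum>c\<in>?T. graded_component G c v))"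
    by (simp only: sum_components_superset[OF G T subset_insertI])
  also have "\<dots> = (\<Sum>c\<in>?T. graded_component G (a + b) (f (graded_component G c v)))"
    by (simp only: endo_sum[OF f] endo_sum[OF endo_component[OF G]])
  also have "\<dots> = (\<Sum>c\<in>?T. if c = b then f (graded_component G b v) else 0)"
    by (rule sum.cong[OF refl])
      (use component_homogeneous[OF G shift[OF component_in[OF G]]] in auto)
  also have "\<dots> = f (graded_component G b v)" using T by simp
  finally show ?thesis by simp
qed

end

section \<open>Graded simple ideals\<close>

lemma projection_graded_lie_algebra_component:
  assumes "graded_lie_algebra s UNIV br grade" and "vector_space.fin_dim s UNIV"
  shows "projection_graded_lie_algebra s br (graded_component grade)"
proof -
  interpret A: graded_lie_algebra s UNIV br grade by fact
  interpret total_lie_algebra s br by unfold_locales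
  note G = A.grading
  show ?thesis
  proof unfold_locales
    show "L.graded_by UNIV (graded_component grade)" by (rule L.graded_by_component[OF G assms(2)])
    show "br (graded_component grade a x) (graded_component grade b y)
        = graded_component grade (a + b) (br (graded_component grade a x) y)" for a b x y
      by (rule L.component_homogeneous_operator[OF G endo_br])
        (rule A.bracket_grade[OF L.component_in[OF G]])
  qed
qed

text \<open>
  The commutators of \<open>J\<close> span a graded ideal of \<open>J\<close>, which is nonzero because \<open>J\<close> is not
  commutative. Homogeneous components of a commutator are sums of commutators of homogeneous
  components.
\<close>

lemma graded_simple_ideal_component:
  assumes "graded_lie_algebra s UNIV br grade" and fd: "vector_space.fin_dim s UNIV"
    and id: "graded_lie_algebra.graded_ideal s UNIV br grade J"
    and simple: "graded_simple_lie_algebra s J br (\<lambda>\<alpha>. J \<inter> grade \<alpha>)"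
  shows "projection_graded_lie_algebra.graded_simple_ideal s br (graded_component grade) J"
proof -
  interpret A: graded_lie_algebra s UNIV br grade by fact
  interpret P: projection_graded_lie_algebra s br "graded_component grade"
    by (rule projection_graded_lie_algebra_component[OF assms(1,2)])
  interpret S: graded_simple_lie_algebra s J br "\<lambda>\<alpha>. J \<inter> grade \<alpha>" by fact
  note G = A.grading and iff = P.L.direct_sum_Int_iff[OF A.grading]
  let ?p = "graded_component grade"
  have sJ: "A.subspace J" and ideal: "\<And>x y. y \<in> J \<Longrightarrow> br x y \<in> J" and gr: "\<And>a y. y \<in> J \<Longrightarrow> ?p a y \<in> J"
    using id iff unfolding A.graded_ideal_def by auto
  have min: "R = {0} \<or> R = J" if R: "A.subspace R" "R \<subseteq> J" "\<And>x y. x \<in> J \<Longrightarrow> y \<in> R \<Longrightarrow> br x y \<in> R"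
    "\<And>a y. y \<in> R \<Longrightarrow> ?p a y \<in> R" for R
  proof (rule S.graded_ideal_trivial)
    have "R \<inter> (J \<inter> grade \<alpha>) = R \<inter> grade \<alpha>" for \<alpha> using R(2) by auto
    then show "S.graded_ideal R" unfolding S.graded_ideal_def using R iff[OF R(1)] by simp
  qed
  let ?D = "{br x y |x y. x \<in> J \<and> y \<in> J}"
  have "A.span ?D = {0} \<or> A.span ?D = J"
  proof (rule min)
    show DJ: "A.span ?D \<subseteq> J" by (rule A.span_minimal[OF _ sJ]) (auto intro: ideal)
    show "br x y \<in> A.span ?D" if "x \<in> J" "y \<in> A.span ?D" for x y
      using that DJ by (intro A.span_base) blast
    have pb: "?p a (br x y) \<in> A.span ?D" if xy: "x \<in> J" "y \<in> J" for a x y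
    proof -
      obtain S where S: "finite S" "\<And>x. x \<in> UNIV \<Longrightarrow> (\<Sum>c\<in>S. ?p c x) = x"
        by (rule P.L.graded_by_sum[OF P.graded_algebra finite.emptyI]) (rule that)
      have "?p a (br x y) = ?p a (\<Sum>c\<in>S. br (?p c x) y)"
      proof -
        have "br (\<Sum>c\<in>T. ?p c x) y = (\<Sum>c\<in>T. br (?p c x) y)" for T
          using P.br_add_left[of 0 0 y]
          by (induction T rule: infinite_finite_induct) (simp_all add: P.br_add_left)
        from this[of S] show ?thesis using S(2) by simp
      qed
      also have "\<dots> = (\<Sum>c\<in>S. br (?p c x) (?p (a - c) y))"
        by (simp add: P.L.endo_sum[OF P.L.endo_component[OF G]] P.br_shift)
      also have "\<dots> \<in> A.span ?D"
        by (intro A.span_sum A.span_base) (use gr xy in blast)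
      finally show ?thesis .
    qed
    show "?p a y \<in> A.span ?D" if "y \<in> A.span ?D" for a y
    proof -
      have "A.span ?D \<subseteq> {y. ?p a y \<in> A.span ?D}"
      proof (rule A.span_minimal)
        show "A.subspace {y. ?p a y \<in> A.span ?D}"
          by (rule module_hom.subspace_linear_preimage[OF P.L.endo_module_hom[OF P.L.endo_component[OF G]]])
            (rule A.subspace_span)
      qed (use pb in auto)
      then show ?thesis using that by auto
    qed
  qed (rule A.subspace_span)
  moreover have "A.span ?D \<noteq> {0}"
    using S.not_commutative A.span_base[of _ ?D] by blast
  ultimately have "P.perfect J" by (simp add: P.perfect_def)
  then show ?thesis
    unfolding P.graded_simple_ideal_def
    using P.L.fin_dim_subset(1)[OF fd sJ] ideal gr min by auto
qed

lemma graded_simple_ideals_span: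
  assumes "graded_semisimple_lie_algebra s UNIV br grade"
  obtains \<J> where "module.span s (\<Union>\<J>) = UNIV"
    "\<And>J. J \<in> \<J> \<Longrightarrow> projection_graded_lie_algebra.graded_simple_ideal s br (graded_component grade) J"
proof -
  interpret A: graded_semisimple_lie_algebra s UNIV br grade by fact
  interpret S: linear_space s by unfold_locales
  obtain n and J :: "nat \<Rightarrow> 'b set" where ds: "A.direct_sum UNIV {..<n} J"
    and J: "\<And>i. i < n \<Longrightarrow> A.graded_ideal (J i) \<and> graded_simple_lie_algebra s (J i) br (\<lambda>\<alpha>. J i \<inter> grade \<alpha>)"
    using A.sum_of_simple_ideals by blast
  show thesis
  proof (rule that[of "J ` {..<n}"])
    have "v \<in> A.span (\<Union> (J ` {..<n}))" for v
    proof -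
      obtain c where c: "\<And>i. i \<in> {..<n} \<Longrightarrow> c i \<in> J i" "\<And>i. i \<notin> {..<n} \<Longrightarrow> c i = 0" "v = (\<Sum>i | c i \<noteq> 0. c i)"
        by (rule S.direct_sumE[OF ds UNIV_I]) (rule that)
      have "c i \<in> \<Union> (J ` {..<n})" if "c i \<noteq> 0" for i using that c(1,2) by blast
      then show ?thesis unfolding c(3) by (intro A.span_sum A.span_base) auto
    qed
    then show "A.span (\<Union> (J ` {..<n})) = UNIV" by blast
    show "projection_graded_lie_algebra.graded_simple_ideal s br (graded_component grade) I"
      if "I \<in> J ` {..<n}" for I
      using that J by (auto intro!: graded_simple_ideal_component A.graded_lie_algebra_axioms A.finite_dimensional)
  qed
qed

section \<open>Complete reducibility\<close>

theorem theorem18: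
  fixes scale :: "'k::{alg_closed_field, field_char_0} \<Rightarrow> 'g::ab_group_add \<Rightarrow> 'g"
    and bracket :: "'g \<Rightarrow> 'g \<Rightarrow> 'g"
    and grade :: "'q::ab_group_add \<Rightarrow> 'g set"
    and scaleV :: "'k \<Rightarrow> 'v::ab_group_add \<Rightarrow> 'v"
    and act :: "'g \<Rightarrow> 'v \<Rightarrow> 'v"
    and gradeV :: "'q \<Rightarrow> 'v set"
  assumes "graded_semisimple_lie_algebra scale UNIV bracket grade"
    and "graded_lie_module scale UNIV bracket grade scaleV UNIV act gradeV"
    and "vector_space.fin_dim scaleV UNIV"
  shows "graded_lie_module.graded_completely_reducible
           scale UNIV bracket grade scaleV UNIV act gradeV"
proof -
  interpret A: graded_semisimple_lie_algebra scale UNIV bracket grade by fact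
  interpret V: graded_lie_module scale UNIV bracket grade scaleV UNIV act gradeV by fact
  interpret VL: linear_space scaleV by unfold_locales
  let ?p = "graded_component grade" and ?P = "graded_component gradeV"
  interpret PG: projection_graded_lie_algebra scale bracket ?p
    by (rule projection_graded_lie_algebra_component[OF A.graded_lie_algebra_axioms A.finite_dimensional])
  note G = A.grading and GV = V.module_grading
  have act_endo: "VL.endo (act x)" for x
    by (simp add: VL.endo_iff V.act_add_right V.act_scale_right)
  interpret R: full_graded_rep scale scaleV bracket ?p act ?P
  proof unfold_locales
    show "VL.graded_by UNIV ?P" by (rule VL.graded_by_component[OF GV assms(3)])
    show "act (?p a x) (?P b u) = ?P (a + b) (act (?p a x) u)" for a b x u
      by (rule VL.component_homogeneous_operator[OF GV act_endo])
        (rule V.act_grade[OF PG.L.component_in[OF G]])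
  qed (simp_all add: assms(3) VL.endo_on_def act_endo V.act_add_left V.act_scale_left V.act_bracket)
  obtain \<J> where \<J>: "A.span (\<Union>\<J>) = UNIV" "\<And>J. J \<in> \<J> \<Longrightarrow> PG.graded_simple_ideal J"
    by (rule graded_simple_ideals_span[OF assms(1)]) (rule that)
  have "R.stable UNIV" by (simp add: R.stable_def)
  then obtain n W where W: "V.vs.direct_sum UNIV {..<n::nat} W" "\<And>i. i < n \<Longrightarrow> R.minimal_stable (W i)"
    using R.stable_decomposition[OF \<J>(2,1)] by blast
  have submodule: "V.graded_submodule W \<longleftrightarrow> R.stable W" for W
    using VL.direct_sum_Int_iff[OF GV, of W] by (auto simp: V.graded_submodule_def R.stable_def)
  have summand: "graded_simple_lie_module scale UNIV bracket grade scaleV W act (\<lambda>\<alpha>. W \<inter> gradeV \<alpha>) \<or>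
      V.trivial_line W"
    if min: "R.minimal_stable W" for W
  proof -
    have W: "R.stable W" "W \<noteq> {0}" "\<And>R. R.stable R \<Longrightarrow> R \<subseteq> W \<Longrightarrow> R = {0} \<or> R = W"
      using min by (auto simp: R.minimal_stable_def)
    then have sW: "V.vs.subspace W" by (simp add: R.stable_def)
    show ?thesis
    proof (cases "\<exists>x. \<exists>w\<in>W. act x w \<noteq> 0")
      case True
      interpret W: graded_lie_module scale UNIV bracket grade scaleV W act "\<lambda>\<alpha>. W \<inter> gradeV \<alpha>"
      proof unfold_locales
        show "V.vs.direct_sum W UNIV (\<lambda>\<alpha>. W \<inter> gradeV \<alpha>)"
          using W(1) submodule by (auto simp: V.graded_submodule_def)
      qed (use W(1) sW in \<open>auto simp: R.stable_def V.act_add_left V.act_add_right V.act_scale_left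
          V.act_scale_right V.act_bracket intro: V.act_grade\<close>)
      have "graded_simple_lie_module scale UNIV bracket grade scaleV W act (\<lambda>\<alpha>. W \<inter> gradeV \<alpha>)"
      proof unfold_locales
        show "\<exists>x\<in>UNIV. \<exists>v\<in>W. act x v \<noteq> 0" using True by simp
        fix R assume R: "W.graded_submodule R"
        then have "R \<subseteq> W" by (simp add: W.graded_submodule_def)
        then have "R \<inter> (W \<inter> gradeV \<alpha>) = R \<inter> gradeV \<alpha>" for \<alpha> by auto
        then have "V.graded_submodule R"
          using R by (simp add: W.graded_submodule_def V.graded_submodule_def)
        then show "R = {0} \<or> R = W" using W(3) \<open>R \<subseteq> W\<close> submodule by blast
      qed
      then show ?thesis by blast
    next
      case False
      obtain w where w: "w \<in> W" "w \<noteq> 0" using W(2) V.vs.subspace_0[OF sW] by blast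
      have "\<exists>a. ?P a w \<noteq> 0"
      proof (rule ccontr)
        assume "\<nexists>a. ?P a w \<noteq> 0"
        then have "{a. ?P a w \<noteq> 0} = {}" by blast
        then show False using VL.sum_components[OF GV, of w] w(2) by simp
      qed
      then obtain a where a: "?P a w \<noteq> 0" by blast
      define u where "u = ?P a w"
      have u: "u \<in> W" "u \<noteq> 0" "\<And>b. ?P b u = (if b = a then u else 0)"
        using W(1) w(1) a VL.component_homogeneous[OF GV VL.component_in[OF GV]]
        by (auto simp: u_def R.stable_def)
      have uW: "V.vs.span {u} \<subseteq> W" using u(1) by (intro V.vs.span_minimal sW) simp
      have "R.stable (V.vs.span {u})"
        unfolding R.stable_def
      proof (intro conjI allI ballI)
        show "V.vs.subspace (V.vs.span {u})" by simp
        show "act x v \<in> V.vs.span {u}" if "v \<in> V.vs.span {u}" for x v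
          using False uW that V.vs.span_zero by auto
        show "?P b v \<in> V.vs.span {u}" if v: "v \<in> V.vs.span {u}" for b v
        proof -
          obtain k where "v = scaleV k u" using v by (auto simp: V.vs.span_singleton)
          then have "?P b v = scaleV k (if b = a then u else 0)"
            using VL.endo_scale[OF VL.endo_component[OF GV]] u(3) by simp
          also have "\<dots> \<in> V.vs.span {u}" by (simp add: V.vs.span_scale V.vs.span_base V.vs.span_zero)
          finally show ?thesis .
        qed
      qed
      then have "V.vs.span {u} = W" using W(3)[OF _ uW] u(2) V.vs.span_base[of u "{u}"] by auto
      then have "V.vs.dim W = 1" using V.vs.dim_span_eq_card_independent[of "{u}"] u(2) by simp
      then show ?thesis using False by (auto simp: V.trivial_line_def)
    qed
  qed
  have "V.graded_submodule (W i)" if "i < n" for i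
    using W(2)[OF that] submodule by (simp add: R.minimal_stable_def)
  then show ?thesis
    unfolding V.graded_completely_reducible_def using W(1) summand[OF W(2)] by blast
qed

end
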